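(* Let $R$ be a commutative ring and let $n$ be a natural number. If $A$ is a retract of $R[[X_1,\ldots,X_n]]$, then there is a finitely generated projective $R$-module $P$ such that $A\cong \hat S(P)$ (as complete augmented $R$-algebras).
   Context: Let $\mathrm{Alg}^c(R)$ be the category of (commutative) augmented $R$-algebras $A\to R$ that are complete in the additive topology of the augmentation ideal $I(A)=\operatorname{Ker}(A\to R)$ (i.e. the canonical map $A\to\varprojlim_k A/I(A)^k$ is an isomorphism); morphisms are the $R$-algebra homomorphisms compatible with the augmentations (hence continuous). The ring $R[[X_1,\ldots,X_n]]$ is an object of this category with augmentation $X_i\mapsto 0$. A retract of $R[[X_1,\ldots,X_n]]$ is an algebra $A\in\mathrm{Alg}^c(R)$ for which there are morphisms $A\to R[[X_1,\ldots,X_n]]\to A$ in $\mathrm{Alg}^c(R)$ whose composite is the identity $\mathbf 1_A$. For an $R$-module $M$, $\hat S(M)$ is the completion of the symmetric algebra $R\oplus M\oplus S^2(M)\oplus\cdots$ with respect to the ideal $0\oplus M\oplus S^2(M)\oplus\cdots$. *)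

theory Defs
  imports "HOL-Algebra.Algebra"
begin

subsection \<open>Augmented algebras\<close>

record ('r, 'a) aug_algebra = "('r, 'a) module" +
  aug :: "'a \<Rightarrow> 'r"

locale augmented_algebra = algebra R A
  for R :: "('r, 'k) ring_scheme" and A :: "('r, 'a, 'l) aug_algebra_scheme" +
  assumes aug_ring_hom: "aug A \<in> ring_hom A R"
    and aug_smult: "\<And>r a. r \<in> carrier R \<Longrightarrow> a \<in> carrier A \<Longrightarrow>
      aug A (r \<odot>\<^bsub>A\<^esub> a) = r \<otimes>\<^bsub>R\<^esub> aug A a"

definition aug_ideal :: "('r, 'k) ring_scheme \<Rightarrow> ('r, 'a, 'l) aug_algebra_scheme \<Rightarrow> 'a set"
  where "aug_ideal R A = a_kernel A R (aug A)"

definition aug_pow ::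
    "('r, 'k) ring_scheme \<Rightarrow> ('r, 'a, 'l) aug_algebra_scheme \<Rightarrow> nat \<Rightarrow> 'a set"
  where "aug_pow R A k = aug_ideal R A [^]\<^bsub>ideals_set A\<^esub> k"

definition aug_hom ::
    "('r, 'k) ring_scheme \<Rightarrow> ('r, 'a, 'l) aug_algebra_scheme \<Rightarrow> ('r, 'b, 'm) aug_algebra_scheme
      \<Rightarrow> ('a \<Rightarrow> 'b) set"
  where "aug_hom R A B = {f \<in> ring_hom A B.
    (\<forall>r \<in> carrier R. \<forall>a \<in> carrier A. f (r \<odot>\<^bsub>A\<^esub> a) = r \<odot>\<^bsub>B\<^esub> f a) \<and>
    (\<forall>a \<in> carrier A. aug B (f a) = aug A a)}"

text \<open>
  Quotient by an ideal contained in the augmentation ideal.  The unions below run over all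
  representatives of a coset, in the style of \<^const>\<open>rcoset_mult\<close>; every
  representative contributes the same coset, and the same augmentation.
\<close>

definition aug_quot ::
    "('r, 'a, 'l) aug_algebra_scheme \<Rightarrow> 'a set \<Rightarrow> ('r, 'a set) aug_algebra"
  where "aug_quot A I =
    \<lparr>carrier = carrier (A Quot I), monoid.mult = monoid.mult (A Quot I),
     monoid.one = \<one>\<^bsub>A Quot I\<^esub>, ring.zero = \<zero>\<^bsub>A Quot I\<^esub>, ring.add = ring.add (A Quot I),
     module.smult = (\<lambda>r C. \<Union>x\<in>C. I +>\<^bsub>A\<^esub> (r \<odot>\<^bsub>A\<^esub> x)),
     aug = (\<lambda>C. the_elem (aug A ` C))\<rparr>"

text \<open>
  The inverse limit of the quotients of \<open>A\<close> by the powers \<open>I\<^sup>k\<close> of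
  its augmentation ideal: compatible families of cosets, where the transition map sends the class
  of \<open>a\<close> modulo \<open>I\<^sup>k\<close> to its class modulo \<open>I\<^sup>j\<close>, \<open>j \<le> k\<close>.  For
  \<open>k = 0\<close> the quotient is zero, so the augmentation is read off at \<open>k = 1\<close>.
\<close>

definition aug_completion ::
    "('r, 'k) ring_scheme \<Rightarrow> ('r, 'a, 'l) aug_algebra_scheme \<Rightarrow> ('r, nat \<Rightarrow> 'a set) aug_algebra"
  where "aug_completion R A = (let Q = (\<lambda>k. aug_quot A (aug_pow R A k)) in
    \<lparr>carrier = {x. (\<forall>k. x k \<in> carrier (Q k)) \<and>
       (\<forall>k. \<forall>j\<le>k. \<forall>a \<in> x k. x j = aug_pow R A j +>\<^bsub>A\<^esub> a)},
     monoid.mult = (\<lambda>x y k. x k \<otimes>\<^bsub>Q k\<^esub> y k),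
     monoid.one = (\<lambda>k. \<one>\<^bsub>Q k\<^esub>), ring.zero = (\<lambda>k. \<zero>\<^bsub>Q k\<^esub>),
     ring.add = (\<lambda>x y k. x k \<oplus>\<^bsub>Q k\<^esub> y k),
     module.smult = (\<lambda>r x k. r \<odot>\<^bsub>Q k\<^esub> x k),
     aug = (\<lambda>x. aug (Q 1) (x 1))\<rparr>)"

definition aug_canonical ::
    "('r, 'k) ring_scheme \<Rightarrow> ('r, 'a, 'l) aug_algebra_scheme \<Rightarrow> 'a \<Rightarrow> nat \<Rightarrow> 'a set"
  where "aug_canonical R A a = (\<lambda>k. aug_pow R A k +>\<^bsub>A\<^esub> a)"

locale complete_augmented_algebra = augmented_algebra R A
  for R :: "('r, 'k) ring_scheme" and A :: "('r, 'a, 'l) aug_algebra_scheme" +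
  assumes canonical_iso: "aug_canonical R A \<in> ring_iso A (aug_completion R A)"

definition complete_aug_isomorphic ::
    "('r, 'k) ring_scheme \<Rightarrow> ('r, 'a, 'l) aug_algebra_scheme \<Rightarrow> ('r, 'b, 'm) aug_algebra_scheme
      \<Rightarrow> bool"
  where "complete_aug_isomorphic R A B \<longleftrightarrow>
    complete_augmented_algebra R A \<and> complete_augmented_algebra R B \<and>
    (\<exists>f \<in> aug_hom R A B. \<exists>g \<in> aug_hom R B A.
      (\<forall>a \<in> carrier A. g (f a) = a) \<and> (\<forall>b \<in> carrier B. f (g b) = b))"

definition complete_aug_retract ::
    "('r, 'k) ring_scheme \<Rightarrow> ('r, 'a, 'l) aug_algebra_scheme \<Rightarrow> ('r, 'b, 'm) aug_algebra_scheme
      \<Rightarrow> bool"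
  where "complete_aug_retract R A B \<longleftrightarrow> complete_augmented_algebra R A \<and>
    (\<exists>s \<in> aug_hom R A B. \<exists>p \<in> aug_hom R B A. \<forall>a \<in> carrier A. p (s a) = a)"


subsection \<open>Power series and polynomials\<close>

text \<open>
  As in \<^theory>\<open>HOL-Algebra.Indexed_Polynomials\<close>, a monomial is a finite multiset of
  variables (the exponent of a variable is its multiplicity) and a series is its coefficient
  function.  Coefficients of monomials that involve other variables than those in
  \<open>V\<close> are zero.
\<close>

definition power_series_algebra ::
    "('r, 'k) ring_scheme \<Rightarrow> 'v set \<Rightarrow> ('r, 'v multiset \<Rightarrow> 'r) aug_algebra"
  where "power_series_algebra R V =
    \<lparr>carrier = {f. (\<forall>m. f m \<in> carrier R) \<and> (\<forall>m. \<not> set_mset m \<subseteq> V \<longrightarrow> f m = \<zero>\<^bsub>R\<^esub>)},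
     monoid.mult = (\<lambda>f g m. \<Oplus>\<^bsub>R\<^esub>a \<in> {a. a \<subseteq># m}. f a \<otimes>\<^bsub>R\<^esub> g (m - a)),
     monoid.one = ring.indexed_const R \<one>\<^bsub>R\<^esub>, ring.zero = ring.indexed_const R \<zero>\<^bsub>R\<^esub>,
     ring.add = (\<lambda>f g m. f m \<oplus>\<^bsub>R\<^esub> g m),
     module.smult = (\<lambda>r f m. r \<otimes>\<^bsub>R\<^esub> f m),
     aug = (\<lambda>f. f {#})\<rparr>"

definition polynomial_algebra ::
    "('r, 'k) ring_scheme \<Rightarrow> 'v set \<Rightarrow> ('r, 'v multiset \<Rightarrow> 'r) aug_algebra"
  where "polynomial_algebra R V = power_series_algebra R V
    \<lparr>carrier := {f \<in> carrier (power_series_algebra R V). finite {m. f m \<noteq> \<zero>\<^bsub>R\<^esub>}}\<rparr>"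


subsection \<open>Modules and symmetric algebras\<close>

definition mod_hom ::
    "('r, 'k) ring_scheme \<Rightarrow> ('r, 'm, 'l) module_scheme \<Rightarrow> ('r, 'n, 'j) module_scheme
      \<Rightarrow> ('m \<Rightarrow> 'n) set"
  where "mod_hom R M N = {f \<in> carrier M \<rightarrow> carrier N.
    (\<forall>x \<in> carrier M. \<forall>y \<in> carrier M. f (x \<oplus>\<^bsub>M\<^esub> y) = f x \<oplus>\<^bsub>N\<^esub> f y) \<and>
    (\<forall>r \<in> carrier R. \<forall>x \<in> carrier M. f (r \<odot>\<^bsub>M\<^esub> x) = r \<odot>\<^bsub>N\<^esub> f x)}"

text \<open>A \<^typ>\<open>('r, 'm) module\<close> has the fields of a ring, but its product and unit play no role.\<close>

definition free_module :: "('r, 'k) ring_scheme \<Rightarrow> 'x set \<Rightarrow> ('r, 'x \<Rightarrow> 'r) module"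
  where "free_module R B =
    \<lparr>carrier = {f. (\<forall>x. f x \<in> carrier R) \<and> (\<forall>x. x \<notin> B \<longrightarrow> f x = \<zero>\<^bsub>R\<^esub>) \<and>
       finite {x. f x \<noteq> \<zero>\<^bsub>R\<^esub>}},
     monoid.mult = undefined, monoid.one = undefined,
     ring.zero = (\<lambda>x. \<zero>\<^bsub>R\<^esub>), ring.add = (\<lambda>f g x. f x \<oplus>\<^bsub>R\<^esub> g x),
     module.smult = (\<lambda>r f x. r \<otimes>\<^bsub>R\<^esub> f x)\<rparr>"

definition finitely_generated_module ::
    "('r, 'k) ring_scheme \<Rightarrow> ('r, 'm, 'l) module_scheme \<Rightarrow> bool"
  where "finitely_generated_module R M \<longleftrightarrow> module R M \<and>
    (\<exists>S. finite S \<and> S \<subseteq> carrier M \<and>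
      (\<forall>x \<in> carrier M. \<exists>c \<in> S \<rightarrow> carrier R. x = (\<Oplus>\<^bsub>M\<^esub>s\<in>S. c s \<odot>\<^bsub>M\<^esub> s)))"

text \<open>
  A module is projective if it is a direct summand of a free module.  Restricting the index set
  of the free module to the type of elements of \<open>M\<close> loses nothing: if \<open>M\<close> is a summand of
  any free module, then it is one of the free module on the set \<open>carrier M\<close>.  Up to
  isomorphism every finitely generated projective module is a submodule of some \<open>R\<^sup>k\<close>,
  hence occurs with elements of type \<^typ>\<open>nat \<Rightarrow> 'r\<close>.
\<close>

definition projective_module ::
    "('r, 'k) ring_scheme \<Rightarrow> ('r, 'm, 'l) module_scheme \<Rightarrow> bool"
  where "projective_module R M \<longleftrightarrow> module R M \<and>
    (\<exists>B :: 'm set. \<exists>s \<in> mod_hom R M (free_module R B). \<exists>p \<in> mod_hom R (free_module R B) M.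
      \<forall>x \<in> carrier M. p (s x) = x)"

text \<open>
  The symmetric algebra is the free commutative algebra on symbols \<open>v(x)\<close>, one for each
  element \<open>x\<close> of \<open>M\<close>, modulo the relations saying that \<open>x \<mapsto> v(x)\<close> is linear.
  The relations are homogeneous of degree one, whence the grading by \<open>S\<^sup>k(M)\<close>.  The
  augmentation is the projection to degree zero, with kernel
  \<open>0 \<oplus> M \<oplus> S\<^sup>2(M) \<oplus> \<dots>\<close>.
\<close>

definition symmetric_relations ::
    "('r, 'k) ring_scheme \<Rightarrow> ('r, 'm, 'l) module_scheme \<Rightarrow> ('m multiset \<Rightarrow> 'r) set"
  where "symmetric_relations R M =
    (let F = polynomial_algebra R (carrier M); v = ring.indexed_var R in
      {v (x \<oplus>\<^bsub>M\<^esub> y) \<ominus>\<^bsub>F\<^esub> (v x \<oplus>\<^bsub>F\<^esub> v y) | x y. x \<in> carrier M \<and> y \<in> carrier M} \<union>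
      {v (r \<odot>\<^bsub>M\<^esub> x) \<ominus>\<^bsub>F\<^esub> (r \<odot>\<^bsub>F\<^esub> v x) | r x. r \<in> carrier R \<and> x \<in> carrier M})"

definition symmetric_algebra ::
    "('r, 'k) ring_scheme \<Rightarrow> ('r, 'm, 'l) module_scheme
      \<Rightarrow> ('r, ('m multiset \<Rightarrow> 'r) set) aug_algebra"
  where "symmetric_algebra R M = (let F = polynomial_algebra R (carrier M) in
    aug_quot F (Idl\<^bsub>F\<^esub> (symmetric_relations R M)))"

definition completed_symmetric_algebra ::
    "('r, 'k) ring_scheme \<Rightarrow> ('r, 'm, 'l) module_scheme
      \<Rightarrow> ('r, nat \<Rightarrow> ('m multiset \<Rightarrow> 'r) set set) aug_algebra"
  where "completed_symmetric_algebra R M = aug_completion R (symmetric_algebra R M)"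

end

theory Submission
  imports Defs
begin

text \<open>
  Let \<open>B = R[[X\<^sub>1,\<dots>,X\<^sub>n]]\<close> with augmentation ideal \<open>J\<close>, let \<open>I\<close> be the augmentation ideal of
  \<open>A\<close>, and let \<open>s : A \<rightarrow> B\<close> and \<open>p : B \<rightarrow> A\<close> satisfy \<open>p \<circ> s = 1\<close>.  The cotangent module
  \<open>I/I\<^sup>2\<close> is a direct summand of \<open>J/J\<^sup>2 = R\<^sup>n\<close>.  It is realised inside \<open>R\<^sup>n\<close> as the module \<open>P\<close> of
  the linear parts of the series \<open>s(a)\<close>, \<open>a \<in> I\<close>.  The linear parts of the series
  \<open>s(p(X\<^sub>i))\<close> together with the coordinate functions are a dual basis of \<open>P\<close>
  (\<open>cotangent_expand\<close>), so \<open>P\<close> is finitely generated and projective.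

  For \<open>y \<in> P\<close> let \<open>\<ell>\<^sub>y = \<Sum>\<^sub>i y\<^sub>i X\<^sub>i\<close>.  The linear map \<open>y \<mapsto> p(\<ell>\<^sub>y)\<close> from \<open>P\<close> to \<open>I\<close> extends to an
  algebra homomorphism \<open>f : S \<rightarrow> A\<close> on the symmetric algebra \<open>S\<close> of \<open>P\<close>, with augmentation
  ideal \<open>I\<^sub>S\<close>.  It induces an isomorphism \<open>S/I\<^sub>S\<^sup>k \<rightarrow> A/I\<^sup>k\<close> for every \<open>k\<close>, and since \<open>A\<close> is the
  inverse limit of the \<open>A/I\<^sup>k\<close>, it is isomorphic to the completion of \<open>S\<close>
  (\<open>isomorphic_aug_completionI\<close>).

  Surjectivity (\<open>to_A_dense\<close>): for \<open>a \<in> I\<close> with \<open>y\<close> the linear part of \<open>s(a)\<close>, the difference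
  \<open>\<ell>\<^sub>y - s(a)\<close> lies in \<open>J\<^sup>2\<close>, hence \<open>p(\<ell>\<^sub>y) - a\<close> lies in \<open>I\<^sup>2\<close>.  So \<open>f(I\<^sub>S)\<close> exhausts \<open>I\<close> modulo \<open>I\<^sup>2\<close>,
  and taking products, \<open>f(I\<^sub>S\<^sup>k)\<close> exhausts \<open>I\<^sup>k\<close> modulo \<open>I\<^sup>k\<^sup>+\<^sup>1\<close>.

  Injectivity (\<open>to_A_strict\<close>): \<open>y \<mapsto> \<ell>\<^sub>y\<close> extends to a homomorphism \<open>e : S \<rightarrow> R[X\<^sub>1,\<dots>,X\<^sub>n]\<close>, and
  mapping \<open>X\<^sub>i\<close> to the \<open>i\<close>-th vector of the dual basis gives a homomorphism \<open>h\<close> back with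
  \<open>h \<circ> e = 1\<close>.  The homomorphisms \<open>s \<circ> f\<close> and \<open>e\<close> from \<open>S\<close> to \<open>B\<close> agree up to terms of degree at
  least \<open>2\<close> on the generators, because \<open>s \<circ> p\<close> fixes the elements of \<open>P\<close> modulo \<open>J\<^sup>2\<close>.  Their
  difference is a twisted derivation, so it takes \<open>I\<^sub>S\<^sup>j\<close> to series without terms of degree
  \<open>\<le> j\<close> (\<open>deviation_vanishes\<close>).  If \<open>x \<in> I\<^sub>S\<^sup>j\<close> and \<open>f(x) \<in> I\<^sup>j\<^sup>+\<^sup>1\<close>, then \<open>e(x)\<close> therefore has no
  terms of degree \<open>\<le> j\<close> either, and \<open>x = h(e(x))\<close> lies in \<open>I\<^sub>S\<^sup>j\<^sup>+\<^sup>1\<close>.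
\<close>

section \<open>Augmented algebras and powers of the augmentation ideal\<close>

lemma aug_homI:
  assumes "\<And>x. x \<in> carrier A \<Longrightarrow> f x \<in> carrier B"
    and "\<And>x y. x \<in> carrier A \<Longrightarrow> y \<in> carrier A \<Longrightarrow> f (x \<otimes>\<^bsub>A\<^esub> y) = f x \<otimes>\<^bsub>B\<^esub> f y"
    and "\<And>x y. x \<in> carrier A \<Longrightarrow> y \<in> carrier A \<Longrightarrow> f (x \<oplus>\<^bsub>A\<^esub> y) = f x \<oplus>\<^bsub>B\<^esub> f y"
    and "f \<one>\<^bsub>A\<^esub> = \<one>\<^bsub>B\<^esub>"
    and "\<And>r x. r \<in> carrier R \<Longrightarrow> x \<in> carrier A \<Longrightarrow> f (r \<odot>\<^bsub>A\<^esub> x) = r \<odot>\<^bsub>B\<^esub> f x"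
    and "\<And>x. x \<in> carrier A \<Longrightarrow> aug B (f x) = aug A x"
  shows "f \<in> aug_hom R A B"
  using assms unfolding aug_hom_def by (auto intro!: ring_hom_memI)

lemma aug_homD:
  assumes "f \<in> aug_hom R A B"
  shows "x \<in> carrier A \<Longrightarrow> f x \<in> carrier B"
    and "x \<in> carrier A \<Longrightarrow> y \<in> carrier A \<Longrightarrow> f (x \<otimes>\<^bsub>A\<^esub> y) = f x \<otimes>\<^bsub>B\<^esub> f y"
    and "x \<in> carrier A \<Longrightarrow> y \<in> carrier A \<Longrightarrow> f (x \<oplus>\<^bsub>A\<^esub> y) = f x \<oplus>\<^bsub>B\<^esub> f y"
    and "f \<one>\<^bsub>A\<^esub> = \<one>\<^bsub>B\<^esub>"
    and "r \<in> carrier R \<Longrightarrow> x \<in> carrier A \<Longrightarrow> f (r \<odot>\<^bsub>A\<^esub> x) = r \<odot>\<^bsub>B\<^esub> f x"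
    and "x \<in> carrier A \<Longrightarrow> aug B (f x) = aug A x"
  using assms unfolding aug_hom_def
  by (auto simp: ring_hom_closed ring_hom_mult ring_hom_add ring_hom_one)

lemma aug_hom_comp:
  assumes "f \<in> aug_hom R A B" "g \<in> aug_hom R B C"
  shows "(\<lambda>x. g (f x)) \<in> aug_hom R A C"
  by (rule aug_homI) (simp_all add: aug_homD[OF assms(1)] aug_homD[OF assms(2)])

lemma augmented_algebraI:
  assumes "algebra R A"
    and "\<And>x. x \<in> carrier A \<Longrightarrow> aug A x \<in> carrier R"
    and "\<And>x y. x \<in> carrier A \<Longrightarrow> y \<in> carrier A \<Longrightarrow> aug A (x \<otimes>\<^bsub>A\<^esub> y) = aug A x \<otimes>\<^bsub>R\<^esub> aug A y"
    and "\<And>x y. x \<in> carrier A \<Longrightarrow> y \<in> carrier A \<Longrightarrow> aug A (x \<oplus>\<^bsub>A\<^esub> y) = aug A x \<oplus>\<^bsub>R\<^esub> aug A y"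
    and "aug A \<one>\<^bsub>A\<^esub> = \<one>\<^bsub>R\<^esub>"
    and "\<And>r x. r \<in> carrier R \<Longrightarrow> x \<in> carrier A \<Longrightarrow> aug A (r \<odot>\<^bsub>A\<^esub> x) = r \<otimes>\<^bsub>R\<^esub> aug A x"
  shows "augmented_algebra R A"
  using assms by (auto intro!: augmented_algebra.intro augmented_algebra_axioms.intro ring_hom_memI)

lemma cring_augmented_algebra: "augmented_algebra R A \<Longrightarrow> cring A"
  by (rule algebra.M_cring[OF augmented_algebra.axioms(1)])

lemma augD:
  assumes "augmented_algebra R A"
  shows "x \<in> carrier A \<Longrightarrow> aug A x \<in> carrier R"
    and "x \<in> carrier A \<Longrightarrow> y \<in> carrier A \<Longrightarrow> aug A (x \<otimes>\<^bsub>A\<^esub> y) = aug A x \<otimes>\<^bsub>R\<^esub> aug A y"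
    and "x \<in> carrier A \<Longrightarrow> y \<in> carrier A \<Longrightarrow> aug A (x \<oplus>\<^bsub>A\<^esub> y) = aug A x \<oplus>\<^bsub>R\<^esub> aug A y"
    and "aug A \<one>\<^bsub>A\<^esub> = \<one>\<^bsub>R\<^esub>"
    and "r \<in> carrier R \<Longrightarrow> x \<in> carrier A \<Longrightarrow> aug A (r \<odot>\<^bsub>A\<^esub> x) = r \<otimes>\<^bsub>R\<^esub> aug A x"
  using augmented_algebra.aug_ring_hom[OF assms] augmented_algebra.aug_smult[OF assms]
  by (auto simp: ring_hom_closed ring_hom_mult ring_hom_add ring_hom_one)

text \<open>
  All axioms pass to the image of \<open>h\<close>, so \<open>C\<close> only has to be a structure with operations.  This
  turns quotients and completions into augmented algebras without checking their axioms one by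
  one.  Preservation of zero is a separate hypothesis because it follows from additivity only
  when \<open>C\<close> is already known to be a group.
\<close>
lemma augmented_algebra_image:
  assumes A: "augmented_algebra R A"
    and h: "h \<in> aug_hom R A C" and surj: "h ` carrier A = carrier C"
    and zero: "h \<zero>\<^bsub>A\<^esub> = \<zero>\<^bsub>C\<^esub>"
  shows "augmented_algebra R C"
proof -
  interpret A': cring A by (rule cring_augmented_algebra[OF A])
  interpret A: augmented_algebra R A by (rule A)
  note hD = aug_homD[OF h]
  have lift: "\<exists>a\<in>carrier A. x = h a" if "x \<in> carrier C" for x
    using that surj by blast
  note hs = hD(2,3)[symmetric] hD(4)[symmetric] hD(5)[symmetric] zero[symmetric]
  have grp: "abelian_group C"
  proof (rule abelian_groupI)
    fix x y assume "x \<in> carrier C" "y \<in> carrier C"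
    then obtain a b where "a \<in> carrier A" "b \<in> carrier A" "x = h a" "y = h b" using lift by metis
    then show "x \<oplus>\<^bsub>C\<^esub> y \<in> carrier C" "x \<oplus>\<^bsub>C\<^esub> y = y \<oplus>\<^bsub>C\<^esub> x"
      by (simp_all add: hs hD(1) A'.a_comm)
  next
    fix x assume "x \<in> carrier C"
    then obtain a where a: "a \<in> carrier A" "x = h a" using lift by metis
    then show "\<zero>\<^bsub>C\<^esub> \<oplus>\<^bsub>C\<^esub> x = x" by (simp add: hs)
    have "h (\<ominus>\<^bsub>A\<^esub> a) \<oplus>\<^bsub>C\<^esub> x = \<zero>\<^bsub>C\<^esub>" using a by (simp add: hs A'.l_neg)
    then show "\<exists>y\<in>carrier C. y \<oplus>\<^bsub>C\<^esub> x = \<zero>\<^bsub>C\<^esub>" using a hD(1) by blast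
  next
    fix x y z assume "x \<in> carrier C" "y \<in> carrier C" "z \<in> carrier C"
    then obtain a b c where "a \<in> carrier A" "b \<in> carrier A" "c \<in> carrier A" "x = h a" "y = h b" "z = h c"
      using lift by metis
    then show "x \<oplus>\<^bsub>C\<^esub> y \<oplus>\<^bsub>C\<^esub> z = x \<oplus>\<^bsub>C\<^esub> (y \<oplus>\<^bsub>C\<^esub> z)"
      by (simp add: hs A'.a_assoc)
  qed (auto simp: zero[symmetric] hD(1))
  have mon: "comm_monoid C"
  proof (rule comm_monoidI)
    fix x y assume "x \<in> carrier C" "y \<in> carrier C"
    then obtain a b where "a \<in> carrier A" "b \<in> carrier A" "x = h a" "y = h b" using lift by metis
    then show "x \<otimes>\<^bsub>C\<^esub> y \<in> carrier C" "x \<otimes>\<^bsub>C\<^esub> y = y \<otimes>\<^bsub>C\<^esub> x"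
      by (simp_all add: hs hD(1) A'.m_comm)
  next
    fix x assume "x \<in> carrier C"
    then obtain a where a: "a \<in> carrier A" "x = h a" using lift by metis
    then show "\<one>\<^bsub>C\<^esub> \<otimes>\<^bsub>C\<^esub> x = x" by (simp add: hs)
  next
    fix x y z assume "x \<in> carrier C" "y \<in> carrier C" "z \<in> carrier C"
    then obtain a b c where "a \<in> carrier A" "b \<in> carrier A" "c \<in> carrier A" "x = h a" "y = h b" "z = h c"
      using lift by metis
    then show "x \<otimes>\<^bsub>C\<^esub> y \<otimes>\<^bsub>C\<^esub> z = x \<otimes>\<^bsub>C\<^esub> (y \<otimes>\<^bsub>C\<^esub> z)"
      by (simp add: hs A'.m_assoc)
  qed (auto simp: hs hD(1))
  have cr: "cring C"
  proof (rule cringI[OF grp mon])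
    fix x y z assume "x \<in> carrier C" "y \<in> carrier C" "z \<in> carrier C"
    then obtain a b c where "a \<in> carrier A" "b \<in> carrier A" "c \<in> carrier A" "x = h a" "y = h b" "z = h c"
      using lift by metis
    then show "(x \<oplus>\<^bsub>C\<^esub> y) \<otimes>\<^bsub>C\<^esub> z = x \<otimes>\<^bsub>C\<^esub> z \<oplus>\<^bsub>C\<^esub> y \<otimes>\<^bsub>C\<^esub> z"
      by (simp add: hs A'.l_distr)
  qed
  have alg: "algebra R C"
  proof (rule algebraI[OF A.R_cring cr])
    fix r x assume r: "r \<in> carrier R" and "x \<in> carrier C"
    then obtain a where a: "a \<in> carrier A" "x = h a" using lift by metis
    with r show "r \<odot>\<^bsub>C\<^esub> x \<in> carrier C" by (simp add: hs hD(1))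
    fix t assume t: "t \<in> carrier R"
    show "(r \<oplus>\<^bsub>R\<^esub> t) \<odot>\<^bsub>C\<^esub> x = r \<odot>\<^bsub>C\<^esub> x \<oplus>\<^bsub>C\<^esub> t \<odot>\<^bsub>C\<^esub> x"
      using r t a by (simp add: hs A.smult_l_distr)
    show "(r \<otimes>\<^bsub>R\<^esub> t) \<odot>\<^bsub>C\<^esub> x = r \<odot>\<^bsub>C\<^esub> (t \<odot>\<^bsub>C\<^esub> x)"
      using r t a by (simp add: hs A.smult_assoc1)
  next
    fix r x y assume r: "r \<in> carrier R" and "x \<in> carrier C" "y \<in> carrier C"
    then obtain a b where "a \<in> carrier A" "b \<in> carrier A" "x = h a" "y = h b" using lift by metis
    then show "r \<odot>\<^bsub>C\<^esub> (x \<oplus>\<^bsub>C\<^esub> y) = r \<odot>\<^bsub>C\<^esub> x \<oplus>\<^bsub>C\<^esub> r \<odot>\<^bsub>C\<^esub> y"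
      "r \<odot>\<^bsub>C\<^esub> x \<otimes>\<^bsub>C\<^esub> y = r \<odot>\<^bsub>C\<^esub> (x \<otimes>\<^bsub>C\<^esub> y)"
      using r by (simp_all add: hs A.smult_r_distr A.smult_assoc2)
  next
    fix x assume "x \<in> carrier C"
    then obtain a where a: "a \<in> carrier A" "x = h a" using lift by metis
    then show "\<one>\<^bsub>R\<^esub> \<odot>\<^bsub>C\<^esub> x = x" by (simp add: hs)
  qed
  show ?thesis
  proof (rule augmented_algebraI[OF alg])
    fix x assume "x \<in> carrier C"
    then obtain a where a: "a \<in> carrier A" "x = h a" using lift by metis
    then show "aug C x \<in> carrier R" by (simp add: hD(6) augD[OF A])
    fix r assume "r \<in> carrier R"
    with a show "aug C (r \<odot>\<^bsub>C\<^esub> x) = r \<otimes>\<^bsub>R\<^esub> aug C x" by (simp add: hs hD(6) augD[OF A])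
  next
    fix x y assume "x \<in> carrier C" "y \<in> carrier C"
    then obtain a b where "a \<in> carrier A" "b \<in> carrier A" "x = h a" "y = h b" using lift by metis
    then show "aug C (x \<otimes>\<^bsub>C\<^esub> y) = aug C x \<otimes>\<^bsub>R\<^esub> aug C y" "aug C (x \<oplus>\<^bsub>C\<^esub> y) = aug C x \<oplus>\<^bsub>R\<^esub> aug C y"
      by (simp_all add: hs hD(6) augD[OF A])
  qed (simp add: hs hD(6) augD[OF A])
qed

context augmented_algebra
begin

lemma ring_A: "ring A" using M_cring cring.axioms(1) by blast

lemma mem_aug_ideal: "a \<in> aug_ideal R A \<longleftrightarrow> a \<in> carrier A \<and> aug A a = \<zero>\<^bsub>R\<^esub>"
  unfolding aug_ideal_def a_kernel_def kernel_def by simp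

lemma aug_ring_hom_ring: "ring_hom_ring A R (aug A)"
  using aug_ring_hom ring_A cring.axioms(1)[OF R_cring] by (rule ring_hom_ringI2[rotated 2])

lemma aug_zero: "aug A \<zero>\<^bsub>A\<^esub> = \<zero>\<^bsub>R\<^esub>"
  using ring_hom_zero[OF aug_ring_hom ring_A cring.axioms(1)[OF R_cring]] .

lemma ideal_aug_ideal: "ideal (aug_ideal R A) A"
  unfolding aug_ideal_def by (rule ring_hom_ring.kernel_is_ideal[OF aug_ring_hom_ring])

lemma aug_pow_0: "aug_pow R A 0 = carrier A"
  unfolding aug_pow_def by (simp add: nat_pow_def ideals_set_def)

lemma aug_pow_Suc: "aug_pow R A (Suc k) = ideal_prod A (aug_pow R A k) (aug_ideal R A)"
  unfolding aug_pow_def by (simp add: nat_pow_def ideals_set_def)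

lemma ideal_aug_pow: "ideal (aug_pow R A k) A"
proof (induction k)
  case 0 then show ?case by (simp add: aug_pow_0 ring.oneideal[OF ring_A])
next
  case (Suc k) then show ?case
    by (simp add: aug_pow_Suc ring.ideal_prod_is_ideal[OF ring_A] ideal_aug_ideal)
qed

lemma aug_pow_1: "aug_pow R A (Suc 0) = aug_ideal R A"
proof -
  have "monoid (ideals_set A)"
    using cring.ideals_set_is_comm_monoid[OF M_cring] comm_monoid.axioms(1) by blast
  then show ?thesis unfolding aug_pow_def
    using ideal_aug_ideal monoid.nat_pow_eone[of "ideals_set A"]
    by (simp add: ideals_set_def)
qed

lemma aug_pow_subset: "aug_pow R A k \<subseteq> carrier A"
  using additive_subgroup.a_subset[OF ideal.axioms(1)[OF ideal_aug_pow]] .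

lemma aug_pow_carrier: "x \<in> aug_pow R A k \<Longrightarrow> x \<in> carrier A"
  using aug_pow_subset by blast

lemma aug_pow_closed:
  "x \<in> aug_pow R A k \<Longrightarrow> y \<in> aug_pow R A k \<Longrightarrow> x \<oplus>\<^bsub>A\<^esub> y \<in> aug_pow R A k"
  "x \<in> aug_pow R A k \<Longrightarrow> \<ominus>\<^bsub>A\<^esub> x \<in> aug_pow R A k"
  "x \<in> aug_pow R A k \<Longrightarrow> y \<in> aug_pow R A k \<Longrightarrow> x \<ominus>\<^bsub>A\<^esub> y \<in> aug_pow R A k"
  "\<zero>\<^bsub>A\<^esub> \<in> aug_pow R A k"
  "x \<in> aug_pow R A k \<Longrightarrow> y \<in> carrier A \<Longrightarrow> y \<otimes>\<^bsub>A\<^esub> x \<in> aug_pow R A k"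
  "x \<in> aug_pow R A k \<Longrightarrow> y \<in> carrier A \<Longrightarrow> x \<otimes>\<^bsub>A\<^esub> y \<in> aug_pow R A k"
proof -
  interpret I: ideal "aug_pow R A k" A by (rule ideal_aug_pow)
  show "x \<in> aug_pow R A k \<Longrightarrow> y \<in> aug_pow R A k \<Longrightarrow> x \<oplus>\<^bsub>A\<^esub> y \<in> aug_pow R A k"
    "x \<in> aug_pow R A k \<Longrightarrow> \<ominus>\<^bsub>A\<^esub> x \<in> aug_pow R A k"
    "\<zero>\<^bsub>A\<^esub> \<in> aug_pow R A k"
    "x \<in> aug_pow R A k \<Longrightarrow> y \<in> carrier A \<Longrightarrow> y \<otimes>\<^bsub>A\<^esub> x \<in> aug_pow R A k"
    "x \<in> aug_pow R A k \<Longrightarrow> y \<in> carrier A \<Longrightarrow> x \<otimes>\<^bsub>A\<^esub> y \<in> aug_pow R A k"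
    by (auto simp: I.I_l_closed I.I_r_closed)
  then show "x \<in> aug_pow R A k \<Longrightarrow> y \<in> aug_pow R A k \<Longrightarrow> x \<ominus>\<^bsub>A\<^esub> y \<in> aug_pow R A k"
    by (simp add: a_minus_def)
qed

lemma aug_pow_Suc_subset: "aug_pow R A (Suc k) \<subseteq> aug_pow R A k"
  using ring.ideal_prod_inter[OF ring_A ideal_aug_pow ideal_aug_ideal] by (auto simp: aug_pow_Suc)

lemma aug_pow_antimono: "j \<le> k \<Longrightarrow> aug_pow R A k \<subseteq> aug_pow R A j"
  by (rule lift_Suc_antimono_le[of "aug_pow R A"]) (rule aug_pow_Suc_subset)

lemma aug_pow_mult_Suc:
  "x \<in> aug_pow R A k \<Longrightarrow> y \<in> aug_ideal R A \<Longrightarrow> x \<otimes>\<^bsub>A\<^esub> y \<in> aug_pow R A (Suc k)"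
  by (simp add: aug_pow_Suc ideal_prod.prod)

lemma aug_pow_mult_Suc_Suc:
  assumes "x \<in> aug_pow R A k" "y \<in> aug_pow R A (Suc (Suc 0))"
  shows "x \<otimes>\<^bsub>A\<^esub> y \<in> aug_pow R A (Suc (Suc k))"
proof -
  have x: "x \<in> carrier A" using assms aug_pow_carrier by blast
  have "y \<in> ideal_prod A (aug_ideal R A) (aug_ideal R A)"
    using assms(2) by (simp add: aug_pow_Suc[of "Suc 0"] aug_pow_1)
  then show ?thesis
  proof (induction y rule: ideal_prod.induct)
    case (prod i j)
    then show ?case using x
      by (metis m_assoc aug_pow_mult_Suc assms(1) mem_aug_ideal)
  next
    case (sum s1 s2)
    have "s1 \<in> carrier A" "s2 \<in> carrier A"
      using sum(1,2) ring.ideal_prod_in_carrier[OF ring_A ideal_aug_ideal ideal_aug_ideal] by auto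
    then show ?case using sum x by (simp add: r_distr aug_pow_closed)
  qed
qed

lemma smult_eq_mult: "r \<in> carrier R \<Longrightarrow> x \<in> carrier A \<Longrightarrow> r \<odot>\<^bsub>A\<^esub> x = (r \<odot>\<^bsub>A\<^esub> \<one>\<^bsub>A\<^esub>) \<otimes>\<^bsub>A\<^esub> x"
  by (simp add: smult_assoc2)

end

lemma aug_hom_ring_hom_cring:
  assumes "augmented_algebra R A" "augmented_algebra R B" "f \<in> aug_hom R A B"
  shows "ring_hom_cring A B f"
proof -
  interpret A: augmented_algebra R A by fact
  interpret B: augmented_algebra R B by fact
  show ?thesis
    using A.M_cring B.M_cring assms(3) unfolding aug_hom_def
    by (auto intro!: ring_hom_cring.intro ring_hom_cring_axioms.intro)
qed

lemma aug_hom_aug_pow: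
  assumes "augmented_algebra R A" "augmented_algebra R B" "f \<in> aug_hom R A B" "x \<in> aug_pow R A k"
  shows "f x \<in> aug_pow R B k"
  using assms(4)
proof (induction k arbitrary: x)
  case 0
  interpret A: augmented_algebra R A by fact
  interpret B: augmented_algebra R B by fact
  note f = aug_homD[OF assms(3)]
  from 0 show ?case by (simp add: A.aug_pow_0 B.aug_pow_0 f)
next
  case (Suc k)
  interpret A: augmented_algebra R A by fact
  interpret B: augmented_algebra R B by fact
  note f = aug_homD[OF assms(3)]
  from Suc.prems have "x \<in> ideal_prod A (aug_pow R A k) (aug_ideal R A)"
    by (simp add: A.aug_pow_Suc)
  then show ?case
  proof (induction x rule: ideal_prod.induct)
    case (prod i j)
    have j: "f j \<in> aug_ideal R B" using prod(2) by (simp add: A.mem_aug_ideal B.mem_aug_ideal f)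
    have c: "i \<in> carrier A" "j \<in> carrier A" using prod A.aug_pow_carrier A.mem_aug_ideal by auto
    show ?case using B.aug_pow_mult_Suc[OF Suc.IH[OF prod(1)] j] c by (simp add: f)
  next
    case (sum s1 s2)
    have "s1 \<in> carrier A" "s2 \<in> carrier A"
      using sum(1,2) ring.ideal_prod_in_carrier[OF A.ring_A A.ideal_aug_pow A.ideal_aug_ideal] by auto
    then show ?case using sum by (simp add: f B.aug_pow_closed)
  qed
qed

section \<open>Quotients and the completion\<close>

context augmented_algebra
begin

lemma ideal_smult_closed:
  assumes "ideal K A" "r \<in> carrier R" "x \<in> K"
  shows "r \<odot>\<^bsub>A\<^esub> x \<in> K"
  using assms smult_eq_mult[of r x] ideal.Icarr[OF assms(1)] ideal.I_l_closed[OF assms(1)]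
  by simp

lemma smult_diff:
  "r \<in> carrier R \<Longrightarrow> x \<in> carrier A \<Longrightarrow> y \<in> carrier A \<Longrightarrow>
    r \<odot>\<^bsub>A\<^esub> (x \<ominus>\<^bsub>A\<^esub> y) = r \<odot>\<^bsub>A\<^esub> x \<ominus>\<^bsub>A\<^esub> r \<odot>\<^bsub>A\<^esub> y"
  by (simp add: a_minus_def smult_r_distr smult_r_minus)

lemma coset_eq_iff:
  assumes "ideal K A" "x \<in> carrier A" "y \<in> carrier A"
  shows "K +>\<^bsub>A\<^esub> x = K +>\<^bsub>A\<^esub> y \<longleftrightarrow> x \<ominus>\<^bsub>A\<^esub> y \<in> K"
proof -
  interpret K: ideal K A by fact
  have "x \<ominus>\<^bsub>A\<^esub> y \<in> K \<longleftrightarrow> x \<in> K +>\<^bsub>A\<^esub> y"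
    using K.a_rcos_module_minus[OF ring_A assms(3,2)] by simp
  then show ?thesis
    using K.a_rcos_self[OF assms(2)] K.a_repr_independence'[of x y] assms by metis
qed

lemma mem_coset_iff:
  assumes "ideal K A" "x \<in> carrier A"
  shows "y \<in> K +>\<^bsub>A\<^esub> x \<longleftrightarrow> y \<in> carrier A \<and> y \<ominus>\<^bsub>A\<^esub> x \<in> K"
proof -
  interpret K: ideal K A by fact
  show ?thesis
    using K.a_rcos_module_minus[OF ring_A assms(2)] K.a_elemrcos_carrier[OF assms(2)] by blast
qed

lemma aug_quot_carrier: "carrier (aug_quot A K) = {K +>\<^bsub>A\<^esub> x | x. x \<in> carrier A}"
  unfolding aug_quot_def FactRing_def A_RCOSETS_def' by auto

text \<open>
  Operations on cosets are computed on representatives.  The union that defines the scalar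
  product is constant because an ideal is closed under scalars (\<open>ideal_smult_closed\<close>).
\<close>
lemma aug_quot_simps:
  assumes "ideal K A"
  shows "x \<in> carrier A \<Longrightarrow> y \<in> carrier A \<Longrightarrow>
      (K +>\<^bsub>A\<^esub> x) \<otimes>\<^bsub>aug_quot A K\<^esub> (K +>\<^bsub>A\<^esub> y) = K +>\<^bsub>A\<^esub> (x \<otimes>\<^bsub>A\<^esub> y)"
    and "x \<in> carrier A \<Longrightarrow> y \<in> carrier A \<Longrightarrow>
      (K +>\<^bsub>A\<^esub> x) \<oplus>\<^bsub>aug_quot A K\<^esub> (K +>\<^bsub>A\<^esub> y) = K +>\<^bsub>A\<^esub> (x \<oplus>\<^bsub>A\<^esub> y)"
    and "r \<in> carrier R \<Longrightarrow> x \<in> carrier A \<Longrightarrow>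
      r \<odot>\<^bsub>aug_quot A K\<^esub> (K +>\<^bsub>A\<^esub> x) = K +>\<^bsub>A\<^esub> (r \<odot>\<^bsub>A\<^esub> x)"
    and "\<one>\<^bsub>aug_quot A K\<^esub> = K +>\<^bsub>A\<^esub> \<one>\<^bsub>A\<^esub>"
    and "\<zero>\<^bsub>aug_quot A K\<^esub> = K +>\<^bsub>A\<^esub> \<zero>\<^bsub>A\<^esub>"
proof -
  interpret K: ideal K A by fact
  show "x \<in> carrier A \<Longrightarrow> y \<in> carrier A \<Longrightarrow>
      (K +>\<^bsub>A\<^esub> x) \<otimes>\<^bsub>aug_quot A K\<^esub> (K +>\<^bsub>A\<^esub> y) = K +>\<^bsub>A\<^esub> (x \<otimes>\<^bsub>A\<^esub> y)"
    by (simp add: aug_quot_def FactRing_def K.rcoset_mult_add)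
  show "x \<in> carrier A \<Longrightarrow> y \<in> carrier A \<Longrightarrow>
      (K +>\<^bsub>A\<^esub> x) \<oplus>\<^bsub>aug_quot A K\<^esub> (K +>\<^bsub>A\<^esub> y) = K +>\<^bsub>A\<^esub> (x \<oplus>\<^bsub>A\<^esub> y)"
    by (simp add: aug_quot_def FactRing_def K.a_rcos_sum)
  show "\<one>\<^bsub>aug_quot A K\<^esub> = K +>\<^bsub>A\<^esub> \<one>\<^bsub>A\<^esub>"
    by (simp add: aug_quot_def FactRing_def)
  show "\<zero>\<^bsub>aug_quot A K\<^esub> = K +>\<^bsub>A\<^esub> \<zero>\<^bsub>A\<^esub>"
    by (simp add: aug_quot_def FactRing_def K.a_subset)
  assume r: "r \<in> carrier R" and x: "x \<in> carrier A"
  have "K +>\<^bsub>A\<^esub> (r \<odot>\<^bsub>A\<^esub> y) = K +>\<^bsub>A\<^esub> (r \<odot>\<^bsub>A\<^esub> x)" if "y \<in> K +>\<^bsub>A\<^esub> x" for y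
    using that x r ideal_smult_closed[OF assms r, of "y \<ominus>\<^bsub>A\<^esub> x"]
    by (simp add: mem_coset_iff[OF assms] coset_eq_iff[OF assms] smult_diff)
  moreover have "x \<in> K +>\<^bsub>A\<^esub> x" using x by (rule K.a_rcos_self)
  ultimately have "(\<Union>y \<in> K +>\<^bsub>A\<^esub> x. K +>\<^bsub>A\<^esub> (r \<odot>\<^bsub>A\<^esub> y)) = K +>\<^bsub>A\<^esub> (r \<odot>\<^bsub>A\<^esub> x)"
    by blast
  then show "r \<odot>\<^bsub>aug_quot A K\<^esub> (K +>\<^bsub>A\<^esub> x) = K +>\<^bsub>A\<^esub> (r \<odot>\<^bsub>A\<^esub> x)"
    by (simp add: aug_quot_def)
qed

lemma aug_diff: "x \<in> carrier A \<Longrightarrow> y \<in> carrier A \<Longrightarrow> aug A (x \<ominus>\<^bsub>A\<^esub> y) = aug A x \<ominus>\<^bsub>R\<^esub> aug A y"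
proof -
  interpret aug: ring_hom_ring A R "aug A" by (rule aug_ring_hom_ring)
  show "x \<in> carrier A \<Longrightarrow> y \<in> carrier A \<Longrightarrow> ?thesis" by (simp add: a_minus_def)
qed

lemma aug_eq_iff: "x \<in> carrier A \<Longrightarrow> y \<in> carrier A \<Longrightarrow>
    x \<ominus>\<^bsub>A\<^esub> y \<in> aug_ideal R A \<longleftrightarrow> aug A x = aug A y"
  using augD(1)[OF augmented_algebra_axioms]
  by (simp add: mem_aug_ideal aug_diff)

lemma aug_quot_aug:
  assumes "ideal K A" "K \<subseteq> aug_ideal R A" "x \<in> carrier A"
  shows "aug (aug_quot A K) (K +>\<^bsub>A\<^esub> x) = aug A x"
proof -
  interpret K: ideal K A by fact
  have "aug A ` (K +>\<^bsub>A\<^esub> x) = {aug A x}"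
    using assms aug_eq_iff K.a_rcos_self[OF assms(3)] by (auto simp: mem_coset_iff)
  then show ?thesis by (simp add: aug_quot_def)
qed

lemma aug_quot_proj:
  assumes "ideal K A" "K \<subseteq> aug_ideal R A"
  shows "(\<lambda>x. K +>\<^bsub>A\<^esub> x) \<in> aug_hom R A (aug_quot A K)"
  by (rule aug_homI) (auto simp: aug_quot_simps[OF assms(1)] aug_quot_aug[OF assms] aug_quot_carrier)

lemma augmented_algebra_aug_quot:
  assumes "ideal K A" "K \<subseteq> aug_ideal R A"
  shows "augmented_algebra R (aug_quot A K)"
  using augmented_algebra_axioms aug_quot_proj[OF assms]
  by (rule augmented_algebra_image) (auto simp: aug_quot_carrier aug_quot_simps[OF assms(1)])

text \<open>The factorisation through the quotient exists because \<open>f\<close> is constant on each coset.\<close>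
lemma aug_quot_lift:
  assumes T: "augmented_algebra R T" and K: "ideal K A" "K \<subseteq> aug_ideal R A"
    and f: "f \<in> aug_hom R A T" and ker: "\<And>x. x \<in> K \<Longrightarrow> f x = \<zero>\<^bsub>T\<^esub>"
  shows "\<exists>g \<in> aug_hom R (aug_quot A K) T. \<forall>x \<in> carrier A. g (K +>\<^bsub>A\<^esub> x) = f x"
proof -
  interpret K: ideal K A by fact
  interpret f: ring_hom_cring A T f
    by (rule aug_hom_ring_hom_cring[OF augmented_algebra_axioms T f])
  define g where "g C = the_elem (f ` C)" for C
  have g: "g (K +>\<^bsub>A\<^esub> x) = f x" if x: "x \<in> carrier A" for x
  proof -
    have "f y = f x" if "y \<in> K +>\<^bsub>A\<^esub> x" for y
    proof -
      have y: "y \<in> carrier A" "y \<ominus>\<^bsub>A\<^esub> x \<in> K" using that x by (simp_all add: mem_coset_iff[OF K(1)])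
      have "f y \<ominus>\<^bsub>T\<^esub> f x = \<zero>\<^bsub>T\<^esub>" using ker[OF y(2)] x y(1) by (simp add: a_minus_def)
      then show ?thesis using x y(1) by simp
    qed
    then have "f ` (K +>\<^bsub>A\<^esub> x) = {f x}" using K.a_rcos_self[OF x] by blast
    then show ?thesis by (simp add: g_def)
  qed
  have "g \<in> aug_hom R (aug_quot A K) T"
    by (rule aug_homI)
      (auto simp: aug_quot_carrier aug_quot_simps[OF K(1)] aug_quot_aug[OF K] g aug_homD[OF f])
  with g show ?thesis by blast
qed

end

text \<open>
  Completeness in terms of elements.  A compatible family of cosets amounts to a sequence of
  representatives, so the two clauses are the injectivity and the surjectivity of the canonical
  map to the inverse limit of the quotients.
\<close>
definition sequentially_complete ::
    "('r, 'k) ring_scheme \<Rightarrow> ('r, 'a, 'l) aug_algebra_scheme \<Rightarrow> bool"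
  where "sequentially_complete R A \<longleftrightarrow>
    (\<forall>a \<in> carrier A. (\<forall>k. a \<in> aug_pow R A k) \<longrightarrow> a = \<zero>\<^bsub>A\<^esub>) \<and>
    (\<forall>x. (\<forall>k. x k \<in> carrier A) \<longrightarrow> (\<forall>k. \<forall>j\<le>k. x k \<ominus>\<^bsub>A\<^esub> x j \<in> aug_pow R A j) \<longrightarrow>
      (\<exists>a \<in> carrier A. \<forall>k. x k \<ominus>\<^bsub>A\<^esub> a \<in> aug_pow R A k))"

lemma sequentially_complete_limit:
  assumes "sequentially_complete R A" "\<And>k. x k \<in> carrier A"
    and "\<And>k j. j \<le> k \<Longrightarrow> x k \<ominus>\<^bsub>A\<^esub> x j \<in> aug_pow R A j"
  obtains a where "a \<in> carrier A" "\<And>k. x k \<ominus>\<^bsub>A\<^esub> a \<in> aug_pow R A k"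
proof -
  have "\<exists>a \<in> carrier A. \<forall>k. x k \<ominus>\<^bsub>A\<^esub> a \<in> aug_pow R A k"
    using assms(1)[unfolded sequentially_complete_def, THEN conjunct2, rule_format, of x] assms(2,3)
    by blast
  then show ?thesis using that by blast
qed

context augmented_algebra
begin

lemma aug_completion_carrier:
  "c \<in> carrier (aug_completion R A) \<longleftrightarrow>
    (\<exists>x. (\<forall>k. x k \<in> carrier A) \<and> (\<forall>k. \<forall>j\<le>k. x k \<ominus>\<^bsub>A\<^esub> x j \<in> aug_pow R A j) \<and>
      c = (\<lambda>k. aug_pow R A k +>\<^bsub>A\<^esub> x k))"
proof
  assume "c \<in> carrier (aug_completion R A)"
  then have c: "\<And>k. c k \<in> carrier (aug_quot A (aug_pow R A k))"
    and comp: "\<And>k j a. j \<le> k \<Longrightarrow> a \<in> c k \<Longrightarrow> c j = aug_pow R A j +>\<^bsub>A\<^esub> a"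
    by (auto simp: aug_completion_def)
  from c have "\<forall>k. \<exists>x. x \<in> carrier A \<and> c k = aug_pow R A k +>\<^bsub>A\<^esub> x"
    by (fastforce simp: aug_quot_carrier)
  then obtain x where x: "\<And>k. x k \<in> carrier A" "\<And>k. c k = aug_pow R A k +>\<^bsub>A\<^esub> x k" by metis
  have "x k \<in> c k" for k
    using x abelian_subgroup.a_rcos_self[OF abelian_subgroupI3[OF ideal.axioms(1)[OF ideal_aug_pow] is_abelian_group]] by auto
  then have "x k \<ominus>\<^bsub>A\<^esub> x j \<in> aug_pow R A j" if "j \<le> k" for k j
    using comp[OF that, of "x k"] x coset_eq_iff[OF ideal_aug_pow, of "x j" "x k" j]
    by (metis coset_eq_iff[OF ideal_aug_pow])
  with x show "\<exists>x. (\<forall>k. x k \<in> carrier A) \<and> (\<forall>k. \<forall>j\<le>k. x k \<ominus>\<^bsub>A\<^esub> x j \<in> aug_pow R A j) \<and>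
      c = (\<lambda>k. aug_pow R A k +>\<^bsub>A\<^esub> x k)" by blast
next
  assume "\<exists>x. (\<forall>k. x k \<in> carrier A) \<and> (\<forall>k. \<forall>j\<le>k. x k \<ominus>\<^bsub>A\<^esub> x j \<in> aug_pow R A j) \<and>
      c = (\<lambda>k. aug_pow R A k +>\<^bsub>A\<^esub> x k)"
  then obtain x where x: "\<And>k. x k \<in> carrier A"
    "\<And>k j. j \<le> k \<Longrightarrow> x k \<ominus>\<^bsub>A\<^esub> x j \<in> aug_pow R A j"
    and c: "c = (\<lambda>k. aug_pow R A k +>\<^bsub>A\<^esub> x k)" by blast
  have "aug_pow R A j +>\<^bsub>A\<^esub> x j = aug_pow R A j +>\<^bsub>A\<^esub> a"
    if "j \<le> k" "a \<in> aug_pow R A k +>\<^bsub>A\<^esub> x k" for j k a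
  proof -
    have a: "a \<in> carrier A" "a \<ominus>\<^bsub>A\<^esub> x k \<in> aug_pow R A j"
      using that x(1) aug_pow_antimono[OF that(1)] by (auto simp: mem_coset_iff[OF ideal_aug_pow])
    have "aug_pow R A j +>\<^bsub>A\<^esub> a = aug_pow R A j +>\<^bsub>A\<^esub> x k"
      using a x(1) by (simp add: coset_eq_iff[OF ideal_aug_pow])
    also have "\<dots> = aug_pow R A j +>\<^bsub>A\<^esub> x j"
      using x that(1) by (simp add: coset_eq_iff[OF ideal_aug_pow])
    finally show ?thesis by simp
  qed
  then show "c \<in> carrier (aug_completion R A)"
    using x(1) unfolding c aug_completion_def by (auto simp: aug_quot_carrier)
qed

lemma aug_completion_one_zero:
  "\<one>\<^bsub>aug_completion R A\<^esub> = (\<lambda>k. aug_pow R A k +>\<^bsub>A\<^esub> \<one>\<^bsub>A\<^esub>)"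
  "\<zero>\<^bsub>aug_completion R A\<^esub> = (\<lambda>k. aug_pow R A k +>\<^bsub>A\<^esub> \<zero>\<^bsub>A\<^esub>)"
  by (simp_all add: aug_completion_def aug_quot_simps[OF ideal_aug_pow])

lemma aug_completion_smult_aug:
  assumes "\<And>k. x k \<in> carrier A"
  shows "r \<in> carrier R \<Longrightarrow> r \<odot>\<^bsub>aug_completion R A\<^esub> (\<lambda>k. aug_pow R A k +>\<^bsub>A\<^esub> x k) =
      (\<lambda>k. aug_pow R A k +>\<^bsub>A\<^esub> (r \<odot>\<^bsub>A\<^esub> x k))"
    and "aug (aug_completion R A) (\<lambda>k. aug_pow R A k +>\<^bsub>A\<^esub> x k) = aug A (x 1)"
  using assms
  by (simp_all add: aug_completion_def aug_quot_simps[OF ideal_aug_pow] aug_pow_1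
      aug_quot_aug[OF ideal_aug_ideal order_refl])

lemma aug_completion_mult_add:
  assumes "\<And>k. x k \<in> carrier A" "\<And>k. y k \<in> carrier A"
  shows "(\<lambda>k. aug_pow R A k +>\<^bsub>A\<^esub> x k) \<otimes>\<^bsub>aug_completion R A\<^esub> (\<lambda>k. aug_pow R A k +>\<^bsub>A\<^esub> y k) =
      (\<lambda>k. aug_pow R A k +>\<^bsub>A\<^esub> (x k \<otimes>\<^bsub>A\<^esub> y k))"
    and "(\<lambda>k. aug_pow R A k +>\<^bsub>A\<^esub> x k) \<oplus>\<^bsub>aug_completion R A\<^esub> (\<lambda>k. aug_pow R A k +>\<^bsub>A\<^esub> y k) =
      (\<lambda>k. aug_pow R A k +>\<^bsub>A\<^esub> (x k \<oplus>\<^bsub>A\<^esub> y k))"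
  using assms by (simp_all add: aug_completion_def aug_quot_simps[OF ideal_aug_pow])

lemmas aug_completion_simps =
  aug_completion_one_zero aug_completion_smult_aug aug_completion_mult_add

lemma complete_iff_sequentially_complete:
  "complete_augmented_algebra R A \<longleftrightarrow> sequentially_complete R A"
proof -
  have diff: "x \<ominus>\<^bsub>A\<^esub> x = \<zero>\<^bsub>A\<^esub>" if "x \<in> carrier A" for x using that by (simp add: a_minus_def r_neg)
  have hom: "aug_canonical R A \<in> ring_hom A (aug_completion R A)"
  proof (rule ring_hom_memI)
    fix x assume x: "x \<in> carrier A"
    show "aug_canonical R A x \<in> carrier (aug_completion R A)"
      unfolding aug_completion_carrier aug_canonical_def
      using x by (intro exI[of _ "\<lambda>_. x"]) (simp add: diff aug_pow_closed)
  qed (simp_all add: aug_canonical_def aug_completion_simps)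
  have inj: "inj_on (aug_canonical R A) (carrier A) \<longleftrightarrow>
    (\<forall>a \<in> carrier A. (\<forall>k. a \<in> aug_pow R A k) \<longrightarrow> a = \<zero>\<^bsub>A\<^esub>)"
  proof -
    have eq: "aug_canonical R A x = aug_canonical R A y \<longleftrightarrow> (\<forall>k. x \<ominus>\<^bsub>A\<^esub> y \<in> aug_pow R A k)"
      if "x \<in> carrier A" "y \<in> carrier A" for x y
      using that by (auto simp: aug_canonical_def fun_eq_iff coset_eq_iff[OF ideal_aug_pow])
    show ?thesis
    proof (intro iffI ballI impI)
      fix a assume "inj_on (aug_canonical R A) (carrier A)" "a \<in> carrier A" "\<forall>k. a \<in> aug_pow R A k"
      then show "a = \<zero>\<^bsub>A\<^esub>"
        using eq[of a "\<zero>\<^bsub>A\<^esub>"] by (simp add: inj_on_def a_minus_def)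
    next
      assume *: "\<forall>a \<in> carrier A. (\<forall>k. a \<in> aug_pow R A k) \<longrightarrow> a = \<zero>\<^bsub>A\<^esub>"
      show "inj_on (aug_canonical R A) (carrier A)"
      proof (rule inj_onI)
        fix x y assume xy: "x \<in> carrier A" "y \<in> carrier A" "aug_canonical R A x = aug_canonical R A y"
        then have "x \<ominus>\<^bsub>A\<^esub> y = \<zero>\<^bsub>A\<^esub>" using * eq[of x y] by simp
        then show "x = y" using xy by simp
      qed
    qed
  qed
  have surj: "carrier (aug_completion R A) \<subseteq> aug_canonical R A ` carrier A \<longleftrightarrow>
    (\<forall>x. (\<forall>k. x k \<in> carrier A) \<longrightarrow> (\<forall>k. \<forall>j\<le>k. x k \<ominus>\<^bsub>A\<^esub> x j \<in> aug_pow R A j) \<longrightarrow>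
      (\<exists>a \<in> carrier A. \<forall>k. x k \<ominus>\<^bsub>A\<^esub> a \<in> aug_pow R A k))"
  proof -
    have eq: "(\<lambda>k. aug_pow R A k +>\<^bsub>A\<^esub> x k) = aug_canonical R A a \<longleftrightarrow>
      (\<forall>k. x k \<ominus>\<^bsub>A\<^esub> a \<in> aug_pow R A k)" if "\<And>k. x k \<in> carrier A" "a \<in> carrier A" for x a
      using that by (auto simp: aug_canonical_def fun_eq_iff coset_eq_iff[OF ideal_aug_pow])
    show ?thesis
    proof (intro iffI allI impI subsetI)
      fix x assume s: "carrier (aug_completion R A) \<subseteq> aug_canonical R A ` carrier A"
        and x: "\<forall>k. x k \<in> carrier A" "\<forall>k. \<forall>j\<le>k. x k \<ominus>\<^bsub>A\<^esub> x j \<in> aug_pow R A j"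
      then have "(\<lambda>k. aug_pow R A k +>\<^bsub>A\<^esub> x k) \<in> aug_canonical R A ` carrier A"
        by (auto simp: aug_completion_carrier subset_iff)
      then show "\<exists>a \<in> carrier A. \<forall>k. x k \<ominus>\<^bsub>A\<^esub> a \<in> aug_pow R A k"
        using eq[of x] x by auto
    next
      fix c assume *: "\<forall>x. (\<forall>k. x k \<in> carrier A) \<longrightarrow> (\<forall>k. \<forall>j\<le>k. x k \<ominus>\<^bsub>A\<^esub> x j \<in> aug_pow R A j) \<longrightarrow>
        (\<exists>a \<in> carrier A. \<forall>k. x k \<ominus>\<^bsub>A\<^esub> a \<in> aug_pow R A k)"
        and "c \<in> carrier (aug_completion R A)"
      then obtain x where x: "\<forall>k. x k \<in> carrier A" "\<forall>k. \<forall>j\<le>k. x k \<ominus>\<^bsub>A\<^esub> x j \<in> aug_pow R A j"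
        "c = (\<lambda>k. aug_pow R A k +>\<^bsub>A\<^esub> x k)" unfolding aug_completion_carrier by blast
      with * obtain a where "a \<in> carrier A" "\<forall>k. x k \<ominus>\<^bsub>A\<^esub> a \<in> aug_pow R A k" by blast
      then show "c \<in> aug_canonical R A ` carrier A" using eq[of x a] x by auto
    qed
  qed
  have "complete_augmented_algebra R A \<longleftrightarrow> aug_canonical R A \<in> ring_iso A (aug_completion R A)"
    unfolding complete_augmented_algebra_def complete_augmented_algebra_axioms_def
    using augmented_algebra_axioms by blast
  also have "\<dots> \<longleftrightarrow> inj_on (aug_canonical R A) (carrier A) \<and>
      carrier (aug_completion R A) \<subseteq> aug_canonical R A ` carrier A"
    using hom ring_hom_closed[OF hom] unfolding ring_iso_def bij_betw_def by auto
  finally show ?thesis unfolding inj surj sequentially_complete_def .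
qed

end

text \<open>
  The target \<open>C\<close> is a bare structure.  That it is an augmented algebra and that it is complete
  are both inherited from \<open>A\<close> along the bijection.
\<close>
lemma complete_augmented_algebra_transport:
  assumes A: "complete_augmented_algebra R A"
    and h: "h \<in> aug_hom R A C" and bij: "bij_betw h (carrier A) (carrier C)"
    and zero: "h \<zero>\<^bsub>A\<^esub> = \<zero>\<^bsub>C\<^esub>"
  shows "complete_aug_isomorphic R A C"
proof -
  interpret A: complete_augmented_algebra R A by fact
  have aA: "augmented_algebra R A" ..
  have aC: "augmented_algebra R C"
    using aA h _ zero by (rule augmented_algebra_image) (use bij in \<open>simp add: bij_betw_def\<close>)
  interpret C: augmented_algebra R C by (rule aC)
  define g where "g = inv_into (carrier A) h"
  have g: "g y \<in> carrier A" "h (g y) = y" if "y \<in> carrier C" for y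
    using bij that unfolding g_def bij_betw_def
    by (simp_all add: inv_into_into f_inv_into_f)
  have gh: "g (h x) = x" if "x \<in> carrier A" for x
    using bij that unfolding g_def bij_betw_def by simp
  have g_hom: "g \<in> aug_hom R C A"
  proof (rule aug_homI)
    fix x y assume "x \<in> carrier C" "y \<in> carrier C"
    then show "g (x \<otimes>\<^bsub>C\<^esub> y) = g x \<otimes>\<^bsub>A\<^esub> g y" "g (x \<oplus>\<^bsub>C\<^esub> y) = g x \<oplus>\<^bsub>A\<^esub> g y"
      using g gh[of "g x \<otimes>\<^bsub>A\<^esub> g y"] gh[of "g x \<oplus>\<^bsub>A\<^esub> g y"] by (simp_all add: aug_homD[OF h])
  next
    fix r x assume "r \<in> carrier R" "x \<in> carrier C"
    then show "g (r \<odot>\<^bsub>C\<^esub> x) = r \<odot>\<^bsub>A\<^esub> g x"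
      using g gh[of "r \<odot>\<^bsub>A\<^esub> g x"] by (simp add: aug_homD[OF h])
  next
    fix x assume "x \<in> carrier C"
    then show "aug A (g x) = aug C x" using g aug_homD(6)[OF h, of "g x"] by simp
  qed (use g gh[of "\<one>\<^bsub>A\<^esub>"] in \<open>simp_all add: aug_homD[OF h]\<close>)
  interpret h: ring_hom_cring A C h by (rule aug_hom_ring_hom_cring[OF aA aC h])
  interpret g: ring_hom_cring C A g by (rule aug_hom_ring_hom_cring[OF aC aA g_hom])
  have sA: "sequentially_complete R A"
    using A.complete_iff_sequentially_complete assms(1) by blast
  have "sequentially_complete R C"
    unfolding sequentially_complete_def
  proof (intro conjI ballI allI impI)
    fix c assume c: "c \<in> carrier C" "\<forall>k. c \<in> aug_pow R C k"
    then have "\<forall>k. g c \<in> aug_pow R A k" using aug_hom_aug_pow[OF aC aA g_hom] by blast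
    then have "g c = \<zero>\<^bsub>A\<^esub>" using sA g(1)[OF c(1)] unfolding sequentially_complete_def by blast
    then show "c = \<zero>\<^bsub>C\<^esub>" using g(2)[OF c(1)] zero by simp
  next
    fix x assume x: "\<forall>k. x k \<in> carrier C" "\<forall>k. \<forall>j\<le>k. x k \<ominus>\<^bsub>C\<^esub> x j \<in> aug_pow R C j"
    have cauchy: "g (x k) \<ominus>\<^bsub>A\<^esub> g (x j) \<in> aug_pow R A j" if "j \<le> k" for j k
      using aug_hom_aug_pow[OF aC aA g_hom, of "x k \<ominus>\<^bsub>C\<^esub> x j" j] x that by (simp add: a_minus_def)
    obtain a where a: "a \<in> carrier A" "\<And>k. g (x k) \<ominus>\<^bsub>A\<^esub> a \<in> aug_pow R A k"
      by (rule sequentially_complete_limit[OF sA, of "\<lambda>k. g (x k)", OF _ cauchy]) (use x(1) g(1) in auto)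
    have "x k \<ominus>\<^bsub>C\<^esub> h a \<in> aug_pow R C k" for k
      using aug_hom_aug_pow[OF aA aC h a(2)] x a(1) g by (simp add: a_minus_def)
    then show "\<exists>a \<in> carrier C. \<forall>k. x k \<ominus>\<^bsub>C\<^esub> a \<in> aug_pow R C k" using a(1) by blast
  qed
  then have "complete_augmented_algebra R C" using C.complete_iff_sequentially_complete by blast
  then show ?thesis
    unfolding complete_aug_isomorphic_def using assms(1) h g_hom gh g(2) by blast
qed

text \<open>
  The hypotheses on \<open>f\<close> say that it induces surjective and injective maps from \<open>S/I(S)\<^sup>k\<close> to
  \<open>A/I(A)\<^sup>k\<close>.  The isomorphism sends \<open>a\<close> to the family of cosets of elements whose images
  approximate \<open>a\<close>.  The completion of an arbitrary augmented algebra need not be complete in the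
  powers of its own augmentation ideal; here its completeness comes from that of \<open>A\<close>.
\<close>
theorem isomorphic_aug_completionI:
  assumes A: "complete_augmented_algebra R A" and S: "augmented_algebra R S"
    and f: "f \<in> aug_hom R S A"
    and dense: "\<And>a k. a \<in> carrier A \<Longrightarrow> \<exists>x \<in> carrier S. f x \<ominus>\<^bsub>A\<^esub> a \<in> aug_pow R A k"
    and strict: "\<And>x k. x \<in> carrier S \<Longrightarrow> f x \<in> aug_pow R A k \<Longrightarrow> x \<in> aug_pow R S k"
  shows "complete_aug_isomorphic R A (aug_completion R S)"
proof -
  interpret A: complete_augmented_algebra R A by fact
  interpret S: augmented_algebra R S by fact
  have aA: "augmented_algebra R A" ..
  interpret f: ring_hom_cring S A f by (rule aug_hom_ring_hom_cring[OF S aA f])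
  have sA: "sequentially_complete R A"
    using A.complete_iff_sequentially_complete A by blast
  note cos = S.coset_eq_iff[OF S.ideal_aug_pow]
  have telescope: "x \<ominus>\<^bsub>A\<^esub> z \<in> aug_pow R A k"
    if "x \<ominus>\<^bsub>A\<^esub> y \<in> aug_pow R A k" "y \<ominus>\<^bsub>A\<^esub> z \<in> aug_pow R A k"
      "x \<in> carrier A" "y \<in> carrier A" "z \<in> carrier A" for x y z k
  proof -
    have "x \<ominus>\<^bsub>A\<^esub> z = (x \<ominus>\<^bsub>A\<^esub> y) \<oplus>\<^bsub>A\<^esub> (y \<ominus>\<^bsub>A\<^esub> z)" using that(3-) by algebra
    then show ?thesis using that A.aug_pow_closed(1) by metis
  qed
  have flip: "y \<ominus>\<^bsub>A\<^esub> x \<in> aug_pow R A k"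
    if "x \<ominus>\<^bsub>A\<^esub> y \<in> aug_pow R A k" "x \<in> carrier A" "y \<in> carrier A" for x y k
  proof -
    have "y \<ominus>\<^bsub>A\<^esub> x = \<ominus>\<^bsub>A\<^esub> (x \<ominus>\<^bsub>A\<^esub> y)" using that(2-) by algebra
    then show ?thesis using that A.aug_pow_closed(2) by metis
  qed
  have fdiff: "f (x \<ominus>\<^bsub>S\<^esub> y) = f x \<ominus>\<^bsub>A\<^esub> f y" if "x \<in> carrier S" "y \<in> carrier S" for x y
    using that by (simp add: a_minus_def)
  \<comment> \<open>an element of \<open>S\<close> that approximates \<open>a\<close> modulo the \<open>k\<close>-th power; \<open>F_eq\<close> below says that
      the coset does not depend on the choice\<close>
  define pre where "pre a k = (SOME x. x \<in> carrier S \<and> f x \<ominus>\<^bsub>A\<^esub> a \<in> aug_pow R A k)" for a k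
  have pre: "pre a k \<in> carrier S" "f (pre a k) \<ominus>\<^bsub>A\<^esub> a \<in> aug_pow R A k" if "a \<in> carrier A" for a k
    using someI_ex[of "\<lambda>x. x \<in> carrier S \<and> f x \<ominus>\<^bsub>A\<^esub> a \<in> aug_pow R A k"] dense[OF that, of k]
    unfolding pre_def by blast+
  define F where "F a = (\<lambda>k. aug_pow R S k +>\<^bsub>S\<^esub> pre a k)" for a
  have F_eq: "F a = (\<lambda>k. aug_pow R S k +>\<^bsub>S\<^esub> x k)"
    if a: "a \<in> carrier A" and x: "\<And>k. x k \<in> carrier S" "\<And>k. f (x k) \<ominus>\<^bsub>A\<^esub> a \<in> aug_pow R A k" for a x
  proof -
    have "f (pre a k \<ominus>\<^bsub>S\<^esub> x k) \<in> aug_pow R A k" for k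
      using telescope[OF pre(2)[OF a, of k] flip[OF x(2)]] pre(1)[OF a] x(1) a by (simp add: fdiff)
    then show ?thesis
      unfolding F_def using pre(1)[OF a] x(1) by (simp add: fun_eq_iff cos strict)
  qed
  have F_carrier: "F a \<in> carrier (aug_completion R S)" if a: "a \<in> carrier A" for a
  proof -
    have "pre a k \<ominus>\<^bsub>S\<^esub> pre a j \<in> aug_pow R S j" if "j \<le> k" for j k
    proof (rule strict)
      have "f (pre a k) \<ominus>\<^bsub>A\<^esub> a \<in> aug_pow R A j" using pre(2)[OF a] A.aug_pow_antimono[OF that] by blast
      then show "f (pre a k \<ominus>\<^bsub>S\<^esub> pre a j) \<in> aug_pow R A j"
        using telescope[OF _ flip[OF pre(2)[OF a, of j]]] pre(1)[OF a] a by (simp add: fdiff)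
    qed (use pre(1)[OF a] in simp)
    then show ?thesis
      unfolding S.aug_completion_carrier F_def using pre(1)[OF a] by blast
  qed
  have F_hom: "F \<in> aug_hom R A (aug_completion R S)"
  proof (rule aug_homI)
    fix a b assume ab: "a \<in> carrier A" "b \<in> carrier A"
    have "f (pre a k \<otimes>\<^bsub>S\<^esub> pre b k) \<ominus>\<^bsub>A\<^esub> (a \<otimes>\<^bsub>A\<^esub> b) \<in> aug_pow R A k" for k
    proof -
      have c: "f (pre a k) \<in> carrier A" "f (pre b k) \<in> carrier A" using pre(1) ab by auto
      have "f (pre a k) \<otimes>\<^bsub>A\<^esub> f (pre b k) \<ominus>\<^bsub>A\<^esub> (a \<otimes>\<^bsub>A\<^esub> b) =
        (f (pre a k) \<ominus>\<^bsub>A\<^esub> a) \<otimes>\<^bsub>A\<^esub> f (pre b k) \<oplus>\<^bsub>A\<^esub> a \<otimes>\<^bsub>A\<^esub> (f (pre b k) \<ominus>\<^bsub>A\<^esub> b)"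
        using ab c by algebra
      then show ?thesis using pre ab c by (simp add: A.aug_pow_closed)
    qed
    then show "F (a \<otimes>\<^bsub>A\<^esub> b) = F a \<otimes>\<^bsub>aug_completion R S\<^esub> F b"
      using ab pre(1) F_eq[of "a \<otimes>\<^bsub>A\<^esub> b" "\<lambda>k. pre a k \<otimes>\<^bsub>S\<^esub> pre b k"]
      by (simp add: F_def S.aug_completion_simps)
    have "f (pre a k \<oplus>\<^bsub>S\<^esub> pre b k) \<ominus>\<^bsub>A\<^esub> (a \<oplus>\<^bsub>A\<^esub> b) \<in> aug_pow R A k" for k
    proof -
      have c: "f (pre a k) \<in> carrier A" "f (pre b k) \<in> carrier A" using pre(1) ab by auto
      have "f (pre a k) \<oplus>\<^bsub>A\<^esub> f (pre b k) \<ominus>\<^bsub>A\<^esub> (a \<oplus>\<^bsub>A\<^esub> b) =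
        (f (pre a k) \<ominus>\<^bsub>A\<^esub> a) \<oplus>\<^bsub>A\<^esub> (f (pre b k) \<ominus>\<^bsub>A\<^esub> b)"
        using ab c by algebra
      then show ?thesis using pre ab c by (simp add: A.aug_pow_closed)
    qed
    then show "F (a \<oplus>\<^bsub>A\<^esub> b) = F a \<oplus>\<^bsub>aug_completion R S\<^esub> F b"
      using ab pre(1) F_eq[of "a \<oplus>\<^bsub>A\<^esub> b" "\<lambda>k. pre a k \<oplus>\<^bsub>S\<^esub> pre b k"]
      by (simp add: F_def S.aug_completion_simps)
  next
    fix r a assume ra: "r \<in> carrier R" "a \<in> carrier A"
    have "f (r \<odot>\<^bsub>S\<^esub> pre a k) \<ominus>\<^bsub>A\<^esub> (r \<odot>\<^bsub>A\<^esub> a) \<in> aug_pow R A k" for k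
      using ra pre A.ideal_smult_closed[OF A.ideal_aug_pow ra(1) pre(2)[OF ra(2)], of k]
      by (simp add: aug_homD[OF f] A.smult_diff)
    then show "F (r \<odot>\<^bsub>A\<^esub> a) = r \<odot>\<^bsub>aug_completion R S\<^esub> F a"
      using ra pre(1) F_eq[of "r \<odot>\<^bsub>A\<^esub> a" "\<lambda>k. r \<odot>\<^bsub>S\<^esub> pre a k"]
      by (simp add: F_def S.aug_completion_simps)
  next
    fix a assume a: "a \<in> carrier A"
    have "aug A (f (pre a 1)) = aug A a"
      using pre(2)[OF a, of 1] pre(1)[OF a] a A.aug_eq_iff by (simp add: A.aug_pow_1)
    then show "aug (aug_completion R S) (F a) = aug A a"
      using pre(1)[OF a] by (simp add: F_def S.aug_completion_simps aug_homD(6)[OF f])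
  next
    show "F \<one>\<^bsub>A\<^esub> = \<one>\<^bsub>aug_completion R S\<^esub>"
      using F_eq[of "\<one>\<^bsub>A\<^esub>" "\<lambda>_. \<one>\<^bsub>S\<^esub>"]
      by (simp add: S.aug_completion_simps A.aug_pow_closed a_minus_def A.r_neg)
  qed (rule F_carrier)
  have F_zero: "F \<zero>\<^bsub>A\<^esub> = \<zero>\<^bsub>aug_completion R S\<^esub>"
    using F_eq[of "\<zero>\<^bsub>A\<^esub>" "\<lambda>_. \<zero>\<^bsub>S\<^esub>"]
    by (simp add: S.aug_completion_simps A.aug_pow_closed a_minus_def A.r_neg)
  have "bij_betw F (carrier A) (carrier (aug_completion R S))"
    unfolding bij_betw_def
  proof (intro conjI inj_onI equalityI subsetI)
    fix a b assume ab: "a \<in> carrier A" "b \<in> carrier A" "F a = F b"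
    have "a \<ominus>\<^bsub>A\<^esub> b \<in> aug_pow R A k" for k
    proof -
      have "pre a k \<ominus>\<^bsub>S\<^esub> pre b k \<in> aug_pow R S k"
        using ab pre(1) by (simp add: F_def fun_eq_iff cos)
      then have "f (pre a k) \<ominus>\<^bsub>A\<^esub> f (pre b k) \<in> aug_pow R A k"
        using aug_hom_aug_pow[OF S aA f] ab pre(1) fdiff by metis
      then have "f (pre a k) \<ominus>\<^bsub>A\<^esub> b \<in> aug_pow R A k"
        using telescope pre ab by (meson f.hom_closed)
      then show ?thesis
        using telescope[OF flip[OF pre(2)[OF ab(1)]]] pre(1) ab by (meson f.hom_closed)
    qed
    then have "a \<ominus>\<^bsub>A\<^esub> b = \<zero>\<^bsub>A\<^esub>"
      using sA ab unfolding sequentially_complete_def by simp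
    then show "a = b" using ab by simp
  next
    fix c assume "c \<in> carrier (aug_completion R S)"
    then obtain x where x: "\<And>k. x k \<in> carrier S"
      "\<And>k j. j \<le> k \<Longrightarrow> x k \<ominus>\<^bsub>S\<^esub> x j \<in> aug_pow R S j"
      and c: "c = (\<lambda>k. aug_pow R S k +>\<^bsub>S\<^esub> x k)" unfolding S.aug_completion_carrier by blast
    have cauchy: "f (x k) \<ominus>\<^bsub>A\<^esub> f (x j) \<in> aug_pow R A j" if "j \<le> k" for k j
      using aug_hom_aug_pow[OF S aA f x(2)[OF that]] x(1) by (simp add: fdiff)
    obtain a where "a \<in> carrier A" "\<And>k. f (x k) \<ominus>\<^bsub>A\<^esub> a \<in> aug_pow R A k"
      by (rule sequentially_complete_limit[OF sA, of "\<lambda>k. f (x k)", OF _ cauchy]) (use x(1) in auto)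
    then have "F a = c" using F_eq x(1) c by blast
    then show "c \<in> F ` carrier A" using \<open>a \<in> carrier A\<close> by blast
  qed (use F_carrier in auto)
  then show ?thesis using complete_augmented_algebra_transport[OF A F_hom _ F_zero] by blast
qed

section \<open>Power series\<close>

lemma (in abelian_monoid) finsum_Sigma:
  assumes "finite A" "\<And>x. x \<in> A \<Longrightarrow> finite (B x)"
    and "\<And>x y. x \<in> A \<Longrightarrow> y \<in> B x \<Longrightarrow> f x y \<in> carrier G"
  shows "(\<Oplus>x\<in>A. \<Oplus>y\<in>B x. f x y) = (\<Oplus>p\<in>Sigma A B. f (fst p) (snd p))"
  using assms
proof (induction A)
  case empty then show ?case by simp
next
  case (insert a A)
  have S: "Sigma (insert a A) B = Pair a ` B a \<union> Sigma A B" by auto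
  have "(\<Oplus>p\<in>Sigma (insert a A) B. f (fst p) (snd p)) =
    (\<Oplus>p\<in>Pair a ` B a. f (fst p) (snd p)) \<oplus> (\<Oplus>p\<in>Sigma A B. f (fst p) (snd p))"
    unfolding S using insert by (intro finsum_Un_disjoint) auto
  also have "(\<Oplus>p\<in>Pair a ` B a. f (fst p) (snd p)) = (\<Oplus>y\<in>B a. f a y)"
    using insert.prems by (subst finsum_reindex) (auto simp: inj_on_def)
  finally show ?case using insert by (simp add: Pi_def)
qed

lemma finite_submultisets: "finite {a. a \<subseteq># (m :: 'v multiset)}"
proof (induction m)
  case empty then show ?case by simp
next
  case (add x m)
  have "{a. a \<subseteq># add_mset x m} \<subseteq> {a. a \<subseteq># m} \<union> add_mset x ` {a. a \<subseteq># m}"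
  proof
    fix a assume "a \<in> {a. a \<subseteq># add_mset x m}"
    then have a: "a \<subseteq># add_mset x m" by simp
    show "a \<in> {a. a \<subseteq># m} \<union> add_mset x ` {a. a \<subseteq># m}"
    proof (cases "x \<in># a")
      case True
      then obtain b where "a = add_mset x b" by (metis insert_DiffM)
      then show ?thesis using a by auto
    next
      case False
      then have "count a y \<le> count m y" for y
        using mset_subset_eq_count[OF a, of y] by (cases "y = x") (auto simp: not_in_iff)
      then show ?thesis by (simp add: subseteq_mset_def)
    qed
  qed
  then show ?case using add finite_subset by fastforce
qed

lemma submultiset_double_diff: "a \<subseteq># m \<Longrightarrow> m - (m - a) = a" for a m :: "'v multiset"
  by (auto simp: multiset_eq_iff subseteq_mset_def)

context cring
begin

lemma power_series_carrier:
  "f \<in> carrier (power_series_algebra R V) \<longleftrightarrow>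
    (\<forall>m. f m \<in> carrier R) \<and> (\<forall>m. \<not> set_mset m \<subseteq> V \<longrightarrow> f m = \<zero>)"
  by (simp add: power_series_algebra_def)

lemma power_series_closed: "f \<in> carrier (power_series_algebra R V) \<Longrightarrow> f m \<in> carrier R"
  by (simp add: power_series_carrier)

lemma power_series_simps:
  "(f \<otimes>\<^bsub>power_series_algebra R V\<^esub> g) m = (\<Oplus>a \<in> {a. a \<subseteq># m}. f a \<otimes> g (m - a))"
  "(f \<oplus>\<^bsub>power_series_algebra R V\<^esub> g) m = f m \<oplus> g m"
  "(r \<odot>\<^bsub>power_series_algebra R V\<^esub> f) m = r \<otimes> f m"
  "\<one>\<^bsub>power_series_algebra R V\<^esub> m = (if m = {#} then \<one> else \<zero>)"
  "\<zero>\<^bsub>power_series_algebra R V\<^esub> m = \<zero>"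
  "aug (power_series_algebra R V) f = f {#}"
  by (simp_all add: power_series_algebra_def indexed_const_def)

lemma finsum_delta:
  assumes "finite A" "i \<in> A \<Longrightarrow> x \<in> carrier R"
  shows "(\<Oplus>a\<in>A. if a = i then x else \<zero>) = (if i \<in> A then x else \<zero>)"
proof (cases "i \<in> A")
  case True
  then show ?thesis
    using finsum_singleton[of i A "\<lambda>_. x"] assms by (simp add: eq_commute Pi_def)
next
  case False
  then have "(\<Oplus>a\<in>A. if a = i then x else \<zero>) = (\<Oplus>a\<in>A. \<zero>)"
    by (intro finsum_cong') auto
  then show ?thesis using False by simp
qed

text \<open>Multiplication of a series by the monomial with exponent \<open>c\<close> and coefficient \<open>x\<close>.\<close>
lemma convolution_monomial:
  assumes "x \<in> carrier R" "\<And>m. g m \<in> carrier R"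
  shows "(\<Oplus>a \<in> {a. a \<subseteq># m}. (if a = c then x else \<zero>) \<otimes> g (m - a)) =
    (if c \<subseteq># m then x \<otimes> g (m - c) else \<zero>)"
proof -
  have "(\<Oplus>a \<in> {a. a \<subseteq># m}. (if a = c then x else \<zero>) \<otimes> g (m - a)) =
    (\<Oplus>a \<in> {a. a \<subseteq># m}. if a = c then x \<otimes> g (m - c) else \<zero>)"
    by (rule finsum_cong') (use assms in auto)
  then show ?thesis using assms by (simp add: finsum_delta finite_submultisets)
qed

lemma power_series_mult_closed:
  fixes V :: "'v set"
  assumes "f \<in> carrier (power_series_algebra R V)" "g \<in> carrier (power_series_algebra R V)"
  shows "f \<otimes>\<^bsub>power_series_algebra R V\<^esub> g \<in> carrier (power_series_algebra R V)"
  unfolding power_series_carrier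
proof (intro conjI allI impI)
  fix m :: "'v multiset"
  show "(f \<otimes>\<^bsub>power_series_algebra R V\<^esub> g) m \<in> carrier R"
    using assms by (auto simp: power_series_simps power_series_closed intro!: finsum_closed)
  assume m: "\<not> set_mset m \<subseteq> V"
  have "f a \<otimes> g (m - a) = \<zero>" if a: "a \<subseteq># m" for a
  proof -
    have "set_mset m = set_mset a \<union> set_mset (m - a)"
      using a by (metis set_mset_union subset_mset.add_diff_inverse)
    then consider "\<not> set_mset a \<subseteq> V" | "\<not> set_mset (m - a) \<subseteq> V" using m by blast
    then show ?thesis using assms by cases (auto simp: power_series_carrier)
  qed
  then have "(\<Oplus>a \<in> {a. a \<subseteq># m}. f a \<otimes> g (m - a)) = (\<Oplus>a \<in> {a. a \<subseteq># m}. \<zero>)"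
    by (intro finsum_cong') auto
  then show "(f \<otimes>\<^bsub>power_series_algebra R V\<^esub> g) m = \<zero>" by (simp add: power_series_simps)
qed

lemma power_series_mult_comm:
  fixes V :: "'v set"
  assumes "f \<in> carrier (power_series_algebra R V)" "g \<in> carrier (power_series_algebra R V)"
  shows "f \<otimes>\<^bsub>power_series_algebra R V\<^esub> g = g \<otimes>\<^bsub>power_series_algebra R V\<^esub> f"
proof
  fix m :: "'v multiset"
  have cl: "f a \<in> carrier R" "g a \<in> carrier R" for a using assms by (simp_all add: power_series_closed)
  have im: "{a. a \<subseteq># m} = (\<lambda>a. m - a) ` {a. a \<subseteq># m}"
  proof -
    have "a \<in> (\<lambda>a. m - a) ` {a. a \<subseteq># m}" if "a \<subseteq># m" for a
      using that by (intro image_eqI[of _ _ "m - a"]) (auto simp: submultiset_double_diff)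
    then show ?thesis by auto
  qed
  have inj: "inj_on (\<lambda>a. m - a) {a. a \<subseteq># m}"
    by (rule inj_onI) (metis mem_Collect_eq submultiset_double_diff)
  have "(\<Oplus>a \<in> {a. a \<subseteq># m}. f a \<otimes> g (m - a)) = (\<Oplus>a \<in> (\<lambda>a. m - a) ` {a. a \<subseteq># m}. f a \<otimes> g (m - a))"
    using im by simp
  also have "\<dots> = (\<Oplus>a \<in> {a. a \<subseteq># m}. f (m - a) \<otimes> g (m - (m - a)))"
    using inj cl by (subst finsum_reindex) auto
  also have "\<dots> = (\<Oplus>a \<in> {a. a \<subseteq># m}. g a \<otimes> f (m - a))"
    using cl by (intro finsum_cong') (auto simp: submultiset_double_diff m_comm)
  finally show "(f \<otimes>\<^bsub>power_series_algebra R V\<^esub> g) m = (g \<otimes>\<^bsub>power_series_algebra R V\<^esub> f) m"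
    by (simp add: power_series_simps)
qed

text \<open>
  Both triple products sum over the decompositions of \<open>m\<close> into three parts.  One side chooses a
  part \<open>a\<close> of \<open>m\<close> and then \<open>b\<close> inside \<open>a\<close>, the other chooses \<open>b\<close> and then \<open>c\<close> inside \<open>m - b\<close>; the
  bijection between the index sets is \<open>(a, b) \<mapsto> (b, a - b)\<close>.
\<close>
lemma power_series_mult_assoc:
  fixes V :: "'v set"
  assumes "f \<in> carrier (power_series_algebra R V)" "g \<in> carrier (power_series_algebra R V)"
    "h \<in> carrier (power_series_algebra R V)"
  shows "f \<otimes>\<^bsub>power_series_algebra R V\<^esub> g \<otimes>\<^bsub>power_series_algebra R V\<^esub> h =
    f \<otimes>\<^bsub>power_series_algebra R V\<^esub> (g \<otimes>\<^bsub>power_series_algebra R V\<^esub> h)"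
proof
  fix m :: "'v multiset"
  have cl: "f a \<in> carrier R" "g a \<in> carrier R" "h a \<in> carrier R" for a
    using assms by (simp_all add: power_series_closed)
  define t where "t = (\<lambda>p :: 'v multiset \<times> 'v multiset. (snd p, fst p - snd p))"
  define S where "S = Sigma {a. a \<subseteq># m} (\<lambda>a. {b. b \<subseteq># a})"
  define S' where "S' = Sigma {a. a \<subseteq># m} (\<lambda>b. {c. c \<subseteq># m - b})"
  have inj: "inj_on t S"
    by (rule inj_onI) (auto simp: t_def S_def, metis subset_mset.diff_add)
  have im: "t ` S = S'"
  proof (intro equalityI subsetI)
    fix q assume "q \<in> t ` S"
    then show "q \<in> S'"
      by (auto simp: t_def S_def S'_def subseteq_mset_def) (meson order_trans diff_le_mono)+
  next
    fix q assume q: "q \<in> S'"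
    obtain b c where bc: "q = (b, c)" by fastforce
    with q have "b \<subseteq># m" "c \<subseteq># m - b" by (auto simp: S'_def)
    then have "b + c \<subseteq># m"
      by (metis subset_mset.add_diff_inverse subset_mset.add_left_mono)
    then have "(b + c, b) \<in> S" by (simp add: S_def)
    then show "q \<in> t ` S" unfolding bc by (rule image_eqI[rotated]) (simp add: t_def)
  qed
  have "(f \<otimes>\<^bsub>power_series_algebra R V\<^esub> g \<otimes>\<^bsub>power_series_algebra R V\<^esub> h) m =
    (\<Oplus>a\<in>{a. a \<subseteq># m}. \<Oplus>b\<in>{b. b \<subseteq># a}. f b \<otimes> g (a - b) \<otimes> h (m - a))"
    unfolding power_series_simps
    using cl by (intro finsum_cong') (auto simp: finsum_ldistr finite_submultisets intro!: finsum_closed)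
  also have "\<dots> = (\<Oplus>p\<in>S. f (snd p) \<otimes> g (fst p - snd p) \<otimes> h (m - fst p))"
    unfolding S_def using cl by (subst finsum_Sigma) (auto simp: finite_submultisets)
  also have "\<dots> = (\<Oplus>p\<in>S. f (fst (t p)) \<otimes> (g (snd (t p)) \<otimes> h (m - fst (t p) - snd (t p))))"
  proof (rule finsum_cong')
    fix p assume "p \<in> S"
    then have "m - fst p = m - snd p - (fst p - snd p)"
      by (auto simp: S_def)
    then show "f (snd p) \<otimes> g (fst p - snd p) \<otimes> h (m - fst p) =
      f (fst (t p)) \<otimes> (g (snd (t p)) \<otimes> h (m - fst (t p) - snd (t p)))"
      using cl by (simp add: t_def m_assoc)
  qed (use cl in auto)
  also have "\<dots> = (\<Oplus>q\<in>S'. f (fst q) \<otimes> (g (snd q) \<otimes> h (m - fst q - snd q)))"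
    unfolding im[symmetric] using inj cl by (subst finsum_reindex) auto
  also have "\<dots> = (\<Oplus>b\<in>{b. b \<subseteq># m}. \<Oplus>c\<in>{c. c \<subseteq># m - b}. f b \<otimes> (g c \<otimes> h (m - b - c)))"
    unfolding S'_def using cl by (subst finsum_Sigma) (auto simp: finite_submultisets)
  also have "\<dots> = (f \<otimes>\<^bsub>power_series_algebra R V\<^esub> (g \<otimes>\<^bsub>power_series_algebra R V\<^esub> h)) m"
    unfolding power_series_simps
    using cl by (intro finsum_cong') (auto simp: finsum_rdistr finite_submultisets intro!: finsum_closed)
  finally show "(f \<otimes>\<^bsub>power_series_algebra R V\<^esub> g \<otimes>\<^bsub>power_series_algebra R V\<^esub> h) m =
    (f \<otimes>\<^bsub>power_series_algebra R V\<^esub> (g \<otimes>\<^bsub>power_series_algebra R V\<^esub> h)) m" .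
qed

lemma augmented_algebra_power_series:
  fixes V :: "'v set"
  shows "augmented_algebra R (power_series_algebra R V)"
proof -
  let ?B = "power_series_algebra R V"
  note cl = power_series_closed
  have grp: "abelian_group ?B"
  proof (rule abelian_groupI)
    fix f assume f: "f \<in> carrier ?B"
    show "\<zero>\<^bsub>?B\<^esub> \<oplus>\<^bsub>?B\<^esub> f = f" using f by (auto simp: power_series_simps cl)
    show "\<exists>g\<in>carrier ?B. g \<oplus>\<^bsub>?B\<^esub> f = \<zero>\<^bsub>?B\<^esub>"
      using f by (intro bexI[of _ "\<lambda>m. \<ominus> f m"]) (auto simp: power_series_simps power_series_carrier l_neg)
  qed (auto simp: power_series_carrier power_series_simps a_ac)
  have one: "\<one>\<^bsub>?B\<^esub> \<otimes>\<^bsub>?B\<^esub> f = f" if "f \<in> carrier ?B" for f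
    using that by (auto simp: power_series_simps convolution_monomial cl)
  have mon: "comm_monoid ?B"
    by (rule comm_monoidI)
      (auto simp: power_series_mult_assoc one intro: power_series_mult_comm power_series_mult_closed,
       auto simp: power_series_carrier power_series_simps)
  have dist: "(f \<oplus>\<^bsub>?B\<^esub> g) \<otimes>\<^bsub>?B\<^esub> h = f \<otimes>\<^bsub>?B\<^esub> h \<oplus>\<^bsub>?B\<^esub> g \<otimes>\<^bsub>?B\<^esub> h"
    if "f \<in> carrier ?B" "g \<in> carrier ?B" "h \<in> carrier ?B" for f g h
  proof
    fix m :: "'v multiset"
    have "(\<Oplus>a \<in> {a. a \<subseteq># m}. (f a \<oplus> g a) \<otimes> h (m - a)) =
      (\<Oplus>a \<in> {a. a \<subseteq># m}. f a \<otimes> h (m - a) \<oplus> g a \<otimes> h (m - a))"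
      using that by (intro finsum_cong') (auto simp: cl l_distr)
    also have "\<dots> = (\<Oplus>a \<in> {a. a \<subseteq># m}. f a \<otimes> h (m - a)) \<oplus> (\<Oplus>a \<in> {a. a \<subseteq># m}. g a \<otimes> h (m - a))"
      using that by (intro finsum_addf) (auto simp: cl)
    finally show "((f \<oplus>\<^bsub>?B\<^esub> g) \<otimes>\<^bsub>?B\<^esub> h) m = (f \<otimes>\<^bsub>?B\<^esub> h \<oplus>\<^bsub>?B\<^esub> g \<otimes>\<^bsub>?B\<^esub> h) m"
      by (simp add: power_series_simps)
  qed
  have cr: "cring ?B" by (rule cringI[OF grp mon dist])
  have alg: "algebra R ?B"
  proof (rule algebraI[OF is_cring cr])
    fix r f g assume r: "r \<in> carrier R" and fg: "f \<in> carrier ?B" "g \<in> carrier ?B"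
    show "r \<odot>\<^bsub>?B\<^esub> f \<otimes>\<^bsub>?B\<^esub> g = r \<odot>\<^bsub>?B\<^esub> (f \<otimes>\<^bsub>?B\<^esub> g)"
    proof
      fix m :: "'v multiset"
      have "(\<Oplus>a \<in> {a. a \<subseteq># m}. r \<otimes> f a \<otimes> g (m - a)) = (\<Oplus>a \<in> {a. a \<subseteq># m}. r \<otimes> (f a \<otimes> g (m - a)))"
        using r fg by (intro finsum_cong') (auto simp: cl m_assoc)
      also have "\<dots> = r \<otimes> (\<Oplus>a \<in> {a. a \<subseteq># m}. f a \<otimes> g (m - a))"
        using r fg by (intro finsum_rdistr[symmetric]) (auto simp: cl finite_submultisets)
      finally show "(r \<odot>\<^bsub>?B\<^esub> f \<otimes>\<^bsub>?B\<^esub> g) m = (r \<odot>\<^bsub>?B\<^esub> (f \<otimes>\<^bsub>?B\<^esub> g)) m"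
        by (simp add: power_series_simps)
    qed
  qed (auto simp: power_series_carrier power_series_simps l_distr r_distr m_assoc)
  show ?thesis
  proof (rule augmented_algebraI[OF alg])
    fix f g assume "f \<in> carrier ?B" "g \<in> carrier ?B"
    then show "aug ?B (f \<otimes>\<^bsub>?B\<^esub> g) = aug ?B f \<otimes> aug ?B g"
      by (simp add: power_series_simps cl)
  qed (auto simp: power_series_simps cl)
qed

text \<open>
  A series has order at least \<open>k\<close>.  In place of the equality of \<open>J\<^sup>k\<close> with the set of series of
  order at least \<open>k\<close>, one inclusion for all \<open>k\<close> and the other one for \<open>k = 2\<close> suffice.
\<close>
definition vanishes_below :: "nat \<Rightarrow> ('v multiset \<Rightarrow> 'a) \<Rightarrow> bool"
  where "vanishes_below k f \<longleftrightarrow> (\<forall>m. size m < k \<longrightarrow> f m = \<zero>)"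

lemma vanishes_below_mult:
  fixes V :: "'v set"
  assumes "f \<in> carrier (power_series_algebra R V)" "g \<in> carrier (power_series_algebra R V)"
    and "vanishes_below j f" "vanishes_below k g"
  shows "vanishes_below (j + k) (f \<otimes>\<^bsub>power_series_algebra R V\<^esub> g)"
  unfolding vanishes_below_def
proof (intro allI impI)
  fix m :: "'v multiset" assume m: "size m < j + k"
  have "f a \<otimes> g (m - a) = \<zero>" if "a \<subseteq># m" for a
  proof (cases "size a < j")
    case True
    then show ?thesis using assms by (simp add: vanishes_below_def power_series_closed)
  next
    case False
    then have "size (m - a) < k" using m that size_mset_mono[OF that] by (simp add: size_Diff_submset)
    then show ?thesis using assms by (simp add: vanishes_below_def power_series_closed)
  qed
  then have "(\<Oplus>a \<in> {a. a \<subseteq># m}. f a \<otimes> g (m - a)) = (\<Oplus>a \<in> {a. a \<subseteq># m}. \<zero>)"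
    by (intro finsum_cong') auto
  then show "(f \<otimes>\<^bsub>power_series_algebra R V\<^esub> g) m = \<zero>" by (simp add: power_series_simps)
qed

lemma vanishes_below_add:
  "vanishes_below k f \<Longrightarrow> vanishes_below k g \<Longrightarrow> vanishes_below k (f \<oplus>\<^bsub>power_series_algebra R V\<^esub> g)"
  by (simp add: vanishes_below_def power_series_simps)

lemma power_series_minus:
  assumes "f \<in> carrier (power_series_algebra R V)" "g \<in> carrier (power_series_algebra R V)"
  shows "(f \<ominus>\<^bsub>power_series_algebra R V\<^esub> g) m = f m \<ominus> g m"
proof -
  let ?B = "power_series_algebra R V"
  interpret B: cring ?B by (rule cring_augmented_algebra[OF augmented_algebra_power_series])
  have "(f \<ominus>\<^bsub>?B\<^esub> g) \<oplus>\<^bsub>?B\<^esub> g = f" using assms by (simp add: a_minus_def B.a_assoc B.l_neg)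
  then have "(f \<ominus>\<^bsub>?B\<^esub> g) m \<oplus> g m = f m" by (metis power_series_simps(2))
  moreover have "(f \<ominus>\<^bsub>?B\<^esub> g) m \<in> carrier R" "f m \<in> carrier R" "g m \<in> carrier R"
    using assms power_series_closed[OF B.minus_closed[OF assms]] by (auto intro: power_series_closed)
  ultimately show ?thesis by (metis a_assoc a_inv_closed a_minus_def r_neg r_zero)
qed

lemma vanishes_below_diff:
  assumes "f \<in> carrier (power_series_algebra R V)" "g \<in> carrier (power_series_algebra R V)"
    and "vanishes_below k f" "vanishes_below k g"
  shows "vanishes_below k (f \<ominus>\<^bsub>power_series_algebra R V\<^esub> g)"
  using assms(3,4) by (simp add: vanishes_below_def power_series_minus[OF assms(1,2)] a_minus_def[of R])

lemma vanishes_below_mono: "vanishes_below k f \<Longrightarrow> j \<le> k \<Longrightarrow> vanishes_below j f"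
  by (simp add: vanishes_below_def)

lemma vanishes_below_aug_pow:
  assumes "f \<in> aug_pow R (power_series_algebra R V) k"
  shows "vanishes_below k f"
  using assms
proof (induction k arbitrary: f)
  case 0 then show ?case by (simp add: vanishes_below_def)
next
  case (Suc k)
  interpret B: augmented_algebra R "power_series_algebra R V" by (rule augmented_algebra_power_series)
  from Suc.prems show ?case unfolding B.aug_pow_Suc
  proof (induction f rule: ideal_prod.induct)
    case (prod i j)
    have "vanishes_below (Suc 0) j" using prod(2) by (simp add: B.mem_aug_ideal vanishes_below_def power_series_simps)
    then show ?case
      using vanishes_below_mult[OF _ _ Suc.IH[OF prod(1)], of V j "Suc 0"] prod B.aug_pow_carrier B.mem_aug_ideal by simp
  next
    case (sum s1 s2) then show ?case by (simp add: vanishes_below_add)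
  qed
qed

lemma indexed_var_apply: "indexed_var i m = (if m = {#i#} then \<one> else \<zero>)"
  by (auto simp: indexed_var_def indexed_pmult_def indexed_const_def dest: multi_member_split)

lemma indexed_var_carrier: "i \<in> V \<Longrightarrow> indexed_var i \<in> carrier (power_series_algebra R V)"
  by (auto simp: power_series_carrier indexed_var_apply)

lemma indexed_var_mult:
  assumes "f \<in> carrier (power_series_algebra R V)"
  shows "(indexed_var i \<otimes>\<^bsub>power_series_algebra R V\<^esub> f) = indexed_pmult f i"
  using assms
  by (auto simp: power_series_simps indexed_var_apply indexed_pmult_def convolution_monomial power_series_closed fun_eq_iff)

text \<open>
  Sorting the monomials by their least variable gives \<open>f = \<Sum>\<^sub>i X\<^sub>i g\<^sub>i\<close>, where the constant term of
  \<open>g\<^sub>i\<close> is the coefficient of \<open>X\<^sub>i\<close> in \<open>f\<close>, hence zero.  The sum is built up one variable at a time: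
  \<open>part W\<close> collects the monomials whose least variable lies in \<open>W\<close>.
\<close>
lemma vanishes_below_2_aug_pow:
  assumes "finite V" "f \<in> carrier (power_series_algebra R (V :: 'v :: linorder set))" "vanishes_below (Suc (Suc 0)) f"
  shows "f \<in> aug_pow R (power_series_algebra R V) (Suc (Suc 0))"
proof -
  let ?B = "power_series_algebra R V"
  interpret B: augmented_algebra R ?B by (rule augmented_algebra_power_series)
  have fc: "f m \<in> carrier R" for m using assms(2) by (simp add: power_series_closed)
  define part where "part W m = (if m \<noteq> {#} \<and> Min (set_mset m) \<in> W then f m else \<zero>)" for W m
  have part: "part W \<in> aug_pow R ?B (Suc (Suc 0))" if "finite W" "W \<subseteq> V" for W
    using that
  proof (induction W)
    case empty
    have "part {} = \<zero>\<^bsub>?B\<^esub>" by (auto simp: part_def power_series_simps)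
    then show ?case by (simp add: B.aug_pow_closed)
  next
    case (insert i W)
    define g where "g m = (if Min (set_mset (add_mset i m)) = i then f (add_mset i m) else \<zero>)" for m
    have g: "g \<in> carrier ?B"
      using assms(2) by (auto simp: power_series_carrier g_def)
    have "g {#} = \<zero>" using assms(3) by (simp add: g_def vanishes_below_def)
    then have g_aug: "g \<in> aug_ideal R ?B" using g by (simp add: B.mem_aug_ideal power_series_simps)
    have var: "indexed_var i \<in> aug_pow R ?B (Suc 0)"
      using insert.prems indexed_var_carrier[of i V]
      by (simp add: B.aug_pow_1 B.mem_aug_ideal power_series_simps indexed_var_apply)
    have "part (insert i W) = indexed_var i \<otimes>\<^bsub>?B\<^esub> g \<oplus>\<^bsub>?B\<^esub> part W"
    proof
      fix m :: "'v multiset"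
      show "part (insert i W) m = (indexed_var i \<otimes>\<^bsub>?B\<^esub> g \<oplus>\<^bsub>?B\<^esub> part W) m"
      proof (cases "m \<noteq> {#} \<and> Min (set_mset m) = i")
        case True
        then have "i \<in># m" by (metis Min_in finite_set_mset set_mset_eq_empty_iff)
        then show ?thesis using True insert.hyps fc
          by (simp add: part_def power_series_simps(2) indexed_var_mult[OF g] indexed_pmult_def g_def)
      next
        case False
        then have "indexed_pmult g i m = \<zero>" by (auto simp: indexed_pmult_def g_def)
        then show ?thesis using False fc
          by (auto simp: part_def power_series_simps(2) indexed_var_mult[OF g])
      qed
    qed
    then show ?case
      using B.aug_pow_mult_Suc[OF var g_aug] insert by (simp add: B.aug_pow_closed)
  qed
  have "part V = f"
  proof
    fix m :: "'v multiset"
    show "part V m = f m"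
    proof (cases "m = {#} \<or> \<not> set_mset m \<subseteq> V")
      case True
      then show ?thesis using assms(2,3) by (auto simp: part_def power_series_carrier vanishes_below_def)
    next
      case False
      then have "Min (set_mset m) \<in> V" by (metis Min_in finite_set_mset set_mset_eq_empty_iff subsetD)
      then show ?thesis using False by (simp add: part_def)
    qed
  qed
  with part[OF assms(1)] show ?thesis by simp
qed

end

section \<open>Polynomials\<close>

text \<open>Negatives lie in \<open>H\<close> because they are multiples by the scalar \<open>-1\<close>.\<close>
lemma augmented_algebra_subalgebra:
  assumes A: "augmented_algebra R A" and sub: "H \<subseteq> carrier A"
    and zero: "\<zero>\<^bsub>A\<^esub> \<in> H" and one: "\<one>\<^bsub>A\<^esub> \<in> H"
    and add: "\<And>x y. x \<in> H \<Longrightarrow> y \<in> H \<Longrightarrow> x \<oplus>\<^bsub>A\<^esub> y \<in> H"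
    and mult: "\<And>x y. x \<in> H \<Longrightarrow> y \<in> H \<Longrightarrow> x \<otimes>\<^bsub>A\<^esub> y \<in> H"
    and smult: "\<And>r x. r \<in> carrier R \<Longrightarrow> x \<in> H \<Longrightarrow> r \<odot>\<^bsub>A\<^esub> x \<in> H"
  shows "augmented_algebra R (A\<lparr>carrier := H\<rparr>)"
proof -
  interpret cA: cring A by (rule cring_augmented_algebra[OF A])
  interpret A: augmented_algebra R A by (rule A)
  have c: "x \<in> carrier A" if "x \<in> H" for x using that sub by blast
  have minus: "\<ominus>\<^bsub>A\<^esub> x \<in> H" if "x \<in> H" for x
    using smult[of "\<ominus>\<^bsub>R\<^esub> \<one>\<^bsub>R\<^esub>" x] that c[OF that] by (simp add: A.smult_l_minus)
  have grp: "abelian_group (A\<lparr>carrier := H\<rparr>)"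
    by (rule abelian_groupI)
      (auto simp: zero add c cA.a_ac cA.l_neg cA.r_neg intro!: bexI[OF _ minus])
  have mon: "comm_monoid (A\<lparr>carrier := H\<rparr>)"
    by (rule comm_monoidI) (auto simp: one mult c cA.m_ac)
  have cr: "cring (A\<lparr>carrier := H\<rparr>)"
    by (rule cringI[OF grp mon]) (auto simp: c cA.l_distr)
  have "algebra R (A\<lparr>carrier := H\<rparr>)"
    by (rule algebraI[OF A.R_cring cr])
      (auto simp: smult c A.smult_l_distr A.smult_r_distr A.smult_assoc1 A.smult_assoc2)
  then show ?thesis
    by (rule augmented_algebraI) (auto simp: c augD[OF A])
qed

definition (in ring) indexed_monom :: "'c multiset \<Rightarrow> 'a \<Rightarrow> ('c multiset \<Rightarrow> 'a)"
  where "indexed_monom m r = (\<lambda>m'. if m' = m then r else \<zero>)"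

context cring
begin

lemma polynomial_simps:
  "monoid.mult (polynomial_algebra R V) = monoid.mult (power_series_algebra R V)"
  "ring.add (polynomial_algebra R V) = ring.add (power_series_algebra R V)"
  "module.smult (polynomial_algebra R V) = module.smult (power_series_algebra R V)"
  "\<one>\<^bsub>polynomial_algebra R V\<^esub> = \<one>\<^bsub>power_series_algebra R V\<^esub>"
  "\<zero>\<^bsub>polynomial_algebra R V\<^esub> = \<zero>\<^bsub>power_series_algebra R V\<^esub>"
  "aug (polynomial_algebra R V) = aug (power_series_algebra R V)"
  by (simp_all add: polynomial_algebra_def)

lemma polynomial_carrier:
  "f \<in> carrier (polynomial_algebra R V) \<longleftrightarrow>
    f \<in> carrier (power_series_algebra R V) \<and> finite {m. f m \<noteq> \<zero>}"
  by (simp add: polynomial_algebra_def)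

lemma polynomial_closed: "f \<in> carrier (polynomial_algebra R V) \<Longrightarrow> f m \<in> carrier R"
  by (auto simp: polynomial_carrier intro: power_series_closed)

lemma augmented_algebra_polynomial:
  fixes V :: "'v set"
  shows "augmented_algebra R (polynomial_algebra R V)"
  unfolding polynomial_algebra_def
proof (rule augmented_algebra_subalgebra[OF augmented_algebra_power_series])
  let ?B = "power_series_algebra R V"
  interpret B: augmented_algebra R ?B by (rule augmented_algebra_power_series)
  let ?H = "{f \<in> carrier ?B. finite {m. f m \<noteq> \<zero>}}"
  note cl = power_series_closed
  show "\<zero>\<^bsub>?B\<^esub> \<in> ?H" by (simp add: power_series_simps)
  show "\<one>\<^bsub>?B\<^esub> \<in> ?H" by (simp add: power_series_simps)
  show "r \<odot>\<^bsub>?B\<^esub> f \<in> ?H" if "r \<in> carrier R" "f \<in> ?H" for r f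
    using that by (auto simp: power_series_simps elim!: rev_finite_subset)
  fix f g assume fg: "f \<in> ?H" "g \<in> ?H"
  then have fin: "finite {m. f m \<noteq> \<zero>}" "finite {m. g m \<noteq> \<zero>}" by auto
  show "f \<oplus>\<^bsub>?B\<^esub> g \<in> ?H"
    using fg by (auto simp: power_series_simps intro!: finite_subset[OF _ finite_UnI[OF fin]])
  have "{m. (f \<otimes>\<^bsub>?B\<^esub> g) m \<noteq> \<zero>} \<subseteq> (\<lambda>(a, b). a + b) ` ({m. f m \<noteq> \<zero>} \<times> {m. g m \<noteq> \<zero>})"
  proof (intro subsetI, rule ccontr)
    fix m assume m: "m \<in> {m. (f \<otimes>\<^bsub>?B\<^esub> g) m \<noteq> \<zero>}"
      "m \<notin> (\<lambda>(a, b). a + b) ` ({m. f m \<noteq> \<zero>} \<times> {m. g m \<noteq> \<zero>})"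
    have "f a \<otimes> g (m - a) = \<zero>" if "a \<subseteq># m" for a
    proof -
      have "m = a + (m - a)" using that by simp
      then have "f a = \<zero> \<or> g (m - a) = \<zero>" using m(2) by force
      then show ?thesis using fg by (auto simp: cl)
    qed
    then have "(\<Oplus>a \<in> {a. a \<subseteq># m}. f a \<otimes> g (m - a)) = (\<Oplus>a \<in> {a. a \<subseteq># m}. \<zero>)"
      by (intro finsum_cong') auto
    then show False using m(1) by (simp add: power_series_simps)
  qed
  then show "f \<otimes>\<^bsub>?B\<^esub> g \<in> ?H"
    using fg fin by (auto intro: finite_subset)
qed auto

lemma indexed_monom_carrier:
  "set_mset m \<subseteq> V \<Longrightarrow> r \<in> carrier R \<Longrightarrow> indexed_monom m r \<in> carrier (polynomial_algebra R V)"
  by (auto simp: polynomial_carrier power_series_carrier indexed_monom_def)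

lemma indexed_var_poly_carrier: "i \<in> V \<Longrightarrow> indexed_var i \<in> carrier (polynomial_algebra R V)"
  by (auto simp: polynomial_carrier indexed_var_carrier indexed_var_apply)

lemma indexed_var_mult_monom:
  assumes "set_mset m \<subseteq> V" "r \<in> carrier R"
  shows "indexed_var i \<otimes>\<^bsub>polynomial_algebra R V\<^esub> indexed_monom m r = indexed_monom (add_mset i m) r"
proof -
  have "indexed_monom m r \<in> carrier (power_series_algebra R V)"
    using indexed_monom_carrier[OF assms] by (simp add: polynomial_carrier)
  then show ?thesis
    by (auto simp: polynomial_simps indexed_var_mult indexed_pmult_def indexed_monom_def fun_eq_iff
        dest: multi_member_split)
qed

lemma polynomial_monom_induct:
  fixes V :: "'v set"
  assumes f: "f \<in> carrier (polynomial_algebra R V)"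
    and zero: "Q \<zero>\<^bsub>polynomial_algebra R V\<^esub>"
    and monom: "\<And>m. set_mset m \<subseteq> V \<Longrightarrow> f m \<noteq> \<zero> \<Longrightarrow> Q (indexed_monom m (f m))"
    and add: "\<And>g h. g \<in> carrier (polynomial_algebra R V) \<Longrightarrow> h \<in> carrier (polynomial_algebra R V) \<Longrightarrow>
      Q g \<Longrightarrow> Q h \<Longrightarrow> Q (g \<oplus>\<^bsub>polynomial_algebra R V\<^esub> h)"
  shows "Q f"
proof -
  have fc: "f m \<in> carrier R" for m
    using f by (rule polynomial_closed)
  have supp: "set_mset m \<subseteq> V" if "f m \<noteq> \<zero>" for m
    using f that by (auto simp: polynomial_carrier power_series_carrier)
  define part where "part W m = (if m \<in> W then f m else \<zero>)" for W m
  have parts: "Q (part W) \<and> part W \<in> carrier (polynomial_algebra R V)"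
    if "finite W" "W \<subseteq> {m. f m \<noteq> \<zero>}" for W
    using that
  proof (induction W)
    case empty
    have "part {} = \<zero>\<^bsub>polynomial_algebra R V\<^esub>"
      by (simp add: part_def fun_eq_iff polynomial_simps power_series_simps)
    then show ?case
      using zero cring.cring_simprules(2)[OF cring_augmented_algebra[OF augmented_algebra_polynomial]]
      by simp
  next
    case (insert m W)
    have "part (insert m W) = indexed_monom m (f m) \<oplus>\<^bsub>polynomial_algebra R V\<^esub> part W"
      using insert.hyps fc by (auto simp: part_def fun_eq_iff polynomial_simps power_series_simps indexed_monom_def)
    moreover have "set_mset m \<subseteq> V" "f m \<noteq> \<zero>" using insert.prems supp by auto
    ultimately show ?case
      using insert add monom indexed_monom_carrier[of m V "f m"] fc
        cring.cring_simprules(1)[OF cring_augmented_algebra[OF augmented_algebra_polynomial[of V]]]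
      by simp
  qed
  have "part {m. f m \<noteq> \<zero>} = f" by (auto simp: part_def)
  moreover have "finite {m. f m \<noteq> \<zero>}" using f by (simp add: polynomial_carrier)
  ultimately show ?thesis using parts[OF _ subset_refl] by metis
qed

text \<open>
  Multiplication by one variable at a time reaches all monomials.  Identities between
  homomorphisms, and the multiplicativity of evaluation, then only have to be checked on constants
  and variables.
\<close>
lemma polynomial_induct [consumes 1, case_names const add var]:
  fixes V :: "'v set"
  assumes f: "f \<in> carrier (polynomial_algebra R V)"
    and const: "\<And>r. r \<in> carrier R \<Longrightarrow> Q (r \<odot>\<^bsub>polynomial_algebra R V\<^esub> \<one>\<^bsub>polynomial_algebra R V\<^esub>)"
    and add: "\<And>g h. g \<in> carrier (polynomial_algebra R V) \<Longrightarrow> h \<in> carrier (polynomial_algebra R V) \<Longrightarrow>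
      Q g \<Longrightarrow> Q h \<Longrightarrow> Q (g \<oplus>\<^bsub>polynomial_algebra R V\<^esub> h)"
    and var: "\<And>i g. i \<in> V \<Longrightarrow> g \<in> carrier (polynomial_algebra R V) \<Longrightarrow> Q g \<Longrightarrow>
      Q (indexed_var i \<otimes>\<^bsub>polynomial_algebra R V\<^esub> g)"
  shows "Q f"
proof -
  have const': "r \<odot>\<^bsub>polynomial_algebra R V\<^esub> \<one>\<^bsub>polynomial_algebra R V\<^esub> = indexed_monom {#} r"
    if "r \<in> carrier R" for r
    using that by (auto simp: fun_eq_iff polynomial_simps power_series_simps indexed_monom_def)
  have monom: "Q (indexed_monom m r)" if "set_mset m \<subseteq> V" "r \<in> carrier R" for m r
    using that
  proof (induction m)
    case empty then show ?case using const[of r] const'[of r] by simp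
  next
    case (add i m)
    then show ?case
      using var[of i "indexed_monom m r"] indexed_monom_carrier[of m V r] indexed_var_mult_monom[of m V r i]
      by simp
  qed
  show ?thesis
  proof (rule polynomial_monom_induct[where Q = Q, OF f _ _ add])
    have "\<zero>\<^bsub>polynomial_algebra R V\<^esub> = indexed_monom {#} \<zero>"
      by (auto simp: fun_eq_iff polynomial_simps power_series_simps indexed_monom_def)
    then show "Q \<zero>\<^bsub>polynomial_algebra R V\<^esub>" using monom[of "{#}" \<zero>] by simp
    show "Q (indexed_monom m (f m))" if "set_mset m \<subseteq> V" for m
      using monom[OF that] polynomial_closed[OF f] by simp
  qed
qed

text \<open>
  For polynomials membership in a power of the augmentation ideal can be read off from the finitely
  many monomials.
\<close>
lemma vanishes_below_polynomial_aug_pow: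
  fixes V :: "'v set"
  assumes f: "f \<in> carrier (polynomial_algebra R V)" and "vanishes_below k f"
  shows "f \<in> aug_pow R (polynomial_algebra R V) k"
proof -
  let ?F = "polynomial_algebra R V"
  interpret F: augmented_algebra R ?F by (rule augmented_algebra_polynomial)
  interpret cF: cring ?F by (rule F.M_cring)
  have monom: "indexed_monom m r \<in> aug_pow R ?F (size m)" if "set_mset m \<subseteq> V" "r \<in> carrier R" for m r
    using that
  proof (induction m)
    case empty
    then show ?case using indexed_monom_carrier[of "{#}" V r] by (simp add: F.aug_pow_0)
  next
    case (add i m)
    have i: "indexed_var i \<in> aug_ideal R ?F"
      using add.prems indexed_var_poly_carrier[of i V]
      by (simp add: F.mem_aug_ideal polynomial_simps power_series_simps indexed_var_apply)
    have m: "indexed_monom m r \<in> aug_pow R ?F (size m)" using add by simp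
    have "indexed_monom m r \<otimes>\<^bsub>?F\<^esub> indexed_var i = indexed_monom (add_mset i m) r"
      using add.prems indexed_var_mult_monom[of m V r i] indexed_monom_carrier[of m V r]
        indexed_var_poly_carrier[of i V] by (simp add: F.m_comm)
    then show ?case using F.aug_pow_mult_Suc[OF m i] by simp
  qed
  show ?thesis
  proof (rule polynomial_monom_induct[OF f])
    fix m assume m: "set_mset m \<subseteq> V" "f m \<noteq> \<zero>"
    then have "k \<le> size m" using assms(2) by (auto simp: vanishes_below_def not_less[symmetric])
    then show "indexed_monom m (f m) \<in> aug_pow R ?F k"
      using monom[OF m(1)] F.aug_pow_antimono polynomial_closed[OF f] by blast
  qed (auto simp: F.aug_pow_closed)
qed

end

definition eval_monom :: "('a, 'l) monoid_scheme \<Rightarrow> ('v \<Rightarrow> 'a) \<Rightarrow> 'v multiset \<Rightarrow> 'a"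
  where "eval_monom T \<phi> m = (\<Otimes>\<^bsub>T\<^esub>x\<in>set_mset m. \<phi> x [^]\<^bsub>T\<^esub> count m x)"

definition eval_poly ::
    "('r, 'k) ring_scheme \<Rightarrow> ('r, 'a, 'l) module_scheme \<Rightarrow> ('v \<Rightarrow> 'a) \<Rightarrow> ('v multiset \<Rightarrow> 'r) \<Rightarrow> 'a"
  where "eval_poly R T \<phi> f = (\<Oplus>\<^bsub>T\<^esub>m\<in>{m. f m \<noteq> \<zero>\<^bsub>R\<^esub>}. f m \<odot>\<^bsub>T\<^esub> eval_monom T \<phi> m)"

lemma (in comm_monoid) eval_monom_empty: "eval_monom G \<phi> {#} = \<one>"
  by (simp add: eval_monom_def)

lemma (in comm_monoid) eval_monom_closed:
  "\<phi> ` set_mset m \<subseteq> carrier G \<Longrightarrow> eval_monom G \<phi> m \<in> carrier G"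
  unfolding eval_monom_def by (intro finprod_closed) auto

lemma (in comm_monoid) eval_monom_add_mset:
  assumes "\<phi> ` set_mset (add_mset i m) \<subseteq> carrier G"
  shows "eval_monom G \<phi> (add_mset i m) = \<phi> i \<otimes> eval_monom G \<phi> m"
proof -
  define W where "W = set_mset m - {i}"
  have c: "\<phi> x \<in> carrier G" if "x \<in> insert i W" for x using assms that by (auto simp: W_def)
  have W: "finite W" "i \<notin> W" by (simp_all add: W_def)
  have rest: "(\<Otimes>x\<in>W. \<phi> x [^] count m x) \<in> carrier G" using c by (intro finprod_closed) auto
  have "eval_monom G \<phi> m = (\<Otimes>x\<in>insert i W. \<phi> x [^] count m x)"
    unfolding eval_monom_def using c
    by (intro finprod_mono_neutral_cong_left) (auto simp: W_def not_in_iff)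
  also have "\<dots> = \<phi> i [^] count m i \<otimes> (\<Otimes>x\<in>W. \<phi> x [^] count m x)"
    using c W by (intro finprod_insert) auto
  finally have m: "eval_monom G \<phi> m = \<phi> i [^] count m i \<otimes> (\<Otimes>x\<in>W. \<phi> x [^] count m x)" .
  have "eval_monom G \<phi> (add_mset i m) = (\<Otimes>x\<in>insert i W. \<phi> x [^] count (add_mset i m) x)"
    unfolding eval_monom_def by (intro arg_cong2[where f = "finprod G"]) (auto simp: W_def)
  also have "\<dots> = \<phi> i [^] count (add_mset i m) i \<otimes> (\<Otimes>x\<in>W. \<phi> x [^] count (add_mset i m) x)"
    using c W by (intro finprod_insert) auto
  also have "(\<Otimes>x\<in>W. \<phi> x [^] count (add_mset i m) x) = (\<Otimes>x\<in>W. \<phi> x [^] count m x)"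
    using c W by (intro finprod_cong') auto
  also have "\<phi> i [^] count (add_mset i m) i = \<phi> i \<otimes> \<phi> i [^] count m i"
    using c by (simp add: m_comm)
  finally show ?thesis using rest c by (simp add: m m_assoc)
qed

text \<open>
  The universal property of polynomials.  Multiplicativity follows by induction from the case where
  the first factor is a variable, where the product merely shifts the support; no double sum over
  the monomials of both factors arises.
\<close>
lemma eval_poly_aug_hom:
  fixes V :: "'v set"
  assumes R: "cring R" and T: "augmented_algebra R T" and \<phi>: "\<And>i. i \<in> V \<Longrightarrow> \<phi> i \<in> aug_ideal R T"
  shows "eval_poly R T \<phi> \<in> aug_hom R (polynomial_algebra R V) T"
    and "i \<in> V \<Longrightarrow> eval_poly R T \<phi> (ring.indexed_var R i) = \<phi> i"
proof -
  interpret R: cring R by (rule R)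
  interpret cT: cring T by (rule cring_augmented_algebra[OF T])
  interpret T: augmented_algebra R T by (rule T)
  let ?F = "polynomial_algebra R V"
  interpret cF: cring ?F by (rule cring_augmented_algebra[OF R.augmented_algebra_polynomial])
  interpret F: augmented_algebra R ?F by (rule R.augmented_algebra_polynomial)
  let ?ev = "eval_poly R T \<phi>" and ?mon = "eval_monom T \<phi>" and ?X = "ring.indexed_var R"
  have \<phi>c: "\<phi> i \<in> carrier T" if "i \<in> V" for i using \<phi>[OF that] by (simp add: T.mem_aug_ideal)
  have mon: "?mon m \<in> carrier T" if "set_mset m \<subseteq> V" for m
    using that \<phi>c by (intro cT.eval_monom_closed) auto
  have coeff: "f m \<in> carrier R" if "f \<in> carrier ?F" for f m
    using that by (rule R.polynomial_closed)
  have supp: "set_mset m \<subseteq> V" if "f \<in> carrier ?F" "f m \<noteq> \<zero>\<^bsub>R\<^esub>" for f m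
    using that by (auto simp: R.polynomial_carrier R.power_series_carrier)
  have fin: "finite {m. f m \<noteq> \<zero>\<^bsub>R\<^esub>}" if "f \<in> carrier ?F" for f
    using that by (simp add: R.polynomial_carrier)
  have ev: "?ev f = (\<Oplus>\<^bsub>T\<^esub>m\<in>W. f m \<odot>\<^bsub>T\<^esub> ?mon m)"
    if "f \<in> carrier ?F" "finite W" "{m. f m \<noteq> \<zero>\<^bsub>R\<^esub>} \<subseteq> W" "\<And>m. m \<in> W \<Longrightarrow> set_mset m \<subseteq> V" for f W
    unfolding eval_poly_def
    using that by (intro cT.add.finprod_mono_neutral_cong_left) (auto simp: mon coeff)
  have closed: "?ev f \<in> carrier T" if f: "f \<in> carrier ?F" for f
    unfolding eval_poly_def using f by (intro cT.finsum_closed) (auto simp: mon coeff supp)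
  have ev_add: "?ev (f \<oplus>\<^bsub>?F\<^esub> g) = ?ev f \<oplus>\<^bsub>T\<^esub> ?ev g" if fg: "f \<in> carrier ?F" "g \<in> carrier ?F" for f g
  proof -
    let ?W = "{m. f m \<noteq> \<zero>\<^bsub>R\<^esub>} \<union> {m. g m \<noteq> \<zero>\<^bsub>R\<^esub>}"
    have W: "finite ?W" "\<And>m. m \<in> ?W \<Longrightarrow> set_mset m \<subseteq> V" using fg fin supp by auto
    have "?ev (f \<oplus>\<^bsub>?F\<^esub> g) = (\<Oplus>\<^bsub>T\<^esub>m\<in>?W. (f \<oplus>\<^bsub>?F\<^esub> g) m \<odot>\<^bsub>T\<^esub> ?mon m)"
      using fg W by (intro ev[OF cF.a_closed[OF fg]]) (auto simp: R.polynomial_simps R.power_series_simps)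
    also have "\<dots> = (\<Oplus>\<^bsub>T\<^esub>m\<in>?W. f m \<odot>\<^bsub>T\<^esub> ?mon m \<oplus>\<^bsub>T\<^esub> g m \<odot>\<^bsub>T\<^esub> ?mon m)"
      using fg W by (intro cT.finsum_cong')
        (auto simp: R.polynomial_simps R.power_series_simps T.smult_l_distr coeff mon)
    also have "\<dots> = (\<Oplus>\<^bsub>T\<^esub>m\<in>?W. f m \<odot>\<^bsub>T\<^esub> ?mon m) \<oplus>\<^bsub>T\<^esub> (\<Oplus>\<^bsub>T\<^esub>m\<in>?W. g m \<odot>\<^bsub>T\<^esub> ?mon m)"
      using fg W by (intro cT.finsum_addf) (auto simp: coeff mon)
    also have "\<dots> = ?ev f \<oplus>\<^bsub>T\<^esub> ?ev g"
      using ev[OF fg(1) W(1) _ W(2)] ev[OF fg(2) W(1) _ W(2)] by simp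
    finally show ?thesis .
  qed
  have ev_smult: "?ev (r \<odot>\<^bsub>?F\<^esub> f) = r \<odot>\<^bsub>T\<^esub> ?ev f" if r: "r \<in> carrier R" and f: "f \<in> carrier ?F" for r f
  proof -
    let ?W = "{m. f m \<noteq> \<zero>\<^bsub>R\<^esub>}"
    have "?ev (r \<odot>\<^bsub>?F\<^esub> f) = (\<Oplus>\<^bsub>T\<^esub>m\<in>?W. (r \<odot>\<^bsub>?F\<^esub> f) m \<odot>\<^bsub>T\<^esub> ?mon m)"
      using r f fin supp by (intro ev[OF F.smult_closed[OF r f]]) (auto simp: R.polynomial_simps R.power_series_simps)
    also have "\<dots> = (\<Oplus>\<^bsub>T\<^esub>m\<in>?W. r \<odot>\<^bsub>T\<^esub> (f m \<odot>\<^bsub>T\<^esub> ?mon m))"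
      using r f supp by (intro cT.finsum_cong')
        (auto simp: R.polynomial_simps R.power_series_simps T.smult_assoc1 coeff mon)
    also have "\<dots> = r \<odot>\<^bsub>T\<^esub> ?ev f"
      unfolding eval_poly_def using r f fin supp
      by (intro T.finsum_smult_ldistr[symmetric]) (auto simp: coeff mon)
    finally show ?thesis .
  qed
  have ev_one: "?ev \<one>\<^bsub>?F\<^esub> = \<one>\<^bsub>T\<^esub>"
  proof -
    have "?ev \<one>\<^bsub>?F\<^esub> = (\<Oplus>\<^bsub>T\<^esub>m\<in>{{#}}. \<one>\<^bsub>?F\<^esub> m \<odot>\<^bsub>T\<^esub> ?mon m)"
      by (intro ev[OF cF.one_closed]) (auto simp: R.polynomial_simps R.power_series_simps split: if_splits)
    then show ?thesis by (simp add: R.polynomial_simps R.power_series_simps cT.eval_monom_empty)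
  qed
  have ev_var: "?ev (?X i \<otimes>\<^bsub>?F\<^esub> f) = \<phi> i \<otimes>\<^bsub>T\<^esub> ?ev f" if i: "i \<in> V" and f: "f \<in> carrier ?F" for i f
  proof -
    let ?W = "{m. f m \<noteq> \<zero>\<^bsub>R\<^esub>}"
    have Xf: "?X i \<otimes>\<^bsub>?F\<^esub> f = ring.indexed_pmult R f i"
      using f by (simp add: R.polynomial_simps R.polynomial_carrier R.indexed_var_mult)
    have "?ev (?X i \<otimes>\<^bsub>?F\<^esub> f) = (\<Oplus>\<^bsub>T\<^esub>m\<in>add_mset i ` ?W. (?X i \<otimes>\<^bsub>?F\<^esub> f) m \<odot>\<^bsub>T\<^esub> ?mon m)"
    proof (intro ev)
      show "?X i \<otimes>\<^bsub>?F\<^esub> f \<in> carrier ?F" by (rule cF.m_closed[OF R.indexed_var_poly_carrier[OF i] f])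
      show "finite (add_mset i ` ?W)" using f fin by simp
      show "{m. (?X i \<otimes>\<^bsub>?F\<^esub> f) m \<noteq> \<zero>\<^bsub>R\<^esub>} \<subseteq> add_mset i ` ?W"
        unfolding Xf by (auto simp: R.indexed_pmult_def image_iff intro!: exI[of _ "_ - {#i#}"])
      show "set_mset m \<subseteq> V" if "m \<in> add_mset i ` ?W" for m using that i supp[OF f] by fastforce
    qed
    also have "\<dots> = (\<Oplus>\<^bsub>T\<^esub>m\<in>?W. (?X i \<otimes>\<^bsub>?F\<^esub> f) (add_mset i m) \<odot>\<^bsub>T\<^esub> ?mon (add_mset i m))"
      unfolding Xf using i f supp
      by (subst cT.finsum_reindex) (auto simp: inj_on_def R.indexed_pmult_def coeff mon)
    also have "\<dots> = (\<Oplus>\<^bsub>T\<^esub>m\<in>?W. \<phi> i \<otimes>\<^bsub>T\<^esub> (f m \<odot>\<^bsub>T\<^esub> ?mon m))"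
    proof (rule cT.finsum_cong')
      fix m assume "m \<in> ?W"
      then have m: "set_mset m \<subseteq> V" using f supp by auto
      have "?mon (add_mset i m) = ?mon m \<otimes>\<^bsub>T\<^esub> \<phi> i"
        using m i \<phi>c mon[OF m] by (subst cT.eval_monom_add_mset) (auto intro: cT.m_comm)
      then have "f m \<odot>\<^bsub>T\<^esub> ?mon (add_mset i m) = (f m \<odot>\<^bsub>T\<^esub> ?mon m) \<otimes>\<^bsub>T\<^esub> \<phi> i"
        using m i \<phi>c f by (simp add: T.smult_assoc2 mon coeff)
      also have "\<dots> = \<phi> i \<otimes>\<^bsub>T\<^esub> (f m \<odot>\<^bsub>T\<^esub> ?mon m)"
        using m i \<phi>c f by (intro cT.m_comm) (simp_all add: mon coeff)
      finally show "(?X i \<otimes>\<^bsub>?F\<^esub> f) (add_mset i m) \<odot>\<^bsub>T\<^esub> ?mon (add_mset i m) =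
          \<phi> i \<otimes>\<^bsub>T\<^esub> (f m \<odot>\<^bsub>T\<^esub> ?mon m)"
        unfolding Xf by (simp add: R.indexed_pmult_def)
    qed (use i \<phi>c f supp in \<open>auto simp: mon coeff\<close>)
    also have "\<dots> = \<phi> i \<otimes>\<^bsub>T\<^esub> ?ev f"
      unfolding eval_poly_def using i \<phi>c f fin supp
      by (intro cT.finsum_rdistr[symmetric]) (auto simp: mon coeff)
    finally show ?thesis .
  qed
  have mult: "?ev (f \<otimes>\<^bsub>?F\<^esub> g) = ?ev f \<otimes>\<^bsub>T\<^esub> ?ev g" if f: "f \<in> carrier ?F" and g: "g \<in> carrier ?F" for f g
    using f
  proof (induction f rule: R.polynomial_induct)
    case (const r)
    then show ?case using g by (simp add: F.smult_assoc2 ev_smult ev_one T.smult_assoc2 closed)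
  next
    case (add p q)
    then show ?case using g by (simp add: cF.l_distr ev_add closed cT.l_distr)
  next
    case (var i p)
    then show ?case using g R.indexed_var_poly_carrier[of i V]
      by (simp add: cF.m_assoc ev_var closed cT.m_assoc \<phi>c)
  qed
  have aug: "aug T (?ev f) = aug ?F f" if "f \<in> carrier ?F" for f
    using that
  proof (induction f rule: R.polynomial_induct)
    case (const r)
    then show ?case by (simp add: ev_smult ev_one augD[OF T] augD[OF F.augmented_algebra_axioms])
  next
    case (add p q)
    then show ?case by (simp add: ev_add closed augD[OF T] augD[OF F.augmented_algebra_axioms])
  next
    case (var i p)
    have "aug ?F (?X i) = \<zero>\<^bsub>R\<^esub>"
      by (simp add: R.polynomial_simps R.power_series_simps R.indexed_var_apply)
    moreover have "aug T (\<phi> i) = \<zero>\<^bsub>R\<^esub>" using \<phi>[OF var(1)] by (simp add: T.mem_aug_ideal)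
    ultimately show ?case using var R.indexed_var_poly_carrier[of i V]
      by (simp add: ev_var closed augD[OF T] augD[OF F.augmented_algebra_axioms] \<phi>c)
  qed
  show "?ev \<in> aug_hom R ?F T"
    by (rule aug_homI) (simp_all add: closed mult ev_add ev_one ev_smult aug)
  show "?ev (?X i) = \<phi> i" if "i \<in> V"
    using ev_var[OF that, of "\<one>\<^bsub>?F\<^esub>"] that by (simp add: ev_one \<phi>c R.indexed_var_poly_carrier)
qed

section \<open>Dual bases\<close>

text \<open>
  A linear combination of a family is rewritten as one over the set of its members, for a family
  that may repeat members: the coefficients of equal members are added up.
\<close>
lemma (in module) finsum_fibres:
  assumes "finite I" "finite B" "g ` I \<subseteq> B" "g ` I \<subseteq> carrier M" "\<And>i. i \<in> I \<Longrightarrow> c i \<in> carrier R"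
    "B \<subseteq> carrier M"
  shows "(\<Oplus>\<^bsub>M\<^esub>b\<in>B. (\<Oplus>i\<in>I. if g i = b then c i else \<zero>) \<odot>\<^bsub>M\<^esub> b) = (\<Oplus>\<^bsub>M\<^esub>i\<in>I. c i \<odot>\<^bsub>M\<^esub> g i)"
  using assms(1,3-5)
proof (induction I)
  case empty
  have "(\<Oplus>\<^bsub>M\<^esub>b\<in>B. \<zero> \<odot>\<^bsub>M\<^esub> b) = (\<Oplus>\<^bsub>M\<^esub>b\<in>B. \<zero>\<^bsub>M\<^esub>)"
    using assms(6) by (intro M.finsum_cong') auto
  then show ?case by simp
next
  case (insert i I)
  let ?s = "\<lambda>I b. (\<Oplus>i\<in>I. if g i = b then c i else \<zero>)"
  have s: "?s I b \<in> carrier R" for b using insert.prems by (intro R.finsum_closed) auto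
  have gi: "g i \<in> B" "g i \<in> carrier M" "c i \<in> carrier R" using insert.prems by auto
  have "(\<Oplus>\<^bsub>M\<^esub>b\<in>B. ?s (insert i I) b \<odot>\<^bsub>M\<^esub> b) =
      (\<Oplus>\<^bsub>M\<^esub>b\<in>B. (if g i = b then c i \<odot>\<^bsub>M\<^esub> g i else \<zero>\<^bsub>M\<^esub>) \<oplus>\<^bsub>M\<^esub> ?s I b \<odot>\<^bsub>M\<^esub> b)"
  proof (intro M.finsum_cong')
    fix b assume b: "b \<in> B"
    have "?s (insert i I) b = (if g i = b then c i else \<zero>) \<oplus> ?s I b"
      using insert by (subst R.finsum_insert) auto
    then show "?s (insert i I) b \<odot>\<^bsub>M\<^esub> b =
        (if g i = b then c i \<odot>\<^bsub>M\<^esub> g i else \<zero>\<^bsub>M\<^esub>) \<oplus>\<^bsub>M\<^esub> ?s I b \<odot>\<^bsub>M\<^esub> b"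
      using gi s b assms(6) by (auto simp: smult_l_distr)
  qed (use s gi assms(6) in auto)
  also have "\<dots> = (\<Oplus>\<^bsub>M\<^esub>b\<in>B. if g i = b then c i \<odot>\<^bsub>M\<^esub> g i else \<zero>\<^bsub>M\<^esub>) \<oplus>\<^bsub>M\<^esub> (\<Oplus>\<^bsub>M\<^esub>b\<in>B. ?s I b \<odot>\<^bsub>M\<^esub> b)"
    using s gi assms(6) by (intro M.finsum_addf) auto
  also have "(\<Oplus>\<^bsub>M\<^esub>b\<in>B. if g i = b then c i \<odot>\<^bsub>M\<^esub> g i else \<zero>\<^bsub>M\<^esub>) = c i \<odot>\<^bsub>M\<^esub> g i"
    using M.finsum_singleton[of "g i" B "\<lambda>_. c i \<odot>\<^bsub>M\<^esub> g i"] gi assms(2) by auto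
  also have "(\<Oplus>\<^bsub>M\<^esub>b\<in>B. ?s I b \<odot>\<^bsub>M\<^esub> b) = (\<Oplus>\<^bsub>M\<^esub>i\<in>I. c i \<odot>\<^bsub>M\<^esub> g i)"
    using insert by auto
  finally show ?case
    using insert gi by (subst M.finsum_insert) auto
qed

text \<open>
  A finite dual basis makes \<open>M\<close> a summand of a free module: \<open>x\<close> is sent to its coordinates, and
  coordinates are sent back to the linear combination of the \<open>g i\<close>.  Since free modules are indexed
  by elements of \<open>M\<close> here, the coordinates of repeated \<open>g i\<close> are added up in \<open>s\<close>.
\<close>
theorem (in module) dual_basis_projective:
  assumes I: "finite I" and g: "\<And>i. i \<in> I \<Longrightarrow> g i \<in> carrier M"
    and \<phi>: "\<And>i x. i \<in> I \<Longrightarrow> x \<in> carrier M \<Longrightarrow> \<phi> i x \<in> carrier R"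
    and \<phi>_add: "\<And>i x y. i \<in> I \<Longrightarrow> x \<in> carrier M \<Longrightarrow> y \<in> carrier M \<Longrightarrow> \<phi> i (x \<oplus>\<^bsub>M\<^esub> y) = \<phi> i x \<oplus> \<phi> i y"
    and \<phi>_smult: "\<And>i r x. i \<in> I \<Longrightarrow> r \<in> carrier R \<Longrightarrow> x \<in> carrier M \<Longrightarrow> \<phi> i (r \<odot>\<^bsub>M\<^esub> x) = r \<otimes> \<phi> i x"
    and expand: "\<And>x. x \<in> carrier M \<Longrightarrow> x = (\<Oplus>\<^bsub>M\<^esub>i\<in>I. \<phi> i x \<odot>\<^bsub>M\<^esub> g i)"
  shows "finitely_generated_module R M" and "projective_module R M"
proof -
  let ?B = "g ` I"
  define s where "s x b = (\<Oplus>i\<in>I. if g i = b then \<phi> i x else \<zero>)" for x b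
  have B: "finite ?B" "?B \<subseteq> carrier M" using I g by auto
  have s_closed: "s x b \<in> carrier R" if "x \<in> carrier M" for x b
    using that \<phi> unfolding s_def by (intro R.finsum_closed) auto
  have s_expand: "(\<Oplus>\<^bsub>M\<^esub>b\<in>?B. s x b \<odot>\<^bsub>M\<^esub> b) = x" if "x \<in> carrier M" for x
    using finsum_fibres[OF I B(1), of g "\<lambda>i. \<phi> i x"] B that \<phi> expand[OF that] by (simp add: s_def)
  have s_out: "s x b = \<zero>" if "b \<notin> ?B" for x b
  proof -
    have "s x b = (\<Oplus>i\<in>I. \<zero>)"
      unfolding s_def using that by (intro R.finsum_cong') auto
    then show ?thesis by simp
  qed
  have mod: "module R M" by (rule module_axioms)
  show "finitely_generated_module R M"
    unfolding finitely_generated_module_def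
    using mod B s_closed s_expand[symmetric] by (intro conjI exI[of _ ?B]) (auto intro!: bexI[of _ "s _"])
  define p where "p f = (\<Oplus>\<^bsub>M\<^esub>b\<in>?B. f b \<odot>\<^bsub>M\<^esub> b)" for f
  have "s \<in> mod_hom R M (free_module R ?B)"
    unfolding mod_hom_def
  proof (intro CollectI conjI ballI funcsetI)
    fix x assume x: "x \<in> carrier M"
    have "{b. s x b \<noteq> \<zero>} \<subseteq> ?B" using s_out by blast
    then show "s x \<in> carrier (free_module R ?B)"
      using x s_closed s_out B(1) by (auto simp: free_module_def intro: finite_subset)
    fix y assume y: "y \<in> carrier M"
    show "s (x \<oplus>\<^bsub>M\<^esub> y) = s x \<oplus>\<^bsub>free_module R ?B\<^esub> s y"
    proof
      fix b
      have "s (x \<oplus>\<^bsub>M\<^esub> y) b = (\<Oplus>i\<in>I. (if g i = b then \<phi> i x else \<zero>) \<oplus> (if g i = b then \<phi> i y else \<zero>))"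
        unfolding s_def using x y \<phi> by (intro R.finsum_cong') (auto simp: \<phi>_add)
      also have "\<dots> = s x b \<oplus> s y b"
        unfolding s_def using x y \<phi> by (intro R.finsum_addf) auto
      finally show "s (x \<oplus>\<^bsub>M\<^esub> y) b = (s x \<oplus>\<^bsub>free_module R ?B\<^esub> s y) b"
        by (simp add: free_module_def)
    qed
  next
    fix r x assume r: "r \<in> carrier R" and x: "x \<in> carrier M"
    show "s (r \<odot>\<^bsub>M\<^esub> x) = r \<odot>\<^bsub>free_module R ?B\<^esub> s x"
    proof
      fix b
      have "s (r \<odot>\<^bsub>M\<^esub> x) b = (\<Oplus>i\<in>I. r \<otimes> (if g i = b then \<phi> i x else \<zero>))"
        unfolding s_def using r x \<phi> by (intro R.finsum_cong') (auto simp: \<phi>_smult)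
      also have "\<dots> = r \<otimes> s x b"
        unfolding s_def using r x I \<phi> by (intro R.finsum_rdistr[symmetric]) auto
      finally show "s (r \<odot>\<^bsub>M\<^esub> x) b = (r \<odot>\<^bsub>free_module R ?B\<^esub> s x) b"
        by (simp add: free_module_def)
    qed
  qed
  moreover have "p \<in> mod_hom R (free_module R ?B) M"
    unfolding mod_hom_def
  proof (intro CollectI conjI ballI funcsetI)
    fix f assume "f \<in> carrier (free_module R ?B)"
    then have f: "f b \<in> carrier R" for b by (simp add: free_module_def)
    show "p f \<in> carrier M" unfolding p_def using f B(2) by (intro M.finsum_closed) auto
    fix h assume "h \<in> carrier (free_module R ?B)"
    then have h: "h b \<in> carrier R" for b by (simp add: free_module_def)
    have "p (f \<oplus>\<^bsub>free_module R ?B\<^esub> h) = (\<Oplus>\<^bsub>M\<^esub>b\<in>?B. f b \<odot>\<^bsub>M\<^esub> b \<oplus>\<^bsub>M\<^esub> h b \<odot>\<^bsub>M\<^esub> b)"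
      unfolding p_def using f h B(2) by (intro M.finsum_cong') (auto simp: free_module_def smult_l_distr)
    also have "\<dots> = p f \<oplus>\<^bsub>M\<^esub> p h"
      unfolding p_def using f h B(2) by (intro M.finsum_addf) auto
    finally show "p (f \<oplus>\<^bsub>free_module R ?B\<^esub> h) = p f \<oplus>\<^bsub>M\<^esub> p h" .
  next
    fix r f assume r: "r \<in> carrier R" and "f \<in> carrier (free_module R ?B)"
    then have f: "f b \<in> carrier R" for b by (simp add: free_module_def)
    have "p (r \<odot>\<^bsub>free_module R ?B\<^esub> f) = (\<Oplus>\<^bsub>M\<^esub>b\<in>?B. r \<odot>\<^bsub>M\<^esub> (f b \<odot>\<^bsub>M\<^esub> b))"
      unfolding p_def using r f B(2) by (intro M.finsum_cong') (auto simp: free_module_def smult_assoc1)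
    also have "\<dots> = r \<odot>\<^bsub>M\<^esub> p f"
      unfolding p_def using r f B by (intro finsum_smult_ldistr[symmetric]) auto
    finally show "p (r \<odot>\<^bsub>free_module R ?B\<^esub> f) = r \<odot>\<^bsub>M\<^esub> p f" .
  qed
  moreover have "p (s x) = x" if "x \<in> carrier M" for x
    using s_expand[OF that] by (simp add: p_def)
  ultimately show "projective_module R M"
    unfolding projective_module_def using mod by blast
qed

section \<open>The symmetric algebra\<close>

text \<open>The canonical map from \<open>M\<close> into its symmetric algebra.\<close>
definition symmetric_var ::
    "('r, 'k) ring_scheme \<Rightarrow> ('r, 'm, 'l) module_scheme \<Rightarrow> 'm \<Rightarrow> ('m multiset \<Rightarrow> 'r) set"
  where "symmetric_var R M x =
    (let F = polynomial_algebra R (carrier M) in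
      Idl\<^bsub>F\<^esub> (symmetric_relations R M) +>\<^bsub>F\<^esub> ring.indexed_var R x)"

context module
begin

text \<open>
  The relations have no constant term, so the ideal that they generate lies in the augmentation
  ideal and the quotient is augmented.
\<close>
lemma symmetric_relations_ideal:
  shows "symmetric_relations R M \<subseteq> carrier (polynomial_algebra R (carrier M))"
    and "ideal (Idl\<^bsub>polynomial_algebra R (carrier M)\<^esub> (symmetric_relations R M)) (polynomial_algebra R (carrier M))"
    and "Idl\<^bsub>polynomial_algebra R (carrier M)\<^esub> (symmetric_relations R M) \<subseteq>
      aug_ideal R (polynomial_algebra R (carrier M))"
proof -
  let ?F = "polynomial_algebra R (carrier M)"
  interpret cF: cring ?F by (rule cring_augmented_algebra[OF R.augmented_algebra_polynomial])
  interpret F: augmented_algebra R ?F by (rule R.augmented_algebra_polynomial)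
  have v: "R.indexed_var x \<in> carrier ?F" "aug ?F (R.indexed_var x) = \<zero>" if "x \<in> carrier M" for x
    using that by (simp_all add: R.indexed_var_poly_carrier R.polynomial_simps R.power_series_simps R.indexed_var_apply)
  show sub: "symmetric_relations R M \<subseteq> carrier ?F"
    unfolding symmetric_relations_def Let_def by (auto simp: v)
  show "ideal (Idl\<^bsub>?F\<^esub> (symmetric_relations R M)) ?F"
    by (rule cF.genideal_ideal[OF sub])
  have "symmetric_relations R M \<subseteq> aug_ideal R ?F"
    unfolding symmetric_relations_def Let_def
    by (auto simp: F.mem_aug_ideal F.aug_diff v augD[OF F.augmented_algebra_axioms] a_minus_def[of R])
  then show "Idl\<^bsub>?F\<^esub> (symmetric_relations R M) \<subseteq> aug_ideal R ?F"
    by (rule cF.genideal_minimal[OF F.ideal_aug_ideal])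
qed

lemma augmented_algebra_symmetric: "augmented_algebra R (symmetric_algebra R M)"
  unfolding symmetric_algebra_def Let_def
  by (rule augmented_algebra.augmented_algebra_aug_quot[OF R.augmented_algebra_polynomial
        symmetric_relations_ideal(2,3)])

lemma symmetric_proj:
  "(\<lambda>f. Idl\<^bsub>polynomial_algebra R (carrier M)\<^esub> (symmetric_relations R M) +>\<^bsub>polynomial_algebra R (carrier M)\<^esub> f)
    \<in> aug_hom R (polynomial_algebra R (carrier M)) (symmetric_algebra R M)"
  unfolding symmetric_algebra_def Let_def
  by (rule augmented_algebra.aug_quot_proj[OF R.augmented_algebra_polynomial
        symmetric_relations_ideal(2,3)])

lemma symmetric_var_aug_ideal:
  assumes "x \<in> carrier M"
  shows "symmetric_var R M x \<in> aug_ideal R (symmetric_algebra R M)"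
proof -
  interpret S: augmented_algebra R "symmetric_algebra R M" by (rule augmented_algebra_symmetric)
  note \<pi> = aug_homD[OF symmetric_proj]
  show ?thesis
    using assms R.indexed_var_poly_carrier[of x "carrier M"]
    by (simp add: S.mem_aug_ideal symmetric_var_def Let_def \<pi> R.polynomial_simps R.power_series_simps R.indexed_var_apply)
qed

lemma symmetric_var_linear:
  shows "x \<in> carrier M \<Longrightarrow> y \<in> carrier M \<Longrightarrow> symmetric_var R M (x \<oplus>\<^bsub>M\<^esub> y) =
      symmetric_var R M x \<oplus>\<^bsub>symmetric_algebra R M\<^esub> symmetric_var R M y"
    and "r \<in> carrier R \<Longrightarrow> x \<in> carrier M \<Longrightarrow> symmetric_var R M (r \<odot>\<^bsub>M\<^esub> x) =
      r \<odot>\<^bsub>symmetric_algebra R M\<^esub> symmetric_var R M x"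
proof -
  let ?F = "polynomial_algebra R (carrier M)"
  interpret cF: cring ?F by (rule cring_augmented_algebra[OF R.augmented_algebra_polynomial])
  interpret F: augmented_algebra R ?F by (rule R.augmented_algebra_polynomial)
  let ?K = "Idl\<^bsub>?F\<^esub> (symmetric_relations R M)"
  note \<pi> = aug_homD[OF symmetric_proj]
  have v: "R.indexed_var x \<in> carrier ?F" if "x \<in> carrier M" for x
    using that by (rule R.indexed_var_poly_carrier)
  have eq: "?K +>\<^bsub>?F\<^esub> f = ?K +>\<^bsub>?F\<^esub> g"
    if "f \<ominus>\<^bsub>?F\<^esub> g \<in> symmetric_relations R M" "f \<in> carrier ?F" "g \<in> carrier ?F" for f g
    using that cF.genideal_self[OF symmetric_relations_ideal(1)]
    by (auto simp: F.coset_eq_iff[OF symmetric_relations_ideal(2)])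
  show "symmetric_var R M (x \<oplus>\<^bsub>M\<^esub> y) =
      symmetric_var R M x \<oplus>\<^bsub>symmetric_algebra R M\<^esub> symmetric_var R M y"
    if "x \<in> carrier M" "y \<in> carrier M"
  proof -
    have "?K +>\<^bsub>?F\<^esub> R.indexed_var (x \<oplus>\<^bsub>M\<^esub> y) = ?K +>\<^bsub>?F\<^esub> (R.indexed_var x \<oplus>\<^bsub>?F\<^esub> R.indexed_var y)"
      using that v by (intro eq) (auto simp: symmetric_relations_def Let_def)
    then show ?thesis using that v by (simp add: symmetric_var_def Let_def \<pi>)
  qed
  show "symmetric_var R M (r \<odot>\<^bsub>M\<^esub> x) = r \<odot>\<^bsub>symmetric_algebra R M\<^esub> symmetric_var R M x"
    if "r \<in> carrier R" "x \<in> carrier M"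
  proof -
    have "?K +>\<^bsub>?F\<^esub> R.indexed_var (r \<odot>\<^bsub>M\<^esub> x) = ?K +>\<^bsub>?F\<^esub> (r \<odot>\<^bsub>?F\<^esub> R.indexed_var x)"
      using that v by (intro eq) (auto simp: symmetric_relations_def Let_def)
    then show ?thesis using that v by (simp add: symmetric_var_def Let_def \<pi>)
  qed
qed

text \<open>\<open>M\<close> generates its symmetric algebra, because the variables generate the polynomials above it.\<close>
lemma symmetric_induct [consumes 1, case_names const add var]:
  assumes x: "x \<in> carrier (symmetric_algebra R M)"
    and const: "\<And>r. r \<in> carrier R \<Longrightarrow> Q (r \<odot>\<^bsub>symmetric_algebra R M\<^esub> \<one>\<^bsub>symmetric_algebra R M\<^esub>)"
    and add: "\<And>y z. y \<in> carrier (symmetric_algebra R M) \<Longrightarrow> z \<in> carrier (symmetric_algebra R M) \<Longrightarrow>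
      Q y \<Longrightarrow> Q z \<Longrightarrow> Q (y \<oplus>\<^bsub>symmetric_algebra R M\<^esub> z)"
    and var: "\<And>u y. u \<in> carrier M \<Longrightarrow> y \<in> carrier (symmetric_algebra R M) \<Longrightarrow> Q y \<Longrightarrow>
      Q (symmetric_var R M u \<otimes>\<^bsub>symmetric_algebra R M\<^esub> y)"
  shows "Q x"
proof -
  let ?F = "polynomial_algebra R (carrier M)"
  interpret F: augmented_algebra R ?F by (rule R.augmented_algebra_polynomial)
  let ?\<pi> = "\<lambda>f. Idl\<^bsub>?F\<^esub> (symmetric_relations R M) +>\<^bsub>?F\<^esub> f"
  note \<pi> = aug_homD[OF symmetric_proj]
  from x obtain f where f: "f \<in> carrier ?F" "x = ?\<pi> f"
    by (auto simp: symmetric_algebra_def Let_def F.aug_quot_carrier)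
  from f(1) have "Q (?\<pi> f)"
  proof (induction f rule: R.polynomial_induct)
    case (const r)
    then show ?case using assms(2)[of r] by (simp add: \<pi>)
  next
    case (add g h)
    then show ?case using assms(3)[of "?\<pi> g" "?\<pi> h"] by (simp add: \<pi>)
  next
    case (var i g)
    then show ?case using assms(4)[of i "?\<pi> g"] R.indexed_var_poly_carrier[of i "carrier M"]
      by (simp add: \<pi> symmetric_var_def Let_def)
  qed
  with f(2) show ?thesis by simp
qed

theorem symmetric_algebra_universal:
  assumes T: "augmented_algebra R T"
    and \<phi>: "\<And>x. x \<in> carrier M \<Longrightarrow> \<phi> x \<in> aug_ideal R T"
    and add: "\<And>x y. x \<in> carrier M \<Longrightarrow> y \<in> carrier M \<Longrightarrow> \<phi> (x \<oplus>\<^bsub>M\<^esub> y) = \<phi> x \<oplus>\<^bsub>T\<^esub> \<phi> y"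
    and smult: "\<And>r x. r \<in> carrier R \<Longrightarrow> x \<in> carrier M \<Longrightarrow> \<phi> (r \<odot>\<^bsub>M\<^esub> x) = r \<odot>\<^bsub>T\<^esub> \<phi> x"
  shows "\<exists>g \<in> aug_hom R (symmetric_algebra R M) T.
    (\<forall>x \<in> carrier M. g (symmetric_var R M x) = \<phi> x)"
proof -
  let ?F = "polynomial_algebra R (carrier M)"
  let ?K = "Idl\<^bsub>?F\<^esub> (symmetric_relations R M)"
  interpret cF: cring ?F by (rule cring_augmented_algebra[OF R.augmented_algebra_polynomial])
  interpret F: augmented_algebra R ?F by (rule R.augmented_algebra_polynomial)
  interpret cT: cring T by (rule cring_augmented_algebra[OF T])
  interpret T: augmented_algebra R T by (rule T)
  define ev where "ev = eval_poly R T \<phi>"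
  have ev: "ev \<in> aug_hom R ?F T" "\<And>x. x \<in> carrier M \<Longrightarrow> ev (R.indexed_var x) = \<phi> x"
    unfolding ev_def
    by (rule eval_poly_aug_hom(1)[OF R.is_cring T \<phi>], assumption,
        rule eval_poly_aug_hom(2)[OF R.is_cring T \<phi>, where V = "carrier M"])
  interpret ev: ring_hom_cring ?F T ev
    by (rule aug_hom_ring_hom_cring[OF R.augmented_algebra_polynomial T ev(1)])
  have \<phi>c: "\<phi> x \<in> carrier T" if "x \<in> carrier M" for x using \<phi>[OF that] by (simp add: T.mem_aug_ideal)
  have v: "R.indexed_var x \<in> carrier ?F" if "x \<in> carrier M" for x
    using that by (rule R.indexed_var_poly_carrier)
  have "symmetric_relations R M \<subseteq> a_kernel ?F T ev"
    unfolding symmetric_relations_def Let_def a_kernel_def'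
    using v by (auto simp: a_minus_def ev(2) aug_homD(5)[OF ev(1)] add smult \<phi>c cT.r_neg)
  then have K: "?K \<subseteq> a_kernel ?F T ev"
    by (intro cF.genideal_minimal[OF ring_hom_ring.kernel_is_ideal] ring_hom_ringI2[OF F.ring_A T.ring_A ev.homh])
  have ker: "ev f = \<zero>\<^bsub>T\<^esub>" if "f \<in> ?K" for f
    using subsetD[OF K that] unfolding a_kernel_def' by blast
  from F.aug_quot_lift[OF T symmetric_relations_ideal(2,3) ev(1) ker]
  obtain g where "g \<in> aug_hom R (aug_quot ?F ?K) T" "\<And>f. f \<in> carrier ?F \<Longrightarrow> g (?K +>\<^bsub>?F\<^esub> f) = ev f"
    by blast
  then show ?thesis
    using v ev(2) by (intro bexI[of _ g]) (auto simp: symmetric_algebra_def symmetric_var_def Let_def)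
qed

end

section \<open>Retracts of power series algebras\<close>

context cring
begin

text \<open>
  The form \<open>\<Sum>\<^sub>i y\<^sub>i X\<^sub>i\<close>, given by its coefficients: \<open>the_elem\<close> returns the variable of a monomial of
  degree one.
\<close>
definition linear_form :: "('v \<Rightarrow> 'a) \<Rightarrow> 'v multiset \<Rightarrow> 'a"
  where "linear_form y m = (if size m = 1 then y (the_elem (set_mset m)) else \<zero>)"

lemma linear_form_apply [simp]:
  "linear_form y {#i#} = y i" "linear_form y {#} = \<zero>" "size m \<noteq> 1 \<Longrightarrow> linear_form y m = \<zero>"
  by (simp_all add: linear_form_def)

lemma linear_form_cases:
  obtains i where "m = {#i#}" "linear_form y m = y i" | "size m \<noteq> 1" "linear_form y m = \<zero>"
proof (cases "size m = 1")
  case True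
  then obtain i where "m = {#i#}" using size_1_singleton_mset by blast
  then show ?thesis using that(1) by simp
next
  case False
  then show ?thesis using that(2) by simp
qed

end

definition linear_part :: "('v multiset \<Rightarrow> 'r) \<Rightarrow> 'v \<Rightarrow> 'r"
  where "linear_part f i = f {#i#}"

locale power_series_retract = cring R
  for R :: "('r, 'k) ring_scheme" (structure) +
  fixes V :: "'v :: linorder set" and A :: "('r, 'a, 'l) aug_algebra_scheme"
    and s :: "'a \<Rightarrow> 'v multiset \<Rightarrow> 'r" and p :: "('v multiset \<Rightarrow> 'r) \<Rightarrow> 'a"
  assumes finite_V: "finite V"
    and complete_A: "complete_augmented_algebra R A"
    and s_hom: "s \<in> aug_hom R A (power_series_algebra R V)"
    and p_hom: "p \<in> aug_hom R (power_series_algebra R V) A"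
    and p_s: "a \<in> carrier A \<Longrightarrow> p (s a) = a"
begin

abbreviation "B \<equiv> power_series_algebra R V"
abbreviation "F \<equiv> polynomial_algebra R V"

lemma aug_A: "augmented_algebra R A"
  by (rule complete_augmented_algebra.axioms(1)[OF complete_A])

sublocale A: cring A by (rule cring_augmented_algebra[OF aug_A])
sublocale A: augmented_algebra R A by (rule aug_A)
sublocale B: cring B by (rule cring_augmented_algebra[OF augmented_algebra_power_series])
sublocale B: augmented_algebra R B by (rule augmented_algebra_power_series)
sublocale F: cring F by (rule cring_augmented_algebra[OF augmented_algebra_polynomial])
sublocale F: augmented_algebra R F by (rule augmented_algebra_polynomial)
sublocale s: ring_hom_cring A B s by (rule aug_hom_ring_hom_cring[OF aug_A B.augmented_algebra_axioms s_hom])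
sublocale p: ring_hom_cring B A p by (rule aug_hom_ring_hom_cring[OF B.augmented_algebra_axioms aug_A p_hom])

lemma p_diff: "f \<in> carrier B \<Longrightarrow> g \<in> carrier B \<Longrightarrow> p (f \<ominus>\<^bsub>B\<^esub> g) = p f \<ominus>\<^bsub>A\<^esub> p g"
  by (simp add: a_minus_def)

lemma s_diff: "a \<in> carrier A \<Longrightarrow> b \<in> carrier A \<Longrightarrow> s (a \<ominus>\<^bsub>A\<^esub> b) = s a \<ominus>\<^bsub>B\<^esub> s b"
  by (simp add: a_minus_def)

text \<open>
  A copy of \<open>I/I\<^sup>2\<close> inside the functions from \<open>V\<close> to \<open>R\<close>: the linear part of \<open>s a\<close> determines \<open>a\<close>
  modulo \<open>I\<^sup>2\<close>, since \<open>s a \<in> J\<^sup>2\<close> implies \<open>a = p (s a) \<in> I\<^sup>2\<close>.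
\<close>
definition cotangent :: "('r, 'v \<Rightarrow> 'r) module"
  where "cotangent = \<lparr>carrier = linear_part ` s ` aug_ideal R A,
     monoid.mult = undefined, monoid.one = undefined,
     ring.zero = (\<lambda>i. \<zero>), ring.add = (\<lambda>y z i. y i \<oplus> z i),
     module.smult = (\<lambda>r y i. r \<otimes> y i)\<rparr>"

lemma cotangent_simps:
  "\<zero>\<^bsub>cotangent\<^esub> = (\<lambda>i. \<zero>)"
  "y \<oplus>\<^bsub>cotangent\<^esub> z = (\<lambda>i. y i \<oplus> z i)"
  "r \<odot>\<^bsub>cotangent\<^esub> y = (\<lambda>i. r \<otimes> y i)"
  by (simp_all add: cotangent_def)

lemma cotangentE:
  assumes "y \<in> carrier cotangent"
  obtains a where "a \<in> aug_ideal R A" "y = linear_part (s a)"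
  using assms by (auto simp: cotangent_def)

lemma linear_part_cotangent: "a \<in> aug_ideal R A \<Longrightarrow> linear_part (s a) \<in> carrier cotangent"
  by (simp add: cotangent_def)

lemma cotangent_closed: "y \<in> carrier cotangent \<Longrightarrow> y i \<in> carrier R"
  by (erule cotangentE)
    (auto simp: linear_part_def A.mem_aug_ideal intro: power_series_closed[OF s.hom_closed])

lemma cotangent_outside: "y \<in> carrier cotangent \<Longrightarrow> i \<notin> V \<Longrightarrow> y i = \<zero>"
proof (erule cotangentE)
  fix a assume "i \<notin> V" "a \<in> aug_ideal R A" "y = linear_part (s a)"
  then show "y i = \<zero>"
    using s.hom_closed[of a] by (simp add: linear_part_def A.mem_aug_ideal power_series_carrier)
qed

lemma cotangent_add: "y \<in> carrier cotangent \<Longrightarrow> z \<in> carrier cotangent \<Longrightarrow> y \<oplus>\<^bsub>cotangent\<^esub> z \<in> carrier cotangent"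
proof (elim cotangentE)
  fix a b assume ab: "a \<in> aug_ideal R A" "y = linear_part (s a)" "b \<in> aug_ideal R A" "z = linear_part (s b)"
  then have "y \<oplus>\<^bsub>cotangent\<^esub> z = linear_part (s (a \<oplus>\<^bsub>A\<^esub> b))"
    by (simp add: cotangent_simps linear_part_def fun_eq_iff A.mem_aug_ideal power_series_simps)
  moreover have "a \<oplus>\<^bsub>A\<^esub> b \<in> aug_ideal R A" using ab by (simp add: A.mem_aug_ideal augD[OF aug_A])
  ultimately show ?thesis by (simp add: linear_part_cotangent)
qed

lemma cotangent_smult: "r \<in> carrier R \<Longrightarrow> y \<in> carrier cotangent \<Longrightarrow> r \<odot>\<^bsub>cotangent\<^esub> y \<in> carrier cotangent"
proof (elim cotangentE)
  fix a assume a: "r \<in> carrier R" "a \<in> aug_ideal R A" "y = linear_part (s a)"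
  then have "r \<odot>\<^bsub>cotangent\<^esub> y = linear_part (s (r \<odot>\<^bsub>A\<^esub> a))"
    by (simp add: cotangent_simps linear_part_def fun_eq_iff A.mem_aug_ideal power_series_simps aug_homD(5)[OF s_hom])
  moreover have "r \<odot>\<^bsub>A\<^esub> a \<in> aug_ideal R A" using a by (simp add: A.mem_aug_ideal augD[OF aug_A])
  ultimately show ?thesis by (simp add: linear_part_cotangent)
qed

lemma module_cotangent: "module R cotangent"
proof (rule moduleI)
  show "abelian_group cotangent"
  proof (rule abelian_groupI)
    show "\<zero>\<^bsub>cotangent\<^esub> \<in> carrier cotangent"
    proof -
      have "linear_part (s \<zero>\<^bsub>A\<^esub>) \<in> carrier cotangent"
        by (rule linear_part_cotangent) (simp add: A.mem_aug_ideal A.aug_zero)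
      moreover have "\<zero>\<^bsub>cotangent\<^esub> = linear_part (s \<zero>\<^bsub>A\<^esub>)"
        by (simp add: cotangent_simps linear_part_def fun_eq_iff power_series_simps)
      ultimately show ?thesis by (simp only:)
    qed
    fix y assume y: "y \<in> carrier cotangent"
    have "(\<ominus> \<one>) \<odot>\<^bsub>cotangent\<^esub> y \<oplus>\<^bsub>cotangent\<^esub> y = \<zero>\<^bsub>cotangent\<^esub>"
      using cotangent_closed[OF y] by (simp add: cotangent_simps l_minus l_neg)
    then show "\<exists>z\<in>carrier cotangent. z \<oplus>\<^bsub>cotangent\<^esub> y = \<zero>\<^bsub>cotangent\<^esub>"
      using cotangent_smult[of "\<ominus> \<one>" y] y by auto
  qed (auto simp: cotangent_add, auto simp: cotangent_simps cotangent_closed a_ac)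
qed (auto simp: is_cring cotangent_smult, auto simp: cotangent_simps cotangent_closed l_distr r_distr m_assoc)

sublocale P: module R cotangent by (rule module_cotangent)

lemma linear_form_carrier: "y \<in> carrier cotangent \<Longrightarrow> linear_form y \<in> carrier F"
proof -
  assume y: "y \<in> carrier cotangent"
  have "finite {m. linear_form y m \<noteq> \<zero>}"
  proof (rule finite_subset)
    show "{m. linear_form y m \<noteq> \<zero>} \<subseteq> (\<lambda>i. {#i#}) ` V"
    proof
      fix m assume "m \<in> {m. linear_form y m \<noteq> \<zero>}"
      then show "m \<in> (\<lambda>i. {#i#}) ` V"
        using cotangent_outside[OF y] by (cases rule: linear_form_cases[of m y]) auto
    qed
  qed (simp add: finite_V)
  moreover have "linear_form y m \<in> carrier R \<and> (\<not> set_mset m \<subseteq> V \<longrightarrow> linear_form y m = \<zero>)" for m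
    using cotangent_outside[OF y] cotangent_closed[OF y] by (cases rule: linear_form_cases[of m y]) auto
  ultimately show ?thesis by (simp add: polynomial_carrier power_series_carrier)
qed

lemma poly_carrier_subset: "f \<in> carrier F \<Longrightarrow> f \<in> carrier B"
  by (simp add: polynomial_carrier)

lemma linear_form_add: "linear_form (y \<oplus>\<^bsub>cotangent\<^esub> z) = linear_form y \<oplus>\<^bsub>F\<^esub> linear_form z"
  by (simp add: fun_eq_iff linear_form_def cotangent_simps polynomial_simps power_series_simps)

lemma linear_form_smult:
  "r \<in> carrier R \<Longrightarrow> linear_form (r \<odot>\<^bsub>cotangent\<^esub> y) = r \<odot>\<^bsub>F\<^esub> linear_form y"
  by (simp add: fun_eq_iff linear_form_def cotangent_simps polynomial_simps power_series_simps)

lemma linear_form_aug_ideal: "y \<in> carrier cotangent \<Longrightarrow> linear_form y \<in> aug_ideal R F"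
  by (simp add: F.mem_aug_ideal linear_form_carrier polynomial_simps power_series_simps)

text \<open>
  A series without constant term is congruent to its linear part modulo \<open>J\<^sup>2\<close>.  Here the finiteness
  of \<open>V\<close> enters.
\<close>
lemma linear_form_linear_part:
  assumes "a \<in> aug_ideal R A"
  shows "linear_form (linear_part (s a)) \<ominus>\<^bsub>B\<^esub> s a \<in> aug_pow R B (Suc (Suc 0))"
proof (rule vanishes_below_2_aug_pow[OF finite_V])
  have a: "a \<in> carrier A" "s a {#} = \<zero>"
    using assms aug_homD(6)[OF s_hom, of a] by (simp_all add: A.mem_aug_ideal power_series_simps)
  have l: "linear_form (linear_part (s a)) \<in> carrier B"
    by (rule poly_carrier_subset[OF linear_form_carrier[OF linear_part_cotangent[OF assms]]])
  show "linear_form (linear_part (s a)) \<ominus>\<^bsub>B\<^esub> s a \<in> carrier B" using l a by simp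
  show "vanishes_below (Suc (Suc 0)) (linear_form (linear_part (s a)) \<ominus>\<^bsub>B\<^esub> s a)"
    unfolding vanishes_below_def
  proof (intro allI impI)
    fix m :: "'v multiset" assume m: "size m < Suc (Suc 0)"
    have sm: "s a m \<in> carrier R" by (rule power_series_closed[OF s.hom_closed[OF a(1)]])
    have "linear_form (linear_part (s a)) m = s a m"
    proof (cases rule: linear_form_cases[of m "linear_part (s a)"])
      case 2
      with m have "m = {#}" by (cases m) auto
      then show ?thesis using a(2) by simp
    qed (simp add: linear_part_def)
    then show "(linear_form (linear_part (s a)) \<ominus>\<^bsub>B\<^esub> s a) m = \<zero>"
      using sm by (simp add: power_series_minus[OF l s.hom_closed[OF a(1)]] a_minus_def[of R] r_neg)
  qed
qed

text \<open>
  The endomorphism of \<open>J/J\<^sup>2\<close> induced by \<open>s \<circ> p\<close> is idempotent with image \<open>cotangent\<close>, so it is the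
  identity there.  With \<open>y\<close> the linear part of \<open>s a\<close> and \<open>g = \<ell>\<^sub>y - s a \<in> J\<^sup>2\<close>, idempotence is used as
  \<open>s p (s a) = s a\<close>.
\<close>
lemma sp_linear_form:
  assumes y: "y \<in> carrier cotangent"
  shows "vanishes_below (Suc (Suc 0)) (s (p (linear_form y)) \<ominus>\<^bsub>B\<^esub> linear_form y)"
proof -
  obtain a where a: "a \<in> aug_ideal R A" "y = linear_part (s a)" using y by (rule cotangentE)
  define g where "g = linear_form y \<ominus>\<^bsub>B\<^esub> s a"
  have l: "linear_form y \<in> carrier B" by (rule poly_carrier_subset[OF linear_form_carrier[OF y]])
  have a': "a \<in> carrier A" using a by (simp add: A.mem_aug_ideal)
  have g: "g \<in> aug_pow R B (Suc (Suc 0))" unfolding g_def a(2) by (rule linear_form_linear_part[OF a(1)])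
  have sp: "s (p g) \<in> aug_pow R B (Suc (Suc 0))"
    by (intro aug_hom_aug_pow[OF aug_A B.augmented_algebra_axioms s_hom]
        aug_hom_aug_pow[OF B.augmented_algebra_axioms aug_A p_hom] g)
  have "s (p g) = s (p (linear_form y)) \<ominus>\<^bsub>B\<^esub> s a"
    using l a' by (simp add: g_def p_diff s_diff p_s)
  then have "s (p (linear_form y)) \<ominus>\<^bsub>B\<^esub> linear_form y = s (p g) \<ominus>\<^bsub>B\<^esub> g"
    using l a' by (simp add: g_def a_minus_def B.minus_add B.a_ac B.r_neg1 B.r_neg2 B.l_neg B.r_neg)
  then show ?thesis
    using B.aug_pow_closed(3)[OF sp g] vanishes_below_aug_pow by metis
qed

definition basis_vector :: "'v \<Rightarrow> 'v \<Rightarrow> 'r"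
  where "basis_vector i = linear_part (s (p (indexed_var i)))"

lemma basis_vector_cotangent: "i \<in> V \<Longrightarrow> basis_vector i \<in> carrier cotangent"
  unfolding basis_vector_def
  using indexed_var_carrier[of i V]
  by (intro linear_part_cotangent)
    (simp add: A.mem_aug_ideal aug_homD(6)[OF p_hom] power_series_simps indexed_var_apply)

text \<open>
  Restricting the coefficients to a subset \<open>W\<close> of \<open>V\<close> makes a linear form accessible to induction
  on the set of its variables.
\<close>
lemma linear_form_restrict_insert:
  assumes "i \<in> V" "i \<notin> W" "\<And>i. y i \<in> carrier R"
  shows "linear_form (\<lambda>j. if j \<in> insert i W then y j else \<zero>) =
    y i \<odot>\<^bsub>F\<^esub> indexed_var i \<oplus>\<^bsub>F\<^esub> linear_form (\<lambda>j. if j \<in> W then y j else \<zero>)"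
proof
  fix m
  show "linear_form (\<lambda>j. if j \<in> insert i W then y j else \<zero>) m =
    (y i \<odot>\<^bsub>F\<^esub> indexed_var i \<oplus>\<^bsub>F\<^esub> linear_form (\<lambda>j. if j \<in> W then y j else \<zero>)) m"
    using assms by (cases rule: linear_form_cases[of m y])
      (auto simp: polynomial_simps power_series_simps indexed_var_apply)
qed

lemma linear_form_restrict_closed:
  assumes "W \<subseteq> V" "\<And>i. y i \<in> carrier R"
  shows "linear_form (\<lambda>j. if j \<in> W then y j else \<zero>) \<in> carrier F"
proof -
  have "finite W" using assms(1) finite_V finite_subset by blast
  then show ?thesis using assms(1)
  proof (induction W)
    case empty
    have "linear_form (\<lambda>j. if j \<in> {} then y j else \<zero>) = \<zero>\<^bsub>F\<^esub>"
      by (auto simp: fun_eq_iff linear_form_def polynomial_simps power_series_simps)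
    then show ?case by simp
  next
    case (insert i W)
    then show ?case
      using assms(2) linear_form_restrict_insert[of i W y] indexed_var_poly_carrier[of i V] by simp
  qed
qed

lemma indexed_var_aug_ideal: "i \<in> V \<Longrightarrow> indexed_var i \<in> aug_ideal R F"
  using indexed_var_poly_carrier[of i V]
  by (simp add: F.mem_aug_ideal polynomial_simps power_series_simps indexed_var_apply)

lemma linear_form_restrict_aug_ideal:
  assumes "W \<subseteq> V" "\<And>i. y i \<in> carrier R"
  shows "linear_form (\<lambda>j. if j \<in> W then y j else \<zero>) \<in> aug_ideal R F"
  using linear_form_restrict_closed[OF assms]
  by (simp add: F.mem_aug_ideal polynomial_simps power_series_simps)

text \<open>
  Linearity of \<open>D\<close> is required on the augmentation ideal, where \<open>f \<mapsto> linear_part (s (p f))\<close>, one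
  of the two maps to which this is applied, takes values in \<open>cotangent\<close> by definition; the other
  one is \<open>project\<close>.
\<close>
lemma linear_form_expand:
  assumes N: "module R N" and y: "\<And>i. y i \<in> carrier R" and W: "W \<subseteq> V"
    and D: "\<And>f. f \<in> aug_ideal R F \<Longrightarrow> D f \<in> carrier N"
      "\<And>f g. f \<in> aug_ideal R F \<Longrightarrow> g \<in> aug_ideal R F \<Longrightarrow> D (f \<oplus>\<^bsub>F\<^esub> g) = D f \<oplus>\<^bsub>N\<^esub> D g"
      "\<And>r f. r \<in> carrier R \<Longrightarrow> f \<in> aug_ideal R F \<Longrightarrow> D (r \<odot>\<^bsub>F\<^esub> f) = r \<odot>\<^bsub>N\<^esub> D f"
  shows "D (linear_form (\<lambda>j. if j \<in> W then y j else \<zero>)) = (\<Oplus>\<^bsub>N\<^esub>i\<in>W. y i \<odot>\<^bsub>N\<^esub> D (indexed_var i))"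
proof -
  interpret N: module R N by (rule N)
  have "finite W" using W finite_V finite_subset by blast
  then show ?thesis using W
  proof (induction W)
    case empty
    have "linear_form (\<lambda>j. if j \<in> {} then y j else \<zero>) = \<zero> \<odot>\<^bsub>F\<^esub> \<zero>\<^bsub>F\<^esub>"
      by (auto simp: fun_eq_iff linear_form_def polynomial_simps power_series_simps)
    then have "D (linear_form (\<lambda>j. if j \<in> {} then y j else \<zero>)) = \<zero> \<odot>\<^bsub>N\<^esub> D \<zero>\<^bsub>F\<^esub>"
      using D(3)[of \<zero> "\<zero>\<^bsub>F\<^esub>"] by (simp add: F.mem_aug_ideal F.aug_zero)
    then show ?case using D(1)[of "\<zero>\<^bsub>F\<^esub>"] by (simp add: F.mem_aug_ideal F.aug_zero)
  next
    case (insert i W)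
    have v: "indexed_var j \<in> aug_ideal R F" if "j \<in> insert i W" for j
      using that insert.prems by (intro indexed_var_aug_ideal) auto
    have "D (linear_form (\<lambda>j. if j \<in> insert i W then y j else \<zero>)) =
      y i \<odot>\<^bsub>N\<^esub> D (indexed_var i) \<oplus>\<^bsub>N\<^esub> D (linear_form (\<lambda>j. if j \<in> W then y j else \<zero>))"
      using insert v[OF insertI1] y F.ideal_smult_closed[OF F.ideal_aug_ideal]
      by (simp add: linear_form_restrict_insert D linear_form_restrict_aug_ideal del: insert_iff)
    then show ?case
      using insert y v D(1) by (subst N.M.finsum_insert) auto
  qed
qed

lemma linear_form_cotangent_expand:
  assumes "module R N" "y \<in> carrier cotangent"
    and "\<And>f. f \<in> aug_ideal R F \<Longrightarrow> D f \<in> carrier N"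
      "\<And>f g. f \<in> aug_ideal R F \<Longrightarrow> g \<in> aug_ideal R F \<Longrightarrow> D (f \<oplus>\<^bsub>F\<^esub> g) = D f \<oplus>\<^bsub>N\<^esub> D g"
      "\<And>r f. r \<in> carrier R \<Longrightarrow> f \<in> aug_ideal R F \<Longrightarrow> D (r \<odot>\<^bsub>F\<^esub> f) = r \<odot>\<^bsub>N\<^esub> D f"
  shows "D (linear_form y) = (\<Oplus>\<^bsub>N\<^esub>i\<in>V. y i \<odot>\<^bsub>N\<^esub> D (indexed_var i))"
proof -
  have "(\<lambda>j. if j \<in> V then y j else \<zero>) = y" using cotangent_outside[OF assms(2)] by auto
  then show ?thesis
    using linear_form_expand[where D = D and y = y, OF assms(1) cotangent_closed[OF assms(2)] subset_refl assms(3-5)]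
    by simp
qed

text \<open>
  Both sides are the image of the linear form of \<open>y\<close> under \<open>f \<mapsto> linear_part (s (p f))\<close>: the left
  side because \<open>s \<circ> p\<close> fixes the form up to order two, the right side by linearity.
\<close>
lemma cotangent_expand:
  assumes y: "y \<in> carrier cotangent"
  shows "y = (\<Oplus>\<^bsub>cotangent\<^esub>i\<in>V. y i \<odot>\<^bsub>cotangent\<^esub> basis_vector i)"
proof -
  let ?D = "\<lambda>f. linear_part (s (p f))"
  have pI: "p f \<in> aug_ideal R A" "f \<in> carrier B" if "f \<in> aug_ideal R F" for f
    using that by (simp_all add: F.mem_aug_ideal A.mem_aug_ideal aug_homD(6)[OF p_hom] poly_carrier_subset polynomial_simps)
  have "?D (linear_form y) = (\<Oplus>\<^bsub>cotangent\<^esub>i\<in>V. y i \<odot>\<^bsub>cotangent\<^esub> ?D (indexed_var i))"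
  proof (rule linear_form_cotangent_expand[OF module_cotangent y])
    fix f assume f: "f \<in> aug_ideal R F"
    show "?D f \<in> carrier cotangent" by (rule linear_part_cotangent[OF pI(1)[OF f]])
    show "?D (r \<odot>\<^bsub>F\<^esub> f) = r \<odot>\<^bsub>cotangent\<^esub> ?D f" if "r \<in> carrier R" for r
      using that pI[OF f] by (simp add: polynomial_simps aug_homD(5)[OF s_hom] aug_homD(5)[OF p_hom]
          linear_part_def fun_eq_iff power_series_simps cotangent_simps)
    fix g assume g: "g \<in> aug_ideal R F"
    show "?D (f \<oplus>\<^bsub>F\<^esub> g) = ?D f \<oplus>\<^bsub>cotangent\<^esub> ?D g"
      using pI[OF f] pI[OF g]
      by (simp add: polynomial_simps linear_part_def fun_eq_iff power_series_simps cotangent_simps)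
  qed
  moreover have "?D (linear_form y) = y"
  proof
    fix i
    have l: "linear_form y \<in> carrier B" by (rule poly_carrier_subset[OF linear_form_carrier[OF y]])
    then have c: "s (p (linear_form y)) \<in> carrier B" by simp
    have "(s (p (linear_form y)) \<ominus>\<^bsub>B\<^esub> linear_form y) {#i#} = \<zero>"
      using sp_linear_form[OF y] by (simp add: vanishes_below_def)
    then show "?D (linear_form y) i = y i"
      using power_series_closed[OF c] cotangent_closed[OF y]
      by (simp add: power_series_minus[OF c l] linear_part_def)
  qed
  ultimately show ?thesis by (simp add: basis_vector_def)
qed

lemma cotangent_finitely_generated_projective:
  "finitely_generated_module R cotangent" "projective_module R cotangent"
  using P.dual_basis_projective[where I = V and g = basis_vector and \<phi> = "\<lambda>i y. y i"]
    finite_V basis_vector_cotangent cotangent_closed cotangent_expand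
  by (simp_all add: cotangent_simps)

abbreviation "S \<equiv> symmetric_algebra R cotangent"
abbreviation "\<iota> \<equiv> symmetric_var R cotangent"

sublocale S: cring S by (rule cring_augmented_algebra[OF P.augmented_algebra_symmetric])
sublocale S: augmented_algebra R S by (rule P.augmented_algebra_symmetric)

text \<open>
  The algebra homomorphism that extends \<open>linear_form\<close>.  It has polynomial values, so that it can be
  composed with the evaluation \<open>project\<close>; a power series could not be evaluated in the uncompleted
  symmetric algebra.
\<close>
definition embed :: "(('v \<Rightarrow> 'r) multiset \<Rightarrow> 'r) set \<Rightarrow> 'v multiset \<Rightarrow> 'r"
  where "embed = (SOME g. g \<in> aug_hom R S F \<and> (\<forall>y \<in> carrier cotangent. g (\<iota> y) = linear_form y))"

lemma embed_hom: "embed \<in> aug_hom R S F"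
  and embed_sym: "y \<in> carrier cotangent \<Longrightarrow> embed (\<iota> y) = linear_form y"
proof -
  have "\<exists>g. g \<in> aug_hom R S F \<and> (\<forall>y \<in> carrier cotangent. g (\<iota> y) = linear_form y)"
    using P.symmetric_algebra_universal[OF F.augmented_algebra_axioms, of linear_form]
      linear_form_aug_ideal linear_form_add linear_form_smult by blast
  from someI_ex[OF this]
  show "embed \<in> aug_hom R S F" "y \<in> carrier cotangent \<Longrightarrow> embed (\<iota> y) = linear_form y"
    unfolding embed_def by blast+
qed

lemma sym_carrier: "y \<in> carrier cotangent \<Longrightarrow> \<iota> y \<in> carrier S"
  using P.symmetric_var_aug_ideal[of y] by (simp add: S.mem_aug_ideal)

definition project :: "('v multiset \<Rightarrow> 'r) \<Rightarrow> (('v \<Rightarrow> 'r) multiset \<Rightarrow> 'r) set"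
  where "project = eval_poly R S (\<lambda>i. \<iota> (basis_vector i))"

lemma project_hom: "project \<in> aug_hom R F S"
  and project_var: "i \<in> V \<Longrightarrow> project (indexed_var i) = \<iota> (basis_vector i)"
  unfolding project_def
  by (rule eval_poly_aug_hom(1)[OF is_cring S.augmented_algebra_axioms],
      simp add: P.symmetric_var_aug_ideal basis_vector_cotangent,
      rule eval_poly_aug_hom(2)[OF is_cring S.augmented_algebra_axioms, where V = V],
      simp_all add: P.symmetric_var_aug_ideal basis_vector_cotangent)

lemma sym_finsum:
  assumes "finite I" "\<And>i. i \<in> I \<Longrightarrow> c i \<in> carrier R" "\<And>i. i \<in> I \<Longrightarrow> x i \<in> carrier cotangent"
  shows "\<iota> (\<Oplus>\<^bsub>cotangent\<^esub>i\<in>I. c i \<odot>\<^bsub>cotangent\<^esub> x i) = (\<Oplus>\<^bsub>S\<^esub>i\<in>I. c i \<odot>\<^bsub>S\<^esub> \<iota> (x i))"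
  using assms
proof (induction I)
  case empty
  have "\<iota> \<zero>\<^bsub>cotangent\<^esub> = \<iota> (\<zero> \<odot>\<^bsub>cotangent\<^esub> \<zero>\<^bsub>cotangent\<^esub>)" by simp
  also have "\<dots> = \<zero>\<^bsub>S\<^esub>"
    using sym_carrier[of "\<zero>\<^bsub>cotangent\<^esub>"] P.symmetric_var_linear(2)[of \<zero> "\<zero>\<^bsub>cotangent\<^esub>"] by simp
  finally show ?case by simp
next
  case (insert i I)
  have "(\<Oplus>\<^bsub>cotangent\<^esub>i\<in>I. c i \<odot>\<^bsub>cotangent\<^esub> x i) \<in> carrier cotangent"
    using insert by (intro P.M.finsum_closed) auto
  moreover have "(\<Oplus>\<^bsub>cotangent\<^esub>i\<in>insert i I. c i \<odot>\<^bsub>cotangent\<^esub> x i) =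
      c i \<odot>\<^bsub>cotangent\<^esub> x i \<oplus>\<^bsub>cotangent\<^esub> (\<Oplus>\<^bsub>cotangent\<^esub>i\<in>I. c i \<odot>\<^bsub>cotangent\<^esub> x i)"
    using insert by (intro P.M.finsum_insert) auto
  moreover have "(\<Oplus>\<^bsub>S\<^esub>i\<in>insert i I. c i \<odot>\<^bsub>S\<^esub> \<iota> (x i)) =
      c i \<odot>\<^bsub>S\<^esub> \<iota> (x i) \<oplus>\<^bsub>S\<^esub> (\<Oplus>\<^bsub>S\<^esub>i\<in>I. c i \<odot>\<^bsub>S\<^esub> \<iota> (x i))"
    using insert by (intro S.finsum_insert) (auto simp: sym_carrier)
  ultimately show ?case
    using insert P.symmetric_var_linear by simp
qed

lemma project_linear_form:
  assumes y: "y \<in> carrier cotangent"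
  shows "project (linear_form y) = \<iota> y"
proof -
  have mS: "module R S" by (rule S.module)
  have "project (linear_form y) = (\<Oplus>\<^bsub>S\<^esub>i\<in>V. y i \<odot>\<^bsub>S\<^esub> project (indexed_var i))"
    by (rule linear_form_cotangent_expand[OF mS y])
      (simp_all add: F.mem_aug_ideal aug_homD[OF project_hom])
  also have "\<dots> = (\<Oplus>\<^bsub>S\<^esub>i\<in>V. y i \<odot>\<^bsub>S\<^esub> \<iota> (basis_vector i))"
    by (rule S.finsum_cong') (auto simp: project_var sym_carrier basis_vector_cotangent cotangent_closed[OF y])
  also have "\<dots> = \<iota> (\<Oplus>\<^bsub>cotangent\<^esub>i\<in>V. y i \<odot>\<^bsub>cotangent\<^esub> basis_vector i)"
    by (rule sym_finsum[symmetric]) (simp_all add: finite_V basis_vector_cotangent cotangent_closed[OF y])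
  also have "\<dots> = \<iota> y" using cotangent_expand[OF y] by simp
  finally show ?thesis .
qed

text \<open>
  On the generators this is \<open>project_linear_form\<close>.  Thus the symmetric algebra of the summand
  \<open>cotangent\<close> is a retract of the polynomial algebra.
\<close>
lemma project_embed: "x \<in> carrier S \<Longrightarrow> project (embed x) = x"
proof (induction x rule: P.symmetric_induct)
  case (const r)
  then show ?case by (simp add: aug_homD[OF embed_hom] aug_homD[OF project_hom])
next
  case (add y z)
  then show ?case by (simp add: aug_homD[OF embed_hom] aug_homD[OF project_hom])
next
  case (var u y)
  then show ?case
    by (simp add: aug_homD[OF embed_hom] aug_homD[OF project_hom] sym_carrier embed_sym
        linear_form_carrier project_linear_form)
qed

lemma embed_hom_B: "embed \<in> aug_hom R S B"
  using aug_homD[OF embed_hom] by (intro aug_homI) (simp_all add: polynomial_simps poly_carrier_subset)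

sublocale embed: ring_hom_cring S B embed
  by (rule aug_hom_ring_hom_cring[OF S.augmented_algebra_axioms B.augmented_algebra_axioms embed_hom_B])

definition to_A :: "(('v \<Rightarrow> 'r) multiset \<Rightarrow> 'r) set \<Rightarrow> 'a"
  where "to_A x = p (embed x)"

lemma to_A_hom: "to_A \<in> aug_hom R S A"
  unfolding to_A_def using embed_hom_B p_hom by (rule aug_hom_comp)

lemma s_to_A_hom: "(\<lambda>x. s (to_A x)) \<in> aug_hom R S B"
  using to_A_hom s_hom by (rule aug_hom_comp)

text \<open>
  The failure of \<open>s \<circ> to_A\<close> to agree with \<open>embed\<close>.  By \<open>deviation_mult\<close> it satisfies a Leibniz rule
  twisted by these two homomorphisms.
\<close>
definition deviation :: "(('v \<Rightarrow> 'r) multiset \<Rightarrow> 'r) set \<Rightarrow> 'v multiset \<Rightarrow> 'r"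
  where "deviation x = s (to_A x) \<ominus>\<^bsub>B\<^esub> embed x"

lemma deviation_closed: "x \<in> carrier S \<Longrightarrow> deviation x \<in> carrier B"
  by (simp add: deviation_def aug_homD(1)[OF to_A_hom])

lemma deviation_add:
  assumes "x \<in> carrier S" "y \<in> carrier S"
  shows "deviation (x \<oplus>\<^bsub>S\<^esub> y) = deviation x \<oplus>\<^bsub>B\<^esub> deviation y"
proof -
  have c: "s (to_A x) \<in> carrier B" "s (to_A y) \<in> carrier B" "embed x \<in> carrier B" "embed y \<in> carrier B"
    using assms by (simp_all add: aug_homD(1)[OF to_A_hom])
  have "deviation (x \<oplus>\<^bsub>S\<^esub> y) = (s (to_A x) \<oplus>\<^bsub>B\<^esub> s (to_A y)) \<ominus>\<^bsub>B\<^esub> (embed x \<oplus>\<^bsub>B\<^esub> embed y)"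
    using assms by (simp add: deviation_def aug_homD(3)[OF s_to_A_hom])
  also have "\<dots> = deviation x \<oplus>\<^bsub>B\<^esub> deviation y"
    unfolding deviation_def using c by (simp add: a_minus_def B.minus_add B.a_ac)
  finally show ?thesis .
qed

lemma deviation_mult:
  assumes "x \<in> carrier S" "y \<in> carrier S"
  shows "deviation (x \<otimes>\<^bsub>S\<^esub> y) = deviation x \<otimes>\<^bsub>B\<^esub> s (to_A y) \<oplus>\<^bsub>B\<^esub> embed x \<otimes>\<^bsub>B\<^esub> deviation y"
proof -
  have c: "s (to_A x) \<in> carrier B" "s (to_A y) \<in> carrier B" "embed x \<in> carrier B" "embed y \<in> carrier B"
    using assms by (simp_all add: aug_homD(1)[OF to_A_hom])
  have "deviation (x \<otimes>\<^bsub>S\<^esub> y) = s (to_A x) \<otimes>\<^bsub>B\<^esub> s (to_A y) \<ominus>\<^bsub>B\<^esub> embed x \<otimes>\<^bsub>B\<^esub> embed y"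
    using assms by (simp add: deviation_def aug_homD(2)[OF s_to_A_hom])
  also have "\<dots> = deviation x \<otimes>\<^bsub>B\<^esub> s (to_A y) \<oplus>\<^bsub>B\<^esub> embed x \<otimes>\<^bsub>B\<^esub> deviation y"
    unfolding deviation_def using c by algebra
  finally show ?thesis .
qed

text \<open>
  By the Leibniz rule it is enough to look at constants, where the deviation is zero, and at
  generators, which are covered by \<open>sp_linear_form\<close>.
\<close>
lemma deviation_vanishes_2:
  assumes "x \<in> carrier S"
  shows "vanishes_below (Suc (Suc 0)) (deviation x)"
  using assms
proof (induction x rule: P.symmetric_induct)
  case (const r)
  then have "deviation (r \<odot>\<^bsub>S\<^esub> \<one>\<^bsub>S\<^esub>) = \<zero>\<^bsub>B\<^esub>"
    by (simp add: deviation_def aug_homD(4,5)[OF s_to_A_hom] aug_homD(4,5)[OF embed_hom_B] a_minus_def B.r_neg)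
  then show ?case by (simp add: vanishes_below_def power_series_simps)
next
  case (add y z)
  then show ?case by (simp add: deviation_add vanishes_below_add)
next
  case (var u y)
  have u: "\<iota> u \<in> carrier S" using var(1) by (rule sym_carrier)
  have "vanishes_below (Suc (Suc 0)) (deviation (\<iota> u))"
    using sp_linear_form[OF var(1)] var(1) by (simp add: deviation_def to_A_def embed_sym)
  then have "vanishes_below (Suc (Suc 0) + 0) (deviation (\<iota> u) \<otimes>\<^bsub>B\<^esub> s (to_A y))"
    using u var(2) by (intro vanishes_below_mult)
      (simp_all add: deviation_closed aug_homD(1)[OF to_A_hom] vanishes_below_def[of 0])
  moreover have "vanishes_below (0 + Suc (Suc 0)) (embed (\<iota> u) \<otimes>\<^bsub>B\<^esub> deviation y)"
    using u var(2,3) by (intro vanishes_below_mult) (simp_all add: deviation_closed vanishes_below_def[of 0])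
  ultimately show ?case
    using u var(2) by (simp add: deviation_mult vanishes_below_add)
qed

text \<open>
  For \<open>x = a b\<close> with \<open>a\<close> in the \<open>k\<close>-th power and \<open>b\<close> in the augmentation ideal, the two terms of the
  Leibniz rule have orders at least \<open>(k + 1) + 1\<close> and \<open>k + 2\<close>.
\<close>
lemma deviation_vanishes:
  assumes "x \<in> aug_pow R S k"
  shows "vanishes_below (Suc k) (deviation x)"
  using assms
proof (induction k arbitrary: x)
  case 0
  then show ?case
    using deviation_vanishes_2[of x] by (simp add: S.aug_pow_0 vanishes_below_mono)
next
  case (Suc k)
  from Suc.prems show ?case unfolding S.aug_pow_Suc
  proof (induction x rule: ideal_prod.induct)
    case (prod a b)
    have c: "a \<in> carrier S" "b \<in> carrier S" using prod S.aug_pow_carrier by (auto simp: S.mem_aug_ideal)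
    have b: "b \<in> aug_pow R S (Suc 0)" using prod(2) by (simp add: S.aug_pow_1)
    have "vanishes_below (Suc 0) (s (to_A b))"
      by (rule vanishes_below_aug_pow)
        (rule aug_hom_aug_pow[OF S.augmented_algebra_axioms B.augmented_algebra_axioms s_to_A_hom b])
    then have "vanishes_below (Suc k + Suc 0) (deviation a \<otimes>\<^bsub>B\<^esub> s (to_A b))"
      using c Suc.IH[OF prod(1)]
      by (intro vanishes_below_mult) (simp_all add: deviation_closed aug_homD(1)[OF to_A_hom])
    moreover have "vanishes_below k (embed a)"
      by (rule vanishes_below_aug_pow)
        (rule aug_hom_aug_pow[OF S.augmented_algebra_axioms B.augmented_algebra_axioms embed_hom_B prod(1)])
    then have "vanishes_below (k + Suc (Suc 0)) (embed a \<otimes>\<^bsub>B\<^esub> deviation b)"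
      using c deviation_vanishes_2[OF c(2)] by (intro vanishes_below_mult) (simp_all add: deviation_closed)
    ultimately show ?case using c by (simp add: deviation_mult vanishes_below_add)
  next
    case (sum a b)
    have "a \<in> carrier S" "b \<in> carrier S"
      using sum(1,2) S.ideal_prod_in_carrier[OF S.ideal_aug_pow S.ideal_aug_ideal] by auto
    with sum show ?case by (simp add: deviation_add vanishes_below_add)
  qed
qed

text \<open>
  The powers of the augmentation ideal that contain \<open>x\<close> are climbed one at a time.  If \<open>x\<close> lies in
  the \<open>j\<close>-th one, its deviation has order at least \<open>j + 1\<close>, and so has \<open>s (to_A x)\<close> as long as \<open>j < k\<close>;
  hence so has the polynomial \<open>embed x\<close>, and \<open>project\<close> carries this back to \<open>x\<close>.
\<close>
lemma to_A_strict:
  assumes x: "x \<in> carrier S" and tx: "to_A x \<in> aug_pow R A k"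
  shows "x \<in> aug_pow R S k"
proof -
  have "vanishes_below k (s (to_A x))"
    by (rule vanishes_below_aug_pow) (rule aug_hom_aug_pow[OF aug_A B.augmented_algebra_axioms s_hom tx])
  note stx = vanishes_below_mono[OF this]
  have c: "s (to_A x) \<in> carrier B" "deviation x \<in> carrier B" "embed x \<in> carrier B"
    using x by (simp_all add: aug_homD(1)[OF to_A_hom] deviation_closed)
  have embed_eq: "embed x = s (to_A x) \<ominus>\<^bsub>B\<^esub> deviation x"
    unfolding deviation_def using c by algebra
  have "j \<le> k \<Longrightarrow> x \<in> aug_pow R S j" for j
  proof (induction j)
    case 0
    then show ?case using x by (simp add: S.aug_pow_0)
  next
    case (Suc j)
    then have "vanishes_below (Suc j) (deviation x)" by (intro deviation_vanishes) simp
    then have "vanishes_below (Suc j) (embed x)"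
      unfolding embed_eq using stx[OF Suc.prems] c(1,2) by (intro vanishes_below_diff)
    then have "embed x \<in> aug_pow R F (Suc j)"
      using aug_homD(1)[OF embed_hom x] by (intro vanishes_below_polynomial_aug_pow)
    then have "project (embed x) \<in> aug_pow R S (Suc j)"
      by (rule aug_hom_aug_pow[OF F.augmented_algebra_axioms S.augmented_algebra_axioms project_hom])
    then show ?case using project_embed[OF x] by simp
  qed
  then show ?thesis by simp
qed

text \<open>The approximation is the generator given by the linear part of \<open>s a\<close>.\<close>
lemma to_A_approx_ideal:
  assumes a: "a \<in> aug_ideal R A"
  shows "\<exists>x \<in> aug_ideal R S. to_A x \<ominus>\<^bsub>A\<^esub> a \<in> aug_pow R A (Suc (Suc 0))"
proof (rule bexI)
  let ?y = "linear_part (s a)"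
  have y: "?y \<in> carrier cotangent" by (rule linear_part_cotangent[OF a])
  show "\<iota> ?y \<in> aug_ideal R S" by (rule P.symmetric_var_aug_ideal[OF y])
  have c: "linear_form ?y \<in> carrier B" "a \<in> carrier A"
    using poly_carrier_subset[OF linear_form_carrier[OF y]] a by (simp_all add: A.mem_aug_ideal)
  have "p (linear_form ?y \<ominus>\<^bsub>B\<^esub> s a) \<in> aug_pow R A (Suc (Suc 0))"
    by (rule aug_hom_aug_pow[OF B.augmented_algebra_axioms aug_A p_hom linear_form_linear_part[OF a]])
  then show "to_A (\<iota> ?y) \<ominus>\<^bsub>A\<^esub> a \<in> aug_pow R A (Suc (Suc 0))"
    using c by (simp add: to_A_def embed_sym[OF y] p_diff p_s)
qed

text \<open>
  A product \<open>a b\<close> is approximated by the product \<open>x y\<close> of approximations, via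
  \<open>f(x) f(y) - a b = (f(x) - a) b + f(x) (f(y) - b)\<close> where \<open>f\<close> stands for \<open>to_A\<close>.
\<close>
lemma to_A_approx:
  assumes a: "a \<in> aug_pow R A k"
  shows "\<exists>x \<in> aug_pow R S k. to_A x \<ominus>\<^bsub>A\<^esub> a \<in> aug_pow R A (Suc k)"
  using assms
proof (induction k arbitrary: a)
  case 0
  then have a: "a \<in> carrier A" by (simp add: A.aug_pow_0)
  let ?x = "aug A a \<odot>\<^bsub>S\<^esub> \<one>\<^bsub>S\<^esub>"
  have r: "aug A a \<in> carrier R" using augD(1)[OF aug_A a] .
  have x: "?x \<in> carrier S" using r by simp
  have "to_A ?x \<ominus>\<^bsub>A\<^esub> a \<in> aug_ideal R A"
    using a r x by (simp add: A.aug_eq_iff aug_homD[OF to_A_hom] augD[OF aug_A])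
  then show ?case using x by (intro bexI[of _ ?x]) (simp_all add: S.aug_pow_0 A.aug_pow_1)
next
  case (Suc k)
  from Suc.prems show ?case unfolding A.aug_pow_Suc[of k]
  proof (induction a rule: ideal_prod.induct)
    case (prod a b)
    obtain x where x: "x \<in> aug_pow R S k" "to_A x \<ominus>\<^bsub>A\<^esub> a \<in> aug_pow R A (Suc k)"
      using Suc.IH[OF prod(1)] by blast
    obtain y where y: "y \<in> aug_ideal R S" "to_A y \<ominus>\<^bsub>A\<^esub> b \<in> aug_pow R A (Suc (Suc 0))"
      using to_A_approx_ideal[OF prod(2)] by blast
    have xy: "x \<otimes>\<^bsub>S\<^esub> y \<in> aug_pow R S (Suc k)" by (rule S.aug_pow_mult_Suc[OF x(1) y(1)])
    have cS: "x \<in> carrier S" "y \<in> carrier S" using x(1) y(1) S.aug_pow_carrier by (auto simp: S.mem_aug_ideal)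
    have c: "to_A x \<in> carrier A" "to_A y \<in> carrier A" "a \<in> carrier A" "b \<in> carrier A"
      using cS prod A.aug_pow_carrier by (auto simp: aug_homD(1)[OF to_A_hom] A.mem_aug_ideal)
    have "to_A (x \<otimes>\<^bsub>S\<^esub> y) \<ominus>\<^bsub>A\<^esub> a \<otimes>\<^bsub>A\<^esub> b = to_A x \<otimes>\<^bsub>A\<^esub> to_A y \<ominus>\<^bsub>A\<^esub> a \<otimes>\<^bsub>A\<^esub> b"
      using cS by (simp add: aug_homD(2)[OF to_A_hom])
    also have "\<dots> = (to_A x \<ominus>\<^bsub>A\<^esub> a) \<otimes>\<^bsub>A\<^esub> b \<oplus>\<^bsub>A\<^esub> to_A x \<otimes>\<^bsub>A\<^esub> (to_A y \<ominus>\<^bsub>A\<^esub> b)"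
      using c by algebra
    also have "\<dots> \<in> aug_pow R A (Suc (Suc k))"
      by (intro A.aug_pow_closed(1) A.aug_pow_mult_Suc[OF x(2) prod(2)] A.aug_pow_mult_Suc_Suc[OF _ y(2)]
          aug_hom_aug_pow[OF S.augmented_algebra_axioms aug_A to_A_hom x(1)])
    finally show ?case using xy by blast
  next
    case (sum a b)
    obtain x where x: "x \<in> aug_pow R S (Suc k)" "to_A x \<ominus>\<^bsub>A\<^esub> a \<in> aug_pow R A (Suc (Suc k))"
      using sum(3) by blast
    obtain y where y: "y \<in> aug_pow R S (Suc k)" "to_A y \<ominus>\<^bsub>A\<^esub> b \<in> aug_pow R A (Suc (Suc k))"
      using sum(4) by blast
    have cS: "x \<in> carrier S" "y \<in> carrier S" using x(1) y(1) S.aug_pow_carrier by auto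
    have "a \<in> carrier A" "b \<in> carrier A"
      using sum(1,2) A.ideal_prod_in_carrier[OF A.ideal_aug_pow A.ideal_aug_ideal] by auto
    then have "to_A (x \<oplus>\<^bsub>S\<^esub> y) \<ominus>\<^bsub>A\<^esub> (a \<oplus>\<^bsub>A\<^esub> b) = (to_A x \<ominus>\<^bsub>A\<^esub> a) \<oplus>\<^bsub>A\<^esub> (to_A y \<ominus>\<^bsub>A\<^esub> b)"
      using cS by (simp add: aug_homD(1,3)[OF to_A_hom] a_minus_def A.minus_add A.a_ac)
    then have "to_A (x \<oplus>\<^bsub>S\<^esub> y) \<ominus>\<^bsub>A\<^esub> (a \<oplus>\<^bsub>A\<^esub> b) \<in> aug_pow R A (Suc (Suc k))"
      using A.aug_pow_closed(1)[OF x(2) y(2)] by simp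
    moreover have "x \<oplus>\<^bsub>S\<^esub> y \<in> aug_pow R S (Suc k)" by (rule S.aug_pow_closed(1)[OF x(1) y(1)])
    ultimately show ?case by blast
  qed
qed

text \<open>Successive approximation: the error at stage \<open>k\<close> is corrected by \<open>to_A_approx\<close>.\<close>
lemma to_A_dense:
  assumes a: "a \<in> carrier A"
  shows "\<exists>x \<in> carrier S. to_A x \<ominus>\<^bsub>A\<^esub> a \<in> aug_pow R A k"
proof (induction k)
  case 0
  then show ?case using a by (intro bexI[of _ "\<zero>\<^bsub>S\<^esub>"]) (simp_all add: A.aug_pow_0 aug_homD(1)[OF to_A_hom])
next
  case (Suc k)
  then obtain x where x: "x \<in> carrier S" "to_A x \<ominus>\<^bsub>A\<^esub> a \<in> aug_pow R A k" by blast
  have c: "to_A x \<in> carrier A" using x(1) by (rule aug_homD(1)[OF to_A_hom])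
  have "\<ominus>\<^bsub>A\<^esub> (to_A x \<ominus>\<^bsub>A\<^esub> a) \<in> aug_pow R A k" by (rule A.aug_pow_closed(2)[OF x(2)])
  from to_A_approx[OF this] obtain z where z: "z \<in> aug_pow R S k"
    "to_A z \<ominus>\<^bsub>A\<^esub> (\<ominus>\<^bsub>A\<^esub> (to_A x \<ominus>\<^bsub>A\<^esub> a)) \<in> aug_pow R A (Suc k)" by blast
  have zc: "z \<in> carrier S" "to_A z \<in> carrier A"
    using z(1) S.aug_pow_carrier by (auto intro: aug_homD(1)[OF to_A_hom])
  have "to_A (x \<oplus>\<^bsub>S\<^esub> z) \<ominus>\<^bsub>A\<^esub> a = (to_A x \<oplus>\<^bsub>A\<^esub> to_A z) \<ominus>\<^bsub>A\<^esub> a"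
    using x(1) zc(1) by (simp add: aug_homD(3)[OF to_A_hom])
  also have "\<dots> = to_A z \<ominus>\<^bsub>A\<^esub> (\<ominus>\<^bsub>A\<^esub> (to_A x \<ominus>\<^bsub>A\<^esub> a))"
    using c zc(2) a by algebra
  finally show ?case using z(2) x(1) zc(1) by (intro bexI[of _ "x \<oplus>\<^bsub>S\<^esub> z"]) simp_all
qed

theorem isomorphic_completed_symmetric_algebra:
  "complete_aug_isomorphic R A (completed_symmetric_algebra R cotangent)"
  unfolding completed_symmetric_algebra_def
  using complete_A S.augmented_algebra_axioms to_A_hom to_A_dense to_A_strict
  by (rule isomorphic_aug_completionI)

end

theorem theorem1p1:
  fixes R :: "('r, 'k) ring_scheme" and n :: nat
    and A :: "('r, 'a, 'l) aug_algebra_scheme"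
  assumes "cring R"
    and "complete_aug_retract R A (power_series_algebra R {1..n})"
  shows "\<exists>P :: ('r, nat \<Rightarrow> 'r) module.
    finitely_generated_module R P \<and> projective_module R P \<and>
    complete_aug_isomorphic R A (completed_symmetric_algebra R P)"
proof -
  obtain s p where "s \<in> aug_hom R A (power_series_algebra R {1..n})"
    "p \<in> aug_hom R (power_series_algebra R {1..n}) A" "\<And>a. a \<in> carrier A \<Longrightarrow> p (s a) = a"
    and "complete_augmented_algebra R A"
    using assms(2) unfolding complete_aug_retract_def by blast
  then interpret power_series_retract R "{1..n}" A s p
    using assms(1) by (intro power_series_retract.intro power_series_retract_axioms.intro) auto
  show ?thesis
    using cotangent_finitely_generated_projective isomorphic_completed_symmetric_algebra by blast
qed

end
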